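(* The arithmetic progression $p\equiv 11027\pmod{44100}$ contains infinitely many primes. For every such prime $p$, put $n=2p$. Then none of the integers $n-1,n+1,n+2,n+3,n+4$ is a prime power. Moreover, for every $c\in\mathbb F_p$, the permutation $\mathcal B_{-1,c,p}$ of $\mathbb Z_{2p}$ is APN. Consequently, $n$ is neither of the form $r+1$ nor of any of the forms $r-j$ with $1\le j\le 4$, where $r$ is a prime power.
   Context: $\mathbb Z_n=\mathbb Z/n\mathbb Z$. The differential uniformity of $F:\mathbb Z_n\to\mathbb Z_n$ is $\delta(F)=\max_{u\neq 0,\,v\in\mathbb Z_n}\#\{x\in\mathbb Z_n: F(x+u)-F(x)=v\}$, and $F$ is called APN if $\delta(F)=2$. Let $p\ge 11$ be a prime, $a\in\mathbb F_p^*$, $c\in\mathbb F_p$. $\chi$ is the quadratic character of $\mathbb F_p$ (with $\chi(0)=0$), and $\rho(x)=1$ if $\chi(x)=1$, $\rho(x)=0$ otherwise (so $\rho(0)=0$). For $z\in\mathbb Z_{2p}$ let $E(z)=(1-(-1)^z)/2\in\{0,1\}$ (the parity of $z$) and let $X_c(z)\in\mathbb F_p$ be the residue class of $z+cE(z)$ modulo $p$. In $\mathbb F_p$ set $A_a(z)=1+(a-1)E(z)$ and $Y_{a,c,p}(z)=A_a(z)X_c(z)^{p-2}$. Let $R_{c,p}(z)\in\{0,1\}$ be congruent modulo $2$ to $\rho(X_c(z))+E(z)\bigl(1-\chi(X_c(z))^2\bigr)$. Define $\mathcal B_{a,c,p}:\mathbb Z_{2p}\to\mathbb Z_{2p}$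 by $$\mathcal B_{a,c,p}(z)\equiv pR_{c,p}(z)+(p+1)Y_{a,c,p}(z)\pmod{2p},$$ where $Y_{a,c,p}(z)$ is replaced by any integer representative (the result is independent of the choice since $2p\mid p(p+1)$). Here $a=-1$. *)

theory Defs
  imports "HOL-Number_Theory.Number_Theory" "HOL-Number_Theory.Prime_Powers"
begin

(* The ring Z/nZ is represented by the integers 0, ..., n - 1, with arithmetic modulo n. A map
   Z/nZ -> Z/nZ is a function on int, of which only the values on this carrier matter. *)
definition Zmod :: "nat \<Rightarrow> int set" where
  "Zmod n = {0..<int n}"

definition differential_uniformity :: "nat \<Rightarrow> (int \<Rightarrow> int) \<Rightarrow> nat" where
  "differential_uniformity n F =
     Max {card {x \<in> Zmod n. (F ((x + u) mod int n) - F x) mod int n = v} | u v.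
            u \<in> Zmod n \<and> u \<noteq> 0 \<and> v \<in> Zmod n}"

definition APN :: "nat \<Rightarrow> (int \<Rightarrow> int) \<Rightarrow> bool" where
  "APN n F \<longleftrightarrow> differential_uniformity n F = 2"

(* The quadratic character of F_p is the Legendre symbol, with value 0 at 0. *)
definition rho :: "nat \<Rightarrow> int \<Rightarrow> int" where
  "rho p x = (if Legendre x (int p) = 1 then 1 else 0)"

(* parity_bit z = (1 - (-1)^z) / 2 *)
definition parity_bit :: "int \<Rightarrow> int" where
  "parity_bit z = z mod 2"

(* Below, a and c are integer representatives of elements of F_p. *)
definition X_res :: "int \<Rightarrow> nat \<Rightarrow> int \<Rightarrow> int" where
  "X_res c p z = (z + c * parity_bit z) mod int p"

definition A_coeff :: "int \<Rightarrow> nat \<Rightarrow> int \<Rightarrow> int" where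
  "A_coeff a p z = (1 + (a - 1) * parity_bit z) mod int p"

definition Y_res :: "int \<Rightarrow> int \<Rightarrow> nat \<Rightarrow> int \<Rightarrow> int" where
  "Y_res a c p z = (A_coeff a p z * X_res c p z ^ (p - 2)) mod int p"

definition R_bit :: "int \<Rightarrow> nat \<Rightarrow> int \<Rightarrow> int" where
  "R_bit c p z = (rho p (X_res c p z) + parity_bit z * (1 - (Legendre (X_res c p z) (int p))\<^sup>2)) mod 2"

definition B_map :: "int \<Rightarrow> int \<Rightarrow> nat \<Rightarrow> int \<Rightarrow> int" where
  "B_map a c p z = (int p * R_bit c p z + (int p + 1) * Y_res a c p z) mod int (2 * p)"

end

theory Submission
  imports Defs "HOL-Computational_Algebra.Squarefree"
begin

text \<open>Two independent arguments meet here: Dirichlet's theorem on primes in an arithmetic progression, and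
a count of solutions of a difference equation over \<open>\<F>\<^sub>p\<close>.

\<^bold>\<open>Infinitely many primes.\<close> Since \<open>11027\<close> is coprime to \<open>44100\<close>, this is Dirichlet's theorem. It is
proved for every modulus \<open>N\<close> with real and complex numbers but without complex analysis, by comparing,
for each character \<open>\<chi>\<close> modulo \<open>N\<close>, the sum \<open>S\<^sub>\<chi>(x) = \<Sum>\<^bsub>n \<le> x\<^esub> \<chi>(n) \<Lambda>(n) / n\<close> with \<open>ln x\<close>. Up to a bounded
error, \<open>S\<^sub>\<chi>(x)\<close> is \<open>ln x\<close> for the principal character (Mertens), \<open>0\<close> if \<open>L(1, \<chi>) \<noteq> 0\<close>, and \<open>- ln x\<close> if
\<open>L(1, \<chi>) = 0\<close> (\<open>mangoldt_sum_principal\<close>, \<open>mangoldt_sum_bounded\<close>, \<open>mangoldt_sum_of_vanishing\<close>). The sum of all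
the \<open>S\<^sub>\<chi>(x)\<close> is nonnegative, because it is a multiple of the sum of \<open>\<Lambda>(n) / n\<close> over \<open>n \<equiv> 1\<close>; so at most one
\<open>L(1, \<chi>)\<close> vanishes (\<open>vanishing_characters_unique\<close>). A non-real \<open>\<chi>\<close> would vanish together with its
conjugate, and a real \<open>\<chi>\<close> is excluded by Monsky's argument: the power series whose coefficients are the
nonnegative numbers \<open>\<Sum>\<^bsub>d | n\<^esub> \<chi>(d)\<close> is unbounded near \<open>1\<close>, but would be bounded if \<open>L(1, \<chi>) = 0\<close>
(\<open>real_character.L_nonvanishing\<close>). Hence only the principal character contributes to the progression of
\<open>l\<close>, the sum of \<open>\<Lambda>(n) / n\<close> over \<open>n \<equiv> l\<close> diverges, and the proper prime powers account only for a bounded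
part of it.

\<^bold>\<open>Prime powers.\<close> The residue of \<open>p\<close> modulo \<open>44100 = 2\<^sup>2 3\<^sup>2 5\<^sup>2 7\<^sup>2\<close> makes \<open>3\<close>, \<open>5\<close>, \<open>7\<close>, \<open>2\<close> exact divisors of
\<open>2 p - 1\<close>, \<open>2 p + 1\<close>, \<open>2 p + 3\<close>, \<open>2 p + 4\<close>, and makes \<open>2 p + 2\<close> divisible by \<open>6\<close>.

\<^bold>\<open>The APN property.\<close> The congruences also give \<open>\<chi>(-1) = \<chi>(-3) = \<chi>(5) = -1\<close> for the quadratic character
of \<open>\<F>\<^sub>p\<close>, and these three values carry the argument. In the coordinates (parity, \<open>X\<close>) the
element \<open>z\<close> is sent to the pair consisting of \<open>R\<close> modulo \<open>2\<close> and \<open>\<sigma> / X\<close> modulo \<open>p\<close>, where \<open>\<sigma> = 1\<close> for even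
\<open>z\<close> and \<open>\<sigma> = -1\<close> for odd \<open>z\<close>, and \<open>1 / 0\<close> is \<open>0\<close>. Clearing denominators in \<open>F(z + u) - F(z) = v\<close> gives a quadratic
equation for \<open>X\<close> on each parity class.

If \<open>u\<close> is even, the parity of \<open>v\<close> records \<open>\<chi>(\<sigma> u v)\<close>, so by \<open>\<chi>(-1) = -1\<close> only one parity class can contain
solutions, and that class has at most two. If \<open>u\<close> is odd, the substitution \<open>h = \<plusminus> v X - 1\<close> turns the
quadratic into one with product of roots \<open>-1\<close>, and the parity of \<open>v\<close> records \<open>\<chi>(h)\<close>; as \<open>\<chi>(-1) = -1\<close>, the two
roots belong to different parities of \<open>v\<close>, so each class of \<open>z\<close> has at most one solution. The
remaining solutions, for which a denominator vanishes, force the quadratic to have discriminant \<open>-3\<close>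
or \<open>5\<close> times a square; these are nonsquares, so such a solution is the only one in its parity
class.\<close>

section \<open>Summation by parts and sums over divisors\<close>

text \<open>Abel summation: with \<open>F\<close> the partial sums of \<open>f\<close>, the sum equals two boundary terms plus the
sum of \<open>F\<close> against the decrements of \<open>b\<close>. The decrements are nonnegative and telescope, so the bound
on \<open>F\<close> and the first weight control everything.\<close>

lemma summation_by_parts_bound:
  fixes f :: "nat \<Rightarrow> 'a::real_normed_field" and b :: "nat \<Rightarrow> real"
  assumes bounded: "\<And>n. norm (\<Sum>k<n. f k) \<le> C"
    and decr: "\<And>k. M \<le> k \<Longrightarrow> b (Suc k) \<le> b k" and nonneg: "\<And>k. M \<le> k \<Longrightarrow> 0 \<le> b k"
    and "M \<le> n"
  shows "norm (\<Sum>k=M..<n. f k * of_real (b k)) \<le> 2 * C * b M"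
proof -
  define F where "F n = (\<Sum>k<n. f k)" for n
  have parts: "(\<Sum>k=M..<n. f k * of_real (b k))
      = F n * of_real (b n) - F M * of_real (b M) + (\<Sum>k=M..<n. F (Suc k) * of_real (b k - b (Suc k)))"
    using \<open>M \<le> n\<close>
    by (induction n rule: dec_induct) (simp_all add: F_def algebra_simps)
  have term_bound: "norm (F i * of_real x) \<le> C * x" if "0 \<le> x" for i x
    using that bounded[of i] by (simp add: norm_mult F_def mult_right_mono)
  have "norm (\<Sum>k=M..<n. F (Suc k) * of_real (b k - b (Suc k))) \<le> (\<Sum>k=M..<n. C * (b k - b (Suc k)))"
    by (rule sum_norm_le, rule term_bound) (use decr in auto)
  also have "\<dots> = C * (b M - b n)"
    using \<open>M \<le> n\<close> by (induction n rule: dec_induct) (simp_all add: algebra_simps)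
  finally have variation: "norm (\<Sum>k=M..<n. F (Suc k) * of_real (b k - b (Suc k))) \<le> C * (b M - b n)" .
  have "norm (\<Sum>k=M..<n. f k * of_real (b k))
     \<le> norm (F n * of_real (b n)) + norm (F M * of_real (b M))
        + norm (\<Sum>k=M..<n. F (Suc k) * of_real (b k - b (Suc k)))"
    unfolding parts by (smt (verit) norm_triangle_ineq norm_triangle_ineq4)
  also have "\<dots> \<le> C * b n + C * b M + C * (b M - b n)"
    using variation term_bound[of "b n" n] term_bound[of "b M" M] nonneg[of n] nonneg[of M] \<open>M \<le> n\<close>
    by linarith
  also have "\<dots> = 2 * C * b M" by (simp add: algebra_simps)
  finally show ?thesis .
qed

text \<open>Each block of the series is bounded by the weight at its start. Hence the Cauchy criterion
holds, and letting the end of the block tend to infinity bounds the tail.\<close>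

lemma summation_by_parts_tail:
  fixes f :: "nat \<Rightarrow> 'a::{real_normed_field, banach}" and b :: "nat \<Rightarrow> real"
  assumes bounded: "\<And>n. norm (\<Sum>k<n. f k) \<le> C"
    and decr: "\<And>k. M\<^sub>0 \<le> k \<Longrightarrow> b (Suc k) \<le> b k" and nonneg: "\<And>k. M\<^sub>0 \<le> k \<Longrightarrow> 0 \<le> b k"
    and vanish: "b \<longlonglongrightarrow> 0"
  shows "summable (\<lambda>k. f k * of_real (b k))"
    and "M\<^sub>0 \<le> M \<Longrightarrow> norm ((\<Sum>k<M. f k * of_real (b k)) - (\<Sum>k. f k * of_real (b k))) \<le> 2 * C * b M"
proof -
  have C: "0 \<le> C" using bounded[of 0] by simp
  have block: "norm (\<Sum>k=M..<n. f k * of_real (b k)) \<le> 2 * C * b M" if "M\<^sub>0 \<le> M" "M \<le> n" for M n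
    by (rule summation_by_parts_bound[OF bounded]) (use that decr nonneg in auto)
  show *: "summable (\<lambda>k. f k * of_real (b k))"
    unfolding summable_Cauchy
  proof (intro allI impI)
    fix e :: real assume "0 < e"
    have "(\<lambda>k. 2 * C * b k) \<longlonglongrightarrow> 2 * C * 0" by (intro tendsto_intros vanish)
    then have "\<forall>\<^sub>F k in sequentially. 2 * C * b k < e"
      using \<open>0 < e\<close> by (simp add: order_tendsto_iff)
    then obtain K where "\<And>k. K \<le> k \<Longrightarrow> 2 * C * b k < e" by (auto simp: eventually_sequentially)
    then show "\<exists>N. \<forall>m\<ge>N. \<forall>n. norm (\<Sum>k=m..<n. f k * of_real (b k)) < e"
      using \<open>0 < e\<close> block
      by (intro exI[of _ "max K M\<^sub>0"]) (smt (verit) atLeastLessThan_empty le_cases max.bounded_iff norm_zero sum.empty)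
  qed
  assume M: "M\<^sub>0 \<le> M"
  have "(\<lambda>n. norm ((\<Sum>k<M. f k * of_real (b k)) - (\<Sum>k<n. f k * of_real (b k))))
      \<longlonglongrightarrow> norm ((\<Sum>k<M. f k * of_real (b k)) - (\<Sum>k. f k * of_real (b k)))"
    by (intro tendsto_intros summable_LIMSEQ *)
  moreover have "norm ((\<Sum>k<M. f k * of_real (b k)) - (\<Sum>k<n. f k * of_real (b k))) \<le> 2 * C * b M" if "M \<le> n" for n
  proof -
    have "(\<Sum>k<n. f k * of_real (b k)) - (\<Sum>k<M. f k * of_real (b k)) = (\<Sum>k=M..<n. f k * of_real (b k))"
      using that by (simp add: sum_diff_nat_ivl lessThan_atLeast0)
    then show ?thesis using block[OF M that] by (metis norm_minus_commute)
  qed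
  ultimately show "norm ((\<Sum>k<M. f k * of_real (b k)) - (\<Sum>k. f k * of_real (b k))) \<le> 2 * C * b M"
    by (intro Lim_bounded[of _ _ M]) auto
qed

text \<open>Both sides run over the pairs \<open>(d, m)\<close> with \<open>d m \<le> x\<close>. In this form partial sums of a Dirichlet
convolution are evaluated below.\<close>

lemma sum_over_divisors:
  fixes f :: "nat \<Rightarrow> nat \<Rightarrow> 'a::comm_monoid_add"
  shows "(\<Sum>n=1..x. \<Sum>d | d dvd n. f d (n div d)) = (\<Sum>d=1..x. \<Sum>m=1..x div d. f d m)"
proof -
  have "(\<Sum>n=1..x. \<Sum>d | d dvd n. f d (n div d)) = (\<Sum>(n, d) \<in> (SIGMA n:{1..x}. {d. d dvd n}). f d (n div d))"
    by (rule sum.Sigma) auto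
  also have "\<dots> = (\<Sum>(d, m) \<in> (SIGMA d:{1..x}. {1..x div d}). f d m)"
    by (rule sum.reindex_bij_witness[of _ "\<lambda>(d, m). (d * m, d)" "\<lambda>(n, d). (d, n div d)"])
      (auto simp: div_le_mono Suc_le_eq less_eq_div_iff_mult_less_eq mult.commute dvd_imp_le
        intro!: Nat.gr0I intro: order.trans[OF dvd_imp_le])
  also have "\<dots> = (\<Sum>d=1..x. \<Sum>m=1..x div d. f d m)"
    by (rule sum.Sigma[symmetric]) auto
  finally show ?thesis .
qed

section \<open>The estimates of Chebyshev and Mertens\<close>

lemma ln_Suc_diff_le: "0 < k \<Longrightarrow> ln (real (Suc k)) - ln (real k) \<le> 1 / real k"
  using ln_div[of "real (Suc k)" "real k"] ln_add_one_self_le_self[of "1 / real k"]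
  by (simp add: add_divide_distrib add.commute)

lemma ln_fact_eq_sum_ln: "ln (fact x :: real) = (\<Sum>n=1..x. ln (real n))"
  by (induction x) (simp_all add: ln_mult add.commute)

lemma ln_fact_eq_sum_mangoldt: "ln (fact x) = (\<Sum>d=1..x. mangoldt d * real (x div d))"
proof -
  have "ln (fact x :: real) = (\<Sum>n=1..x. ln (real n))" by (rule ln_fact_eq_sum_ln)
  also have "\<dots> = (\<Sum>n=1..x. \<Sum>d | d dvd n. mangoldt d)"
    by (intro sum.cong) (auto simp: mangoldt_sum)
  also have "\<dots> = (\<Sum>d=1..x. \<Sum>m=1..x div d. mangoldt d)" by (rule sum_over_divisors)
  finally show ?thesis by (simp add: mult.commute)
qed

text \<open>A weak form of Stirling's formula, precise enough because an error of order \<open>x\<close> is harmless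
in Mertens' theorem.\<close>

lemma ln_fact_bounds:
  assumes "1 \<le> x"
  shows "real x * ln (real x) - real x \<le> ln (fact x)" "ln (fact x) \<le> real x * ln (real x)"
proof -
  have "fact x \<le> real x ^ x" using fact_le_power[of x, where ?'a = real] by simp
  then have "ln (fact x) \<le> ln (real x ^ x)"
    using assms by (subst ln_le_cancel_iff) auto
  then show "ln (fact x) \<le> real x * ln (real x)" using assms by (simp add: ln_realpow)
  show "real x * ln (real x) - real x \<le> ln (fact x)"
    using assms
  proof (induction x rule: dec_induct)
    case (step n)
    have "real n * (ln (real (Suc n)) - ln (real n)) \<le> 1"
      using step ln_Suc_diff_le[of n] by (simp add: field_simps)
    then have "real (Suc n) * ln (real (Suc n)) - real (Suc n)
        \<le> real n * ln (real n) - real n + ln (real (Suc n))"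
      by (simp add: algebra_simps)
    also have "\<dots> \<le> ln (fact n) + ln (real (Suc n))" using step by simp
    finally show ?case using step by (simp add: ln_mult add.commute)
  qed auto
qed

text \<open>The logarithm of \<open>2 n choose n\<close> is the sum of \<open>\<Lambda>(d) (\<lfloor>2 n / d\<rfloor> - 2 \<lfloor>n / d\<rfloor>)\<close>. All these coefficients
of \<open>\<Lambda>\<close> are nonnegative, those with \<open>n < d \<le> 2 n\<close> are \<open>1\<close>, and the binomial coefficient is at most \<open>4 ^ n\<close>.
So \<open>\<Lambda>\<close> sums to at most \<open>2 n\<close> over \<open>n < d \<le> 2 n\<close>, and halving \<open>x\<close> repeatedly yields a linear bound.\<close>

lemma chebyshev_bound: "(\<Sum>d=1..x. mangoldt d) \<le> 4 * real x"
proof (induction x rule: less_induct)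
  case (less x)
  show ?case
  proof (cases "x \<le> 1")
    case True
    then have "(\<Sum>d=1..x. mangoldt d) = (0::real)" by (cases x) auto
    then show ?thesis by simp
  next
    case False
    define n where "n = x div 2"
    have n: "1 \<le> n" "n < x" "2 * n \<le> x" "x \<le> 2 * n + 1" using False by (auto simp: n_def)
    have sub: "(\<Sum>d=n+1..2*n. mangoldt d) \<le> (\<Sum>d=1..2*n. mangoldt d * (real (2 * n div d) - 2 * real (n div d)))"
    proof -
      have "(\<Sum>d=n+1..2*n. mangoldt d) = (\<Sum>d=n+1..2*n. mangoldt d * (real (2 * n div d) - 2 * real (n div d)))"
      proof (intro sum.cong refl)
        fix d assume d: "d \<in> {n+1..2*n}"
        then have "2 * n div d = 1" by (intro div_nat_eqI) auto
        moreover have "n div d = 0" using d by auto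
        ultimately show "mangoldt d = mangoldt d * (real (2 * n div d) - 2 * real (n div d))" by simp
      qed
      also have "\<dots> \<le> (\<Sum>d=1..2*n. mangoldt d * (real (2 * n div d) - 2 * real (n div d)))"
      proof (intro sum_mono2)
        fix d
        have "2 * (n div d) \<le> 2 * n div d"
          by (metis div_mult2_eq div_times_less_eq_dividend less_eq_div_iff_mult_less_eq mult.assoc mult.commute mult_le_mono2 bot_nat_0.not_eq_extremum div_0 div_by_0 le_refl mult_0_right)
        then show "0 \<le> mangoldt d * (real (2 * n div d) - 2 * real (n div d))"
          by (intro mult_nonneg_nonneg mangoldt_nonneg) linarith
      qed auto
      finally show ?thesis .
    qed
    also have "\<dots> = (\<Sum>d=1..2*n. mangoldt d * real (2 * n div d)) - 2 * (\<Sum>d=1..2*n. mangoldt d * real (n div d))"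
      by (simp add: sum_subtractf algebra_simps sum_distrib_left)
    also have "(\<Sum>d=1..2*n. mangoldt d * real (n div d)) = (\<Sum>d=1..n. mangoldt d * real (n div d))"
      by (intro sum.mono_neutral_right) auto
    also have "(\<Sum>d=1..2*n. mangoldt d * real (2 * n div d)) - 2 * (\<Sum>d=1..n. mangoldt d * real (n div d))
        = ln (fact (2 * n)) - 2 * ln (fact n)"
      by (simp only: ln_fact_eq_sum_mangoldt)
    also have "\<dots> = ln (real ((2 * n) choose n))"
      by (subst binomial_fact) (simp_all add: ln_div ln_mult)
    also have "\<dots> \<le> ln (2 ^ (2 * n))"
    proof -
      have "(2 * n) choose n \<le> 2 ^ (2 * n)" by (rule binomial_le_pow2)
      then have "real ((2 * n) choose n) \<le> 2 ^ (2 * n)" by (metis of_nat_le_iff of_nat_numeral of_nat_power)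
      then show ?thesis by (subst ln_le_cancel_iff) auto
    qed
    also have "\<dots> = 2 * real n * ln 2" by (simp add: ln_realpow)
    also have "\<dots> \<le> 2 * real n * 1" by (intro mult_left_mono) (use ln_2_less_1 in auto)
    finally have upper: "(\<Sum>d=n+1..2*n. mangoldt d) \<le> 2 * real n" by simp
    have IH: "(\<Sum>d=1..n. mangoldt d) \<le> 4 * real n" using less n by simp
    have last: "(mangoldt x :: real) \<le> x" using mangoldt_le[of x] ln_bound[of "real x"] False by simp
    have split: "(\<Sum>d=1..2*n. mangoldt d) = (\<Sum>d=1..n. mangoldt d) + (\<Sum>d=n+1..2*n. mangoldt d :: real)"
      using sum.ub_add_nat[of 1 n "mangoldt :: nat \<Rightarrow> real" n] by (simp add: mult_2)
    have even_part: "(\<Sum>d=1..2*n. mangoldt d) \<le> 6 * real n" using split upper IH by simp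
    show ?thesis
    proof (cases "x = 2 * n")
      case True
      then show ?thesis using even_part by simp
    next
      case odd: False
      then have x: "x = Suc (2 * n)" using n by simp
      have "(\<Sum>d=1..x. mangoldt d) = (\<Sum>d=1..2*n. mangoldt d) + (mangoldt x :: real)" by (simp add: x)
      also have "\<dots> \<le> 6 * real n + real x" using even_part last by simp
      also have "\<dots> \<le> 4 * real x" using x by simp
      finally show ?thesis .
    qed
  qed
qed

text \<open>Replacing \<open>\<lfloor>x / d\<rfloor>\<close> by \<open>x / d\<close> in the formula for \<open>ln (x!)\<close> costs at most the sum of \<open>\<Lambda>\<close> up to \<open>x\<close>, which
is of order \<open>x\<close>; division by \<open>x\<close> leaves a bounded error.\<close>

lemma mertens_bound:
  assumes "1 \<le> x"
  shows "\<bar>(\<Sum>d=1..x. mangoldt d / real d) - ln (real x)\<bar> \<le> 4"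
proof -
  have frac: "real (x div d) \<le> real x / real d \<and> real x / real d \<le> real (x div d) + 1" if "1 \<le> d" for d
  proof -
    have "real x \<le> real (d + d * (x div d))"
      using dividend_less_times_div[of d x] that by linarith
    then have "real x \<le> (real (x div d) + 1) * real d" by (simp add: algebra_simps)
    then show ?thesis using of_nat_div_le_of_nat[of x d, where ?'a = real] that by (simp add: divide_le_eq)
  qed
  have "ln (fact x) \<le> (\<Sum>d=1..x. mangoldt d * (real x / real d))"
    unfolding ln_fact_eq_sum_mangoldt by (intro sum_mono mult_left_mono mangoldt_nonneg) (use frac in auto)
  then have "ln (fact x) \<le> real x * (\<Sum>d=1..x. mangoldt d / real d)"
    by (simp add: sum_distrib_left mult.commute)
  then have "real x * (ln (real x) - 1) \<le> real x * (\<Sum>d=1..x. mangoldt d / real d)"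
    using ln_fact_bounds(1)[OF assms] by (simp add: algebra_simps)
  then have lower: "ln (real x) - 1 \<le> (\<Sum>d=1..x. mangoldt d / real d)" using assms by simp
  have "(\<Sum>d=1..x. mangoldt d * (real x / real d)) \<le> (\<Sum>d=1..x. mangoldt d * (real (x div d) + 1))"
    by (intro sum_mono mult_left_mono mangoldt_nonneg) (use frac in auto)
  also have "\<dots> = ln (fact x) + (\<Sum>d=1..x. mangoldt d)"
    by (simp add: ln_fact_eq_sum_mangoldt algebra_simps sum.distrib)
  also have "\<dots> \<le> real x * ln (real x) + 4 * real x"
    using ln_fact_bounds(2)[OF assms] chebyshev_bound[of x] by linarith
  finally have "real x * (\<Sum>d=1..x. mangoldt d / real d) \<le> real x * (ln (real x) + 4)"
    by (simp add: sum_distrib_left mult.commute distrib_left)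
  then have "(\<Sum>d=1..x. mangoldt d / real d) \<le> ln (real x) + 4" using assms by simp
  with lower show ?thesis by simp
qed

section \<open>Dirichlet characters\<close>

definition dirichlet_character :: "nat \<Rightarrow> (nat \<Rightarrow> complex) \<Rightarrow> bool" where
  "dirichlet_character N \<chi> \<longleftrightarrow> \<chi> 1 = 1 \<and> (\<forall>m n. \<chi> (m * n) = \<chi> m * \<chi> n) \<and>
     (\<forall>m n. [m = n] (mod N) \<longrightarrow> \<chi> m = \<chi> n) \<and> (\<forall>n. \<chi> n = 0 \<longleftrightarrow> \<not> coprime n N)"

lemma dirichlet_characterD:
  assumes "dirichlet_character N \<chi>"
  shows "\<chi> (Suc 0) = 1" "\<chi> (m * n) = \<chi> m * \<chi> n" "[m = n] (mod N) \<Longrightarrow> \<chi> m = \<chi> n"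
    "\<chi> n = 0 \<longleftrightarrow> \<not> coprime n N"
  using assms by (auto simp: dirichlet_character_def)

lemma dirichlet_character_power:
  assumes "dirichlet_character N \<chi>"
  shows "\<chi> (n ^ k) = \<chi> n ^ k"
  by (induction k) (use dirichlet_characterD[OF assms] in auto)

lemma dirichlet_character_root_of_unity:
  assumes "dirichlet_character N \<chi>" "coprime n N"
  shows "\<chi> n ^ totient N = 1"
  using euler_theorem[OF assms(2)] dirichlet_characterD[OF assms(1)]
  by (metis One_nat_def dirichlet_character_power[OF assms(1)])

lemma norm_dirichlet_character_le:
  assumes "dirichlet_character N \<chi>" "0 < N"
  shows "norm (\<chi> n) \<le> 1"
proof (cases "coprime n N")
  case True
  then have "norm (\<chi> n) ^ totient N = 1"
    using dirichlet_character_root_of_unity[OF assms(1)] by (metis norm_one norm_power)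
  then have "norm (\<chi> n) = 1" using assms(2) power_eq_imp_eq_base[of "norm (\<chi> n)" "totient N" 1] by simp
  then show ?thesis by simp
next
  case False
  then have "\<chi> n = 0" using dirichlet_characterD(4)[OF assms(1)] by blast
  then show ?thesis by simp
qed

lemma finite_dirichlet_characters:
  assumes "0 < N"
  shows "finite {\<chi>. dirichlet_character N \<chi>}"
proof -
  let ?V = "insert 0 {z::complex. z ^ totient N = 1}"
  have "{\<chi>. dirichlet_character N \<chi>} \<subseteq> (\<lambda>f n. f (n mod N)) ` ({..<N} \<rightarrow>\<^sub>E ?V)"
  proof
    fix \<chi> assume "\<chi> \<in> {\<chi>. dirichlet_character N \<chi>}"
    then have \<chi>: "dirichlet_character N \<chi>" by simp
    have "\<chi> n = restrict \<chi> {..<N} (n mod N)" for n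
      using dirichlet_characterD(3)[OF \<chi>, of n "n mod N"] assms by (simp add: cong_def)
    moreover have "restrict \<chi> {..<N} \<in> {..<N} \<rightarrow>\<^sub>E ?V"
      using dirichlet_character_root_of_unity[OF \<chi>] dirichlet_characterD(4)[OF \<chi>] by auto
    ultimately show "\<chi> \<in> (\<lambda>f n. f (n mod N)) ` ({..<N} \<rightarrow>\<^sub>E ?V)" by blast
  qed
  moreover have "finite ({..<N} \<rightarrow>\<^sub>E ?V)"
    by (rule finite_PiE) (use assms in \<open>auto intro!: finite_roots_unity simp: Suc_le_eq\<close>)
  ultimately show ?thesis by (meson finite_imageI finite_subset)
qed

lemma dirichlet_character_mult:
  assumes "dirichlet_character N \<chi>" "dirichlet_character N \<psi>"
  shows "dirichlet_character N (\<lambda>n. \<chi> n * \<psi> n)"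
  unfolding dirichlet_character_def
proof (intro conjI allI impI)
  fix m n assume "[m = n] (mod N)"
  then show "\<chi> m * \<psi> m = \<chi> n * \<psi> n"
    using dirichlet_characterD(3)[OF assms(1)] dirichlet_characterD(3)[OF assms(2)] by simp
qed (use dirichlet_characterD(1,2,4)[OF assms(1)] dirichlet_characterD(1,2,4)[OF assms(2)] in simp_all)

lemma dirichlet_character_cnj:
  assumes "dirichlet_character N \<chi>"
  shows "dirichlet_character N (\<lambda>n. cnj (\<chi> n))"
  unfolding dirichlet_character_def
proof (intro conjI allI impI)
  fix m n assume "[m = n] (mod N)"
  then show "cnj (\<chi> m) = cnj (\<chi> n)" using dirichlet_characterD(3)[OF assms] by simp
qed (use dirichlet_characterD(1,2,4)[OF assms] in simp_all)

text \<open>A character of a subgroup of the units modulo \<open>N\<close>. The subgroup is represented by the set \<open>S\<close>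
of all natural numbers in its residue classes; values of \<open>\<chi>\<close> outside \<open>S\<close> are arbitrary. Closure under
inverses follows from finiteness.\<close>

definition partial_character :: "nat \<Rightarrow> nat set \<Rightarrow> (nat \<Rightarrow> complex) \<Rightarrow> bool" where
  "partial_character N S \<chi> \<longleftrightarrow> S \<subseteq> {n. coprime n N} \<and> 1 \<in> S \<and>
     (\<forall>m\<in>S. \<forall>n\<in>S. m * n \<in> S \<and> \<chi> (m * n) = \<chi> m * \<chi> n) \<and>
     (\<forall>m\<in>S. \<forall>n. [m = n] (mod N) \<longrightarrow> n \<in> S \<and> \<chi> n = \<chi> m) \<and> \<chi> 1 = 1"

lemma partial_characterD:
  assumes "partial_character N S \<chi>"
  shows "m \<in> S \<Longrightarrow> coprime m N" "1 \<in> S" "m \<in> S \<Longrightarrow> n \<in> S \<Longrightarrow> m * n \<in> S"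
    "m \<in> S \<Longrightarrow> n \<in> S \<Longrightarrow> \<chi> (m * n) = \<chi> m * \<chi> n"
    "m \<in> S \<Longrightarrow> [m = n] (mod N) \<Longrightarrow> n \<in> S" "m \<in> S \<Longrightarrow> [m = n] (mod N) \<Longrightarrow> \<chi> n = \<chi> m" "\<chi> 1 = 1"
proof -
  have sub: "S \<subseteq> {n. coprime n N}" and "1 \<in> S" "\<chi> 1 = 1"
    and mult: "\<forall>m\<in>S. \<forall>n\<in>S. m * n \<in> S \<and> \<chi> (m * n) = \<chi> m * \<chi> n"
    and cong: "\<forall>m\<in>S. \<forall>n. [m = n] (mod N) \<longrightarrow> n \<in> S \<and> \<chi> n = \<chi> m"
    using assms unfolding partial_character_def by (blast, blast, blast, blast, blast)
  show "1 \<in> S" "\<chi> 1 = 1" by fact+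
  show "coprime m N" if "m \<in> S" using sub that by blast
  show "m * n \<in> S" "\<chi> (m * n) = \<chi> m * \<chi> n" if "m \<in> S" "n \<in> S" using mult that by blast+
  show "n \<in> S" "\<chi> n = \<chi> m" if "m \<in> S" "[m = n] (mod N)" using cong that by blast+
qed

lemma partial_character_power:
  assumes "partial_character N S \<chi>" "m \<in> S"
  shows "m ^ k \<in> S" "\<chi> (m ^ k) = \<chi> m ^ k"
proof -
  have "m ^ k \<in> S \<and> \<chi> (m ^ k) = \<chi> m ^ k"
  proof (induction k)
    case (Suc k)
    then show ?case using partial_characterD(3,4)[OF assms(1) assms(2), of "m ^ k"] by simp
  qed (use partial_characterD(2,7)[OF assms(1)] in simp)
  then show "m ^ k \<in> S" "\<chi> (m ^ k) = \<chi> m ^ k" by auto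
qed

text \<open>The power \<open>s ^ (totient N - 1)\<close> is an inverse of \<open>s\<close> modulo \<open>N\<close> that lies in \<open>S\<close>.\<close>

lemma partial_character_cancel:
  assumes "partial_character N S \<chi>" "0 < N" "s \<in> S" "s * h \<in> S"
  shows "h \<in> S"
proof -
  note D = partial_characterD[OF assms(1)]
  have "s ^ (totient N - 1) * (s * h) = s ^ totient N * h"
    using assms(2) by (metis mult.assoc mult.commute power_minus_mult totient_gt_0_iff)
  also have "[s ^ totient N * h = 1 * h] (mod N)"
    using euler_theorem[OF D(1)[OF assms(3)]] by (rule cong_scalar_right)
  finally have "[s ^ (totient N - 1) * (s * h) = h] (mod N)" by simp
  then show ?thesis
    using D(5)[OF D(3)[OF partial_character_power(1)[OF assms(1,3)] assms(4)]] by blast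
qed

text \<open>The subgroup generated by \<open>S\<close> and \<open>g\<close> consists of the classes of \<open>s * g ^ i\<close>, which are sent to
\<open>\<chi> s * z ^ i\<close>. Two representations of one class differ by a power \<open>g ^ d\<close> that lies in \<open>S\<close>; then \<open>k\<close> divides
\<open>d\<close>, and \<open>z ^ k = \<chi> (g ^ k)\<close> makes the two values agree.\<close>

lemma extend_partial_character_by_element:
  assumes pc: "partial_character N S \<chi>" and "0 < N" "coprime g N" "0 < k" "g ^ k \<in> S"
    and least: "\<And>j. 0 < j \<Longrightarrow> g ^ j \<in> S \<Longrightarrow> k \<le> j" and z: "z ^ k = \<chi> (g ^ k)"
  obtains T \<psi> where "partial_character N T \<psi>" "S \<subseteq> T" "g \<in> T" "\<psi> g = z" "\<And>s. s \<in> S \<Longrightarrow> \<psi> s = \<chi> s"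
proof -
  note D = partial_characterD[OF pc]
  note cancel = partial_character_cancel[OF pc \<open>0 < N\<close>]
  have power_in_S: "\<chi> (g ^ d) = z ^ d" if "g ^ d \<in> S" for d
  proof -
    have d: "g ^ d = (g ^ k) ^ (d div k) * g ^ (d mod k)"
      by (metis mult_div_mod_eq power_add power_mult)
    then have "g ^ (d mod k) \<in> S"
      using that cancel partial_character_power(1)[OF pc \<open>g ^ k \<in> S\<close>] by metis
    then have "d mod k = 0" using least[of "d mod k"] \<open>0 < k\<close> by (metis mod_less_divisor not_le gr0I)
    then have "d = k * (d div k)" by auto
    then have "g ^ d = (g ^ k) ^ (d div k)" "z ^ d = (z ^ k) ^ (d div k)"
      by (metis power_mult)+
    then show ?thesis using partial_character_power(2)[OF pc \<open>g ^ k \<in> S\<close>] z by simp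
  qed
  have aux: "\<chi> s * z ^ i = \<chi> t * z ^ j"
    if "j \<le> i" "s \<in> S" "t \<in> S" "[s * g ^ i = t * g ^ j] (mod N)" for s t i j
  proof -
    have "[s * g ^ (i - j) * g ^ j = t * g ^ j] (mod N)"
      using that(1,4) by (metis le_add_diff_inverse2 mult.assoc power_add)
    then have st: "[t = s * g ^ (i - j)] (mod N)"
      using \<open>coprime g N\<close> by (simp add: cong_mult_rcancel_nat cong_sym)
    then have in_S: "g ^ (i - j) \<in> S" using cancel[OF \<open>s \<in> S\<close>] D(5)[OF \<open>t \<in> S\<close>] by blast
    have "\<chi> t = \<chi> s * z ^ (i - j)"
      using D(6)[OF \<open>t \<in> S\<close> st] D(4)[OF \<open>s \<in> S\<close> in_S] power_in_S[OF in_S] by simp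
    then show ?thesis using that(1) by (simp add: mult.assoc flip: power_add)
  qed
  have well_defined: "\<chi> s * z ^ i = \<chi> t * z ^ j"
    if "s \<in> S" "t \<in> S" "[s * g ^ i = t * g ^ j] (mod N)" for s t i j
    using aux[of j i s t] aux[of i j t s] that cong_sym by (metis le_cases)
  define T where "T = {n. \<exists>s i. s \<in> S \<and> [n = s * g ^ i] (mod N)}"
  define \<psi> where "\<psi> n = (SOME w. \<exists>s i. s \<in> S \<and> [n = s * g ^ i] (mod N) \<and> w = \<chi> s * z ^ i)" for n
  have \<psi>: "\<psi> n = \<chi> s * z ^ i" if "s \<in> S" "[n = s * g ^ i] (mod N)" for n s i
    unfolding \<psi>_def
  proof (rule some_equality)
    show "\<exists>t j. t \<in> S \<and> [n = t * g ^ j] (mod N) \<and> \<chi> s * z ^ i = \<chi> t * z ^ j" using that by blast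
    show "w = \<chi> s * z ^ i" if "\<exists>t j. t \<in> S \<and> [n = t * g ^ j] (mod N) \<and> w = \<chi> t * z ^ j" for w
      using that well_defined \<open>s \<in> S\<close> \<open>[n = s * g ^ i] (mod N)\<close> by (metis cong_sym cong_trans)
  qed
  have "partial_character N T \<psi>"
    unfolding partial_character_def
  proof (intro conjI ballI allI impI subsetI)
    fix n assume "n \<in> T"
    then show "n \<in> {n. coprime n N}"
      using D(1) \<open>coprime g N\<close> unfolding T_def
      by (auto dest!: cong_imp_coprime[OF cong_sym])
  next
    show "1 \<in> T" unfolding T_def using D(2) by (intro CollectI exI[of _ 1] exI[of _ 0]) auto
    show "\<psi> 1 = 1" using \<psi>[OF D(2), of 1 0] D(7) by simp
  next
    fix m n assume "m \<in> T" "n \<in> T"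
    then obtain s t i j where s: "s \<in> S" "[m = s * g ^ i] (mod N)" and t: "t \<in> S" "[n = t * g ^ j] (mod N)"
      unfolding T_def by blast
    then have mn: "[m * n = s * t * g ^ (i + j)] (mod N)"
      using cong_mult[OF s(2) t(2)] by (simp add: power_add ac_simps)
    show "m * n \<in> T" unfolding T_def using mn D(3)[OF s(1) t(1)] by blast
    show "\<psi> (m * n) = \<psi> m * \<psi> n"
      using \<psi>[OF D(3)[OF s(1) t(1)] mn] \<psi>[OF s] \<psi>[OF t] D(4)[OF s(1) t(1)] by (simp add: power_add)
  next
    fix m n assume "m \<in> T" "[m = n] (mod N)"
    then obtain s i where s: "s \<in> S" "[m = s * g ^ i] (mod N)" "[n = s * g ^ i] (mod N)"
      unfolding T_def using cong_sym cong_trans by blast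
    then show "n \<in> T" "\<psi> n = \<psi> m" unfolding T_def using \<psi> by auto
  qed
  moreover have "s \<in> T" if "s \<in> S" for s
    unfolding T_def using that by (intro CollectI exI[of _ s] exI[of _ 0]) simp
  then have "S \<subseteq> T" by blast
  moreover have "g \<in> T"
    unfolding T_def using D(2) by (intro CollectI exI[of _ 1]) (auto intro: exI[of _ 1])
  moreover have "\<psi> g = z" using \<psi>[OF D(2), of g 1] D(7) by simp
  moreover have "\<psi> s = \<chi> s" if "s \<in> S" for s using \<psi>[OF that, of s 0] by simp
  ultimately show ?thesis by (rule that)
qed

lemma complex_root_exists:
  fixes w :: complex
  assumes "0 < k"
  obtains z where "z ^ k = w"
proof -
  have "rcis (root k (cmod w)) (Arg w / k) ^ k = w"
    using assms by (simp add: DeMoivre2 rcis_cmod_Arg)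
  then show ?thesis using that by blast
qed

text \<open>Adjoining one missing residue class after another, each time with some \<open>k\<close>-th root as the new
value, reaches the whole group of units, because that group is finite.\<close>

lemma extend_partial_character:
  assumes "partial_character N S \<chi>" "0 < N"
  obtains \<psi> where "dirichlet_character N \<psi>" "\<And>s. s \<in> S \<Longrightarrow> \<psi> s = \<chi> s"
proof -
  have "\<exists>\<psi>. dirichlet_character N \<psi> \<and> (\<forall>s\<in>S. \<psi> s = \<chi> s)"
    using assms(1)
  proof (induction "card ({n. n < N \<and> coprime n N} - S)" arbitrary: S \<chi> rule: less_induct)
    case less
    note D = partial_characterD[OF less.prems]
    show ?case
    proof (cases "\<forall>g. coprime g N \<longrightarrow> g \<in> S")
      case True
      have "dirichlet_character N (\<lambda>n. if coprime n N then \<chi> n else 0)"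
        unfolding dirichlet_character_def
      proof (intro conjI allI impI)
        fix m n assume mn: "[m = n] (mod N)"
        then have "coprime m N \<longleftrightarrow> coprime n N" by (meson cong_imp_coprime cong_sym)
        then show "(if coprime m N then \<chi> m else 0) = (if coprime n N then \<chi> n else 0)"
          using D(6)[OF _ mn] True by auto
      next
        fix n
        show "((if coprime n N then \<chi> n else 0) = 0) = (\<not> coprime n N)"
        proof (cases "coprime n N")
          case cop: True
          have "[1 = n ^ totient N] (mod N)" by (rule cong_sym[OF euler_theorem[OF cop]])
          then have "\<chi> n ^ totient N = 1"
            using D(6)[OF D(2)] D(7) partial_character_power(2)[OF less.prems] cop True by metis
          then have "\<chi> n \<noteq> 0" using \<open>0 < N\<close> by (auto simp: power_0_left split: if_splits)
          then show ?thesis using cop by simp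
        qed simp
      next
        fix m n
        show "(if coprime (m * n) N then \<chi> (m * n) else 0)
            = (if coprime m N then \<chi> m else 0) * (if coprime n N then \<chi> n else 0)"
          using D(4)[of m n] True by simp
      qed (use D(7) in simp)
      then show ?thesis using D(1) by (intro exI[of _ "\<lambda>n. if coprime n N then \<chi> n else 0"]) auto
    next
      case False
      then obtain g where g: "coprime g N" "g \<notin> S" by blast
      define k where "k = (LEAST j. 0 < j \<and> g ^ j \<in> S)"
      have "0 < totient N \<and> g ^ totient N \<in> S"
        using \<open>0 < N\<close> D(5)[OF D(2) cong_sym[OF euler_theorem[OF g(1)]]] by simp
      then have k: "0 < k \<and> g ^ k \<in> S" unfolding k_def by (rule LeastI)
      have least: "k \<le> j" if "0 < j" "g ^ j \<in> S" for j unfolding k_def using that by (simp add: Least_le)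
      obtain z where "z ^ k = \<chi> (g ^ k)" using complex_root_exists k by metis
      then obtain T \<psi> where T: "partial_character N T \<psi>" "S \<subseteq> T" "g \<in> T" "\<And>s. s \<in> S \<Longrightarrow> \<psi> s = \<chi> s"
        using extend_partial_character_by_element[OF less.prems \<open>0 < N\<close> g(1) _ _ least] k by metis
      have "g mod N \<in> T" "g mod N \<notin> S"
        using partial_characterD(5)[OF T(1,3), of "g mod N"] D(5)[of "g mod N" g] g by (auto simp: cong_def)
      moreover have "g mod N < N" "coprime (g mod N) N" using \<open>0 < N\<close> g by auto
      ultimately have "{n. n < N \<and> coprime n N} - T \<subset> {n. n < N \<and> coprime n N} - S" using T(2) by auto
      then have "card ({n. n < N \<and> coprime n N} - T) < card ({n. n < N \<and> coprime n N} - S)"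
        by (intro psubset_card_mono) auto
      from less.hyps[OF this T(1)] show ?thesis using T(2,4) by (metis subsetD)
    qed
  qed
  then show ?thesis using that by blast
qed

text \<open>On the trivial subgroup, \<open>a\<close> can be adjoined with any root of unity of order dividing the order
of \<open>a\<close> as its value; since \<open>a\<close> has order greater than \<open>1\<close>, that value can be chosen different from \<open>1\<close>.\<close>

lemma exists_separating_character:
  assumes "0 < N" "coprime a N" "\<not> [a = 1] (mod N)"
  obtains \<chi> where "dirichlet_character N \<chi>" "\<chi> a \<noteq> 1"
proof -
  let ?S = "{n. [n = 1] (mod N)}"
  have trivial: "partial_character N ?S (\<lambda>_. 1)"
    unfolding partial_character_def
  proof (intro conjI ballI allI impI subsetI)
    show "m * n \<in> ?S" if "m \<in> ?S" "n \<in> ?S" for m n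
      using that cong_mult[of m 1 N n 1] by simp
    show "n \<in> {n. coprime n N}" if "n \<in> ?S" for n
      using that cong_imp_coprime[OF cong_sym, of n 1 N] by simp
    show "n \<in> ?S" if "m \<in> ?S" "[m = n] (mod N)" for m n
      using that cong_trans cong_sym by blast
  qed simp_all
  define k where "k = ord N a"
  have ak: "0 < k" "a ^ k \<in> ?S" using assms ord[of a N] by (auto simp: k_def coprime_commute)
  have least: "k \<le> j" if "0 < j" "a ^ j \<in> ?S" for j
    using that ord_divides[of a j N] by (auto simp: k_def intro: dvd_imp_le)
  have "k \<noteq> 1" using ak(2) assms(3) by auto
  then have "card {z::complex. z ^ k = 1} \<noteq> 1" using card_roots_unity_eq[OF \<open>0 < k\<close>] by simp
  then have "{z::complex. z ^ k = 1} \<noteq> {1}" by force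
  then obtain z :: complex where z: "z ^ k = 1" "z \<noteq> 1" by auto
  obtain T \<psi> where T: "partial_character N T \<psi>" "a \<in> T" "\<psi> a = z"
    using extend_partial_character_by_element[OF trivial assms(1,2) ak least z(1)] by metis
  obtain \<chi> where "dirichlet_character N \<chi>" "\<And>s. s \<in> T \<Longrightarrow> \<chi> s = \<psi> s"
    using extend_partial_character[OF T(1) assms(1)] by blast
  then show ?thesis using that T z(2) by metis
qed

text \<open>Multiplication by a fixed character \<open>\<psi>\<close> permutes all characters, so the sum is unchanged when
multiplied by \<open>\<psi> a\<close>; if \<open>\<psi>\<close> separates \<open>a\<close> from \<open>1\<close>, the sum is \<open>0\<close>.\<close>

lemma character_orthogonality:
  assumes "0 < N"
  shows "(\<Sum>\<chi> | dirichlet_character N \<chi>. \<chi> a)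
    = (if [a = 1] (mod N) then of_nat (card {\<chi>. dirichlet_character N \<chi>}) else 0)"
proof -
  consider "[a = 1] (mod N)" | "\<not> coprime a N" | "coprime a N" "\<not> [a = 1] (mod N)" by blast
  then show ?thesis
  proof cases
    case 1
    have "(\<Sum>\<chi> | dirichlet_character N \<chi>. \<chi> a) = (\<Sum>\<chi> | dirichlet_character N \<chi>. 1)"
      by (intro sum.cong refl) (use 1 dirichlet_characterD in \<open>metis One_nat_def mem_Collect_eq\<close>)
    then show ?thesis using 1 by simp
  next
    case 2
    then have "\<not> [a = 1] (mod N)" using cong_imp_coprime[OF cong_sym, of a 1 N] by auto
    moreover have "(\<Sum>\<chi> | dirichlet_character N \<chi>. \<chi> a) = 0"
      by (intro sum.neutral) (use 2 dirichlet_characterD(4) in blast)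
    ultimately show ?thesis by simp
  next
    case 3
    obtain \<psi> where \<psi>: "dirichlet_character N \<psi>" "\<psi> a \<noteq> 1"
      using exists_separating_character[OF assms 3] .
    define shift where "shift = (\<lambda>\<chi> n. \<psi> n * \<chi> n :: complex)"
    have "inj_on shift {\<chi>. dirichlet_character N \<chi>}"
    proof (rule inj_onI)
      fix \<chi> \<chi>' assume \<chi>: "\<chi> \<in> {\<chi>. dirichlet_character N \<chi>}" "\<chi>' \<in> {\<chi>. dirichlet_character N \<chi>}"
        and eq: "shift \<chi> = shift \<chi>'"
      show "\<chi> = \<chi>'"
      proof
        fix n
        have "\<psi> n * \<chi> n = \<psi> n * \<chi>' n" using eq by (metis shift_def)
        moreover have "\<psi> n = 0 \<Longrightarrow> \<chi> n = 0 \<and> \<chi>' n = 0" using \<chi> \<psi>(1) dirichlet_characterD(4) by blast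
        ultimately show "\<chi> n = \<chi>' n" by auto
      qed
    qed
    moreover have "shift ` {\<chi>. dirichlet_character N \<chi>} \<subseteq> {\<chi>. dirichlet_character N \<chi>}"
      using dirichlet_character_mult[OF \<psi>(1)] by (auto simp: shift_def)
    ultimately have "bij_betw shift {\<chi>. dirichlet_character N \<chi>} {\<chi>. dirichlet_character N \<chi>}"
      using endo_inj_surj[OF finite_dirichlet_characters[OF assms]] by (auto simp: bij_betw_def)
    then have "(\<Sum>\<chi> | dirichlet_character N \<chi>. \<chi> a) = (\<Sum>\<chi> | dirichlet_character N \<chi>. shift \<chi> a)"
      by (rule sum.reindex_bij_betw[symmetric])
    also have "\<dots> = \<psi> a * (\<Sum>\<chi> | dirichlet_character N \<chi>. \<chi> a)"
      by (simp add: shift_def sum_distrib_left)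
    finally show ?thesis using \<psi>(2) 3 by simp
  qed
qed

text \<open>Multiplication by \<open>a\<close> permutes the residues modulo \<open>N\<close>, so the sum over one period is unchanged
by the factor \<open>\<chi> a \<noteq> 1\<close> and vanishes. Only an incomplete period remains.\<close>

lemma character_sum_bound:
  assumes \<chi>: "dirichlet_character N \<chi>" and "0 < N" and a: "coprime a N" "\<chi> a \<noteq> 1"
  shows "norm (\<Sum>n<m. \<chi> n) \<le> real N"
proof -
  note D = dirichlet_characterD[OF \<chi>]
  have "inj_on (\<lambda>n. a * n mod N) {..<N}"
  proof (rule inj_onI)
    fix m n assume mn: "m \<in> {..<N}" "n \<in> {..<N}" and "a * m mod N = a * n mod N"
    then have "[m = n] (mod N)" using a(1) by (simp add: cong_mult_lcancel_nat flip: cong_def)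
    then show "m = n" using mn by (simp add: cong_def)
  qed
  moreover have "(\<lambda>n. a * n mod N) ` {..<N} \<subseteq> {..<N}" using \<open>0 < N\<close> by auto
  ultimately have "bij_betw (\<lambda>n. a * n mod N) {..<N} {..<N}"
    using endo_inj_surj[of "{..<N}" "\<lambda>n. a * n mod N"] by (simp add: bij_betw_def)
  then have "(\<Sum>n<N. \<chi> n) = (\<Sum>n<N. \<chi> (a * n mod N))" by (rule sum.reindex_bij_betw[symmetric])
  also have "\<dots> = \<chi> a * (\<Sum>n<N. \<chi> n)"
    unfolding sum_distrib_left by (intro sum.cong refl) (use D(2) D(3)[of "a * n mod N" "a * n" for n] in \<open>auto simp: cong_def\<close>)
  finally have period: "(\<Sum>n<N. \<chi> n) = 0" using a(2) by simp
  show ?thesis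
  proof (induction m rule: less_induct)
    case (less m)
    show ?case
    proof (cases "m < N")
      case True
      have "norm (\<Sum>n<m. \<chi> n) \<le> (\<Sum>n<m. 1)"
        by (rule sum_norm_le) (rule norm_dirichlet_character_le[OF \<chi> \<open>0 < N\<close>])
      then show ?thesis using True by simp
    next
      case False
      have shift: "(\<Sum>n<N + k. \<chi> n) = (\<Sum>n<N. \<chi> n) + (\<Sum>n<k. \<chi> n)" for k
        by (induction k) (use D(3)[of "N + n" n for n] in \<open>auto simp: cong_def\<close>)
      have "(\<Sum>n<m. \<chi> n) = (\<Sum>n<m - N. \<chi> n)" using shift[of "m - N"] period False by simp
      then show ?thesis using less.IH[of "m - N"] False \<open>0 < N\<close> by simp
    qed
  qed
qed

section \<open>The Moebius function\<close>

definition moebius :: "nat \<Rightarrow> real" where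
  "moebius n = (if squarefree n then (- 1) ^ card (prime_factors n) else 0)"

lemma abs_moebius_le: "\<bar>moebius n\<bar> \<le> 1"
  by (simp add: moebius_def power_abs)

lemma moebius_1 [simp]: "moebius (Suc 0) = 1"
  by (simp add: moebius_def)

lemma moebius_prime_mult:
  assumes "prime q" "squarefree d" "\<not> q dvd d"
  shows "squarefree (q * d)" "moebius (q * d) = - moebius d"
proof -
  have "coprime q d" using assms by (simp add: prime_imp_coprime)
  then show *: "squarefree (q * d)"
    using assms by (intro squarefree_mult_coprime) (auto simp: squarefree_prime)
  have "d \<noteq> 0" using assms by (auto intro: Nat.gr0I)
  then have "prime_factors (q * d) = insert q (prime_factors d)"
    using assms(1) by (auto simp: prime_factors_product prime_prime_factors)
  moreover have "q \<notin> prime_factors d" using assms(3) by auto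
  ultimately show "moebius (q * d) = - moebius d" using * assms(2) by (simp add: moebius_def)
qed

text \<open>If \<open>q\<close> is a prime divisor of \<open>n\<close>, the squarefree divisors of \<open>n\<close> fall into pairs \<open>d\<close>, \<open>q d\<close> with
\<open>d\<close> prime to \<open>q\<close>, and the two members of a pair have opposite signs.\<close>

lemma sum_moebius_divisors:
  assumes "0 < n"
  shows "(\<Sum>d | d dvd n. moebius d) = (if n = 1 then 1 else 0)"
proof (cases "n = 1")
  case True
  then show ?thesis by (simp add: moebius_def)
next
  case False
  then obtain q where q: "prime q" "q dvd n" using prime_factor_nat by blast
  define A where "A = {d. d dvd n \<and> squarefree d \<and> \<not> q dvd d}"
  have fin: "finite A" unfolding A_def using assms by (auto intro: finite_subset[OF _ finite_divisors_nat])
  have "{d. d dvd n \<and> squarefree d} = A \<union> (\<lambda>d. q * d) ` A"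
  proof (intro equalityI subsetI)
    fix d assume d: "d \<in> {d. d dvd n \<and> squarefree d}"
    show "d \<in> A \<union> (\<lambda>d. q * d) ` A"
    proof (cases "q dvd d")
      case True
      then obtain e where e: "d = q * e" by blast
      have "\<not> q dvd e"
      proof
        assume "q dvd e"
        then have "q ^ 2 dvd d" unfolding e power2_eq_square by (rule mult_dvd_mono[OF dvd_refl])
        then show False using d q(1) by (auto simp: squarefree_def)
      qed
      moreover have "squarefree e" using d e squarefree_mono[of e d] by simp
      moreover have "e dvd n" using d e dvd_mult_right by blast
      ultimately show ?thesis using e by (auto simp: A_def)
    qed (use d in \<open>simp add: A_def\<close>)
  next
    fix d assume "d \<in> A \<union> (\<lambda>d. q * d) ` A"
    then consider "d \<in> A" | e where "d = q * e" "e \<in> A" by blast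
    then show "d \<in> {d. d dvd n \<and> squarefree d}"
    proof cases
      case 2
      then have "coprime q e" using q(1) by (simp add: A_def prime_imp_coprime)
      then have "q * e dvd n" using 2 q(2) by (intro divides_mult) (auto simp: A_def)
      then show ?thesis using 2 moebius_prime_mult(1)[OF q(1)] by (simp add: A_def)
    qed (simp add: A_def)
  qed
  moreover have "(\<Sum>d | d dvd n. moebius d) = (\<Sum>d | d dvd n \<and> squarefree d. moebius d)"
    using assms by (intro sum.mono_neutral_right) (auto simp: moebius_def)
  ultimately have "(\<Sum>d | d dvd n. moebius d) = (\<Sum>d\<in>A. moebius d) + (\<Sum>d\<in>(\<lambda>d. q * d) ` A. moebius d)"
    using fin by (subst sum.union_disjoint[symmetric]) (auto simp: A_def)
  also have "(\<Sum>d\<in>(\<lambda>d. q * d) ` A. moebius d) = (\<Sum>d\<in>A. moebius (q * d))"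
    using q(1) by (subst sum.reindex) (auto simp: inj_on_def)
  also have "\<dots> = - (\<Sum>d\<in>A. moebius d)"
    unfolding sum_negf[symmetric]
    by (intro sum.cong refl) (auto simp: A_def moebius_prime_mult(2)[OF q(1)])
  finally show ?thesis using False by simp
qed

text \<open>Moebius inversion of \<open>\<Sum>\<^bsub>d | n\<^esub> \<Lambda>(d) = ln n\<close>. The extra term at \<open>n = 1\<close> is what makes \<open>ln x\<close> appear in
\<open>mangoldt_sum_of_vanishing\<close>.\<close>

lemma sum_moebius_ln:
  assumes "0 < n" "0 < x"
  shows "(\<Sum>d | d dvd n. moebius d * ln (x / real d)) = (if n = 1 then ln x else 0) + mangoldt n"
proof -
  have swap: "(\<Sum>d | d dvd n. \<Sum>e | e dvd n div d. moebius d * mangoldt e)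
      = (\<Sum>e | e dvd n. \<Sum>d | d dvd n div e. moebius d * (mangoldt e :: real))"
  proof -
    have pos: "0 < n div d" if "d dvd n" for d using that assms(1) by (auto elim!: dvdE)
    have iff: "d dvd n \<and> e dvd n div d \<longleftrightarrow> d * e dvd n" for d e
      using assms(1) by (metis dvd_div_iff_mult dvd_mult_left dvd_0_left_iff less_numeral_extra(3) mult.commute)
    have swap_iff: "d dvd n \<and> e dvd n div d \<longleftrightarrow> e dvd n \<and> d dvd n div e" for d e
      using iff[of d e] iff[of e d] by (simp add: mult.commute)
    have "(\<Sum>d | d dvd n. \<Sum>e | e dvd n div d. moebius d * mangoldt e)
       = (\<Sum>(d, e) \<in> (SIGMA d:{d. d dvd n}. {e. e dvd n div d}). moebius d * mangoldt e)"
      by (rule sum.Sigma) (use assms(1) pos in auto)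
    also have "\<dots> = (\<Sum>(e, d) \<in> (SIGMA e:{e. e dvd n}. {d. d dvd n div e}). moebius d * mangoldt e)"
      by (rule sum.reindex_bij_witness[of _ "\<lambda>(e, d). (d, e)" "\<lambda>(d, e). (e, d)"]; clarsimp;
          use swap_iff in blast)
    also have "\<dots> = (\<Sum>e | e dvd n. \<Sum>d | d dvd n div e. moebius d * mangoldt e)"
      by (rule sum.Sigma[symmetric]) (use assms(1) pos in auto)
    finally show ?thesis .
  qed
  have "(\<Sum>d | d dvd n. moebius d * ln (x / real d))
      = (\<Sum>d | d dvd n. moebius d * ln (x / real n) + (\<Sum>e | e dvd n div d. moebius d * mangoldt e))"
  proof (intro sum.cong refl)
    fix d assume "d \<in> {d. d dvd n}"
    then obtain e where e: "n = d * e" by blast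
    then have "0 < d" "0 < e" using assms(1) by auto
    then have "(\<Sum>f | f dvd n div d. mangoldt f) = ln (real e)" using e by (simp add: mangoldt_sum)
    moreover have "ln (x / real d) = ln (x / real n) + ln (real e)"
      using \<open>0 < d\<close> \<open>0 < e\<close> assms(2) e by (simp add: ln_div ln_mult)
    ultimately show "moebius d * ln (x / real d)
        = moebius d * ln (x / real n) + (\<Sum>e | e dvd n div d. moebius d * mangoldt e)"
      by (simp add: distrib_left sum_distrib_left[symmetric])
  qed
  also have "\<dots> = (\<Sum>d | d dvd n. moebius d) * ln (x / real n)
      + (\<Sum>e | e dvd n. \<Sum>d | d dvd n div e. moebius d * mangoldt e)"
    by (simp add: sum.distrib swap sum_distrib_right)
  also have "(\<Sum>e | e dvd n. \<Sum>d | d dvd n div e. moebius d * mangoldt e)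
      = (\<Sum>e | e dvd n. if e = n then mangoldt n else 0)"
  proof (intro sum.cong refl)
    fix e assume "e \<in> {e. e dvd n}"
    then obtain d where d: "n = e * d" by blast
    then have "0 < d" "0 < e" using assms(1) by auto
    then show "(\<Sum>d | d dvd n div e. moebius d * mangoldt e) = (if e = n then mangoldt n else 0)"
      using d by (cases "d = 1") (simp_all add: sum_moebius_divisors flip: sum_distrib_right)
  qed
  also have "\<dots> = mangoldt n" using assms(1) by simp
  finally show ?thesis using assms by (simp add: sum_moebius_divisors)
qed

section \<open>Weighted von Mangoldt sums and the value of an L-series at 1\<close>

text \<open>The value \<open>L(1, \<chi>)\<close>. The series may start at \<open>0\<close>, because the term at \<open>0\<close> is a division by zero and
hence \<open>0\<close>.\<close>

definition L_one :: "(nat \<Rightarrow> complex) \<Rightarrow> complex" where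
  "L_one \<chi> = (\<Sum>n. \<chi> n / of_nat n)"

definition nonprincipal_character :: "nat \<Rightarrow> (nat \<Rightarrow> complex) \<Rightarrow> bool" where
  "nonprincipal_character N \<chi> \<longleftrightarrow> dirichlet_character N \<chi> \<and> (\<exists>a. coprime a N \<and> \<chi> a \<noteq> 1)"

text \<open>The denominator \<open>y + 1\<close> (rather than \<open>y\<close>) turns into the bound \<open>d / x\<close> at \<open>y = x div d\<close>, even where
\<open>x div d\<close> is small.\<close>

lemma L_one_tail:
  assumes "nonprincipal_character N \<chi>" "0 < N"
  shows "norm ((\<Sum>m=1..y. \<chi> m / of_nat m) - L_one \<chi>) \<le> 2 * real N / (real y + 1)"
proof -
  obtain a where \<chi>: "dirichlet_character N \<chi>" and a: "coprime a N" "\<chi> a \<noteq> 1"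
    using assms(1) by (auto simp: nonprincipal_character_def)
  have "norm ((\<Sum>k<Suc y. \<chi> k * of_real (1 / real k)) - (\<Sum>k. \<chi> k * of_real (1 / real k)))
      \<le> 2 * real N * (1 / real (Suc y))"
    by (rule summation_by_parts_tail(2)[where M\<^sub>0 = 1, OF character_sum_bound[OF \<chi> assms(2) a]])
      (auto simp: frac_le lim_1_over_n)
  moreover have "(\<Sum>k<Suc y. \<chi> k * of_real (1 / real k)) = (\<Sum>m=1..y. \<chi> m / of_nat m)"
    by (rule sum.mono_neutral_cong_right) (auto simp: Suc_le_eq)
  ultimately show ?thesis by (simp add: L_one_def add.commute)
qed

text \<open>The weights \<open>ln k / k\<close> decrease from \<open>k = 3\<close> on, so Abel summation applies after the first two
terms are split off.\<close>

lemma character_ln_sum_bounded: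
  assumes "nonprincipal_character N \<chi>" "0 < N"
  shows "\<exists>C. \<forall>x. norm (\<Sum>n=1..x. \<chi> n / of_nat n * of_real (ln (real n))) \<le> C"
proof -
  obtain a where \<chi>: "dirichlet_character N \<chi>" and a: "coprime a N" "\<chi> a \<noteq> 1"
    using assms(1) by (auto simp: nonprincipal_character_def)
  define b where "b k = ln (real k) / real k" for k
  have decr: "b (Suc k) \<le> b k" if "3 \<le> k" for k
  proof -
    \<comment> \<open>The decrease amounts to \<open>k (ln (k + 1) - ln k) \<le> 1 \<le> ln k\<close>, which needs \<open>k \<ge> 3 \<ge> e\<close>.\<close>
    have "1 \<le> ln (real k)"
      using that exp_le by (subst ln_ge_iff) auto
    moreover have "real k * (ln (real (Suc k)) - ln (real k)) \<le> 1"
      using that ln_Suc_diff_le[of k] by (simp add: field_simps)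
    ultimately have "real k * ln (real (Suc k)) \<le> real (Suc k) * ln (real k)"
      by (simp add: algebra_simps)
    then show ?thesis using that by (simp add: b_def field_simps)
  qed
  have tail: "norm (\<Sum>k=3..<n. \<chi> k * of_real (b k)) \<le> 2 * real N * b 3" if "3 \<le> n" for n
    by (rule summation_by_parts_bound[OF character_sum_bound[OF \<chi> assms(2) a]], rule decr)
      (use that in \<open>auto simp: b_def\<close>)
  have "norm (\<Sum>n=1..x. \<chi> n / of_nat n * of_real (ln (real n))) \<le> b 2 + 2 * real N * b 3" for x
  proof -
    have "norm (\<Sum>n=1..x. \<chi> n / of_nat n * of_real (ln (real n))) = norm (\<Sum>n=1..x. \<chi> n * of_real (b n))"
      by (simp add: b_def)
    also have "\<dots> \<le> norm (\<chi> 2 * of_real (b 2)) + norm (\<Sum>k=3..<max 3 (Suc x). \<chi> k * of_real (b k))"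
    proof (cases "2 \<le> x")
      case True
      have "{1..x} = {1, 2} \<union> {3..<max 3 (Suc x)}" using True by auto
      then have "(\<Sum>n=1..x. \<chi> n * of_real (b n)) = (\<Sum>n\<in>{1,2}. \<chi> n * of_real (b n))
          + (\<Sum>k=3..<max 3 (Suc x). \<chi> k * of_real (b k))"
        by (simp only: sum.union_disjoint) (subst sum.union_disjoint; simp)
      moreover have "(\<Sum>n\<in>{1,2}. \<chi> n * of_real (b n)) = \<chi> 2 * of_real (b 2)" by (simp add: b_def)
      ultimately show ?thesis by (metis norm_triangle_ineq)
    next
      case False
      then have "x = 0 \<or> x = 1" by auto
      then show ?thesis by (auto simp: b_def)
    qed
    also have "\<dots> \<le> b 2 + 2 * real N * b 3"
    proof (intro add_mono tail)
      have "norm (\<chi> 2 * of_real (b 2)) \<le> 1 * b 2"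
        unfolding norm_mult using norm_dirichlet_character_le[OF \<chi> assms(2), of 2]
        by (intro mult_mono) (auto simp: b_def)
      then show "norm (\<chi> 2 * of_real (b 2)) \<le> b 2" by simp
    qed auto
    finally show ?thesis .
  qed
  then show ?thesis by blast
qed

text \<open>Exchanging the sums turns the left sum into a sum over \<open>d\<close> whose inner factor is the partial sum
of \<open>L(1, \<chi>)\<close> up to \<open>x / d\<close>. Its distance from \<open>L(1, \<chi>)\<close> is at most \<open>2 N d / x\<close>, and the weight \<open>1 / d\<close> cancels
the factor \<open>d\<close>. The cases \<open>g = \<Lambda>\<close> and \<open>g(d) = \<mu>(d) ln (x / d)\<close> give the two lemmas below on \<open>mangoldt_sum_at\<close>.\<close>

lemma character_divisor_sum:
  assumes "nonprincipal_character N \<chi>" "0 < N" "1 \<le> x"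
  shows "norm ((\<Sum>n=1..x. \<chi> n / of_nat n * (\<Sum>d | d dvd n. of_real (g d)))
      - L_one \<chi> * (\<Sum>d=1..x. \<chi> d / of_nat d * of_real (g d))) \<le> 2 * real N / real x * (\<Sum>d=1..x. \<bar>g d\<bar>)"
proof -
  have \<chi>: "dirichlet_character N \<chi>" using assms(1) by (auto simp: nonprincipal_character_def)
  have "(\<Sum>n=1..x. \<chi> n / of_nat n * (\<Sum>d | d dvd n. of_real (g d)))
      = (\<Sum>n=1..x. \<Sum>d | d dvd n. \<chi> (d * (n div d)) / of_nat (d * (n div d)) * of_real (g d))"
    unfolding sum_distrib_left by (intro sum.cong refl) auto
  also have "\<dots> = (\<Sum>d=1..x. \<Sum>m=1..x div d. \<chi> (d * m) / of_nat (d * m) * of_real (g d))"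
    by (rule sum_over_divisors)
  also have "\<dots> = (\<Sum>d=1..x. \<chi> d / of_nat d * of_real (g d) * (\<Sum>m=1..x div d. \<chi> m / of_nat m))"
    unfolding sum_distrib_left dirichlet_characterD(2)[OF \<chi>] by (intro sum.cong refl) simp
  finally have "(\<Sum>n=1..x. \<chi> n / of_nat n * (\<Sum>d | d dvd n. of_real (g d)))
      - L_one \<chi> * (\<Sum>d=1..x. \<chi> d / of_nat d * of_real (g d))
      = (\<Sum>d=1..x. \<chi> d / of_nat d * of_real (g d) * ((\<Sum>m=1..x div d. \<chi> m / of_nat m) - L_one \<chi>))"
    by (simp add: algebra_simps sum_subtractf sum_distrib_left)
  also have "norm \<dots> \<le> (\<Sum>d=1..x. 2 * real N / real x * \<bar>g d\<bar>)"
  proof (rule sum_norm_le)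
    fix d assume d: "d \<in> {1..x}"
    have "x \<le> d * (x div d + 1)"
      using dividend_less_times_div[of d x] d by simp
    then have x: "real x \<le> real d * (real (x div d) + 1)"
      by (metis of_nat_1 of_nat_add of_nat_le_iff of_nat_mult)
    have "norm (\<chi> d / of_nat d * of_real (g d) * ((\<Sum>m=1..x div d. \<chi> m / of_nat m) - L_one \<chi>))
        \<le> 1 / real d * \<bar>g d\<bar> * (2 * real N / (real (x div d) + 1))"
      unfolding norm_mult norm_divide
      using norm_dirichlet_character_le[OF \<chi> assms(2)]
      by (intro mult_mono L_one_tail[OF assms(1,2)]) (auto intro!: divide_right_mono)
    also have "\<dots> = 2 * real N / (real d * (real (x div d) + 1)) * \<bar>g d\<bar>" by simp
    also have "\<dots> \<le> 2 * real N / real x * \<bar>g d\<bar>"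
      using x assms(3) by (intro mult_right_mono divide_left_mono) auto
    finally show "norm (\<chi> d / of_nat d * of_real (g d) * ((\<Sum>m=1..x div d. \<chi> m / of_nat m) - L_one \<chi>))
        \<le> 2 * real N / real x * \<bar>g d\<bar>" .
  qed
  finally show ?thesis by (simp add: sum_distrib_left)
qed

text \<open>This sum is denoted by \<open>S\<^sub>\<chi>(x)\<close> in the comments.\<close>

definition mangoldt_sum_at :: "(nat \<Rightarrow> complex) \<Rightarrow> nat \<Rightarrow> complex" where
  "mangoldt_sum_at \<chi> x = (\<Sum>n=1..x. \<chi> n / of_nat n * mangoldt n)"

text \<open>For \<open>g = \<Lambda>\<close> the divisor sums are \<open>ln n\<close>, so \<open>L(1, \<chi>) S\<^sub>\<chi>(x)\<close> differs by a bounded amount from the sum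
of \<open>\<chi>(n) ln n / n\<close>, which is bounded too.\<close>

lemma mangoldt_sum_bounded:
  assumes "nonprincipal_character N \<chi>" "0 < N" "L_one \<chi> \<noteq> 0"
  shows "\<exists>C. \<forall>x\<ge>1. norm (mangoldt_sum_at \<chi> x) \<le> C"
proof -
  obtain C where C: "\<And>x. norm (\<Sum>n=1..x. \<chi> n / of_nat n * of_real (ln (real n))) \<le> C"
    using character_ln_sum_bounded[OF assms(1,2)] by blast
  have "norm (mangoldt_sum_at \<chi> x) \<le> (C + 8 * real N) / norm (L_one \<chi>)" if "1 \<le> x" for x
  proof -
    have eq: "(\<Sum>n=1..x. \<chi> n / of_nat n * (\<Sum>d | d dvd n. of_real (mangoldt d)))
        = (\<Sum>n=1..x. \<chi> n / of_nat n * of_real (ln (real n)))"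
      by (intro sum.cong refl) (auto simp: mangoldt_sum)
    have "norm ((\<Sum>n=1..x. \<chi> n / of_nat n * of_real (ln (real n))) - L_one \<chi> * mangoldt_sum_at \<chi> x)
        \<le> 2 * real N / real x * (\<Sum>d=1..x. mangoldt d)"
      using character_divisor_sum[OF assms(1,2) that, of mangoldt] unfolding eq
      by (simp add: mangoldt_sum_at_def)
    also have "\<dots> \<le> 2 * real N / real x * (4 * real x)"
      by (intro mult_left_mono chebyshev_bound) auto
    also have "\<dots> = 8 * real N" using that by simp
    finally have "norm (L_one \<chi> * mangoldt_sum_at \<chi> x) \<le> C + 8 * real N"
      using C[of x] norm_triangle_sub[of "L_one \<chi> * mangoldt_sum_at \<chi> x"
          "\<Sum>n=1..x. \<chi> n / of_nat n * of_real (ln (real n))"]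
      by (simp add: norm_minus_commute)
    then show ?thesis using assms(3) by (simp add: norm_mult field_simps)
  qed
  then show ?thesis by blast
qed

text \<open>For \<open>g(d) = \<mu>(d) ln (x / d)\<close> the divisor sums are \<open>\<Lambda>(n)\<close>, with an additional \<open>ln x\<close> at \<open>n = 1\<close>. The error is
bounded because \<open>ln (x / d)\<close> sums to \<open>x ln x - ln (x!) \<le> x\<close>.\<close>

lemma mangoldt_sum_of_vanishing:
  assumes "nonprincipal_character N \<chi>" "0 < N" "L_one \<chi> = 0" "1 \<le> x"
  shows "norm (mangoldt_sum_at \<chi> x + of_real (ln (real x))) \<le> 2 * real N"
proof -
  have \<chi>: "dirichlet_character N \<chi>" using assms(1) by (auto simp: nonprincipal_character_def)
  define g where "g d = moebius d * ln (real x / real d)" for d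
  have "(\<Sum>n=1..x. \<chi> n / of_nat n * (\<Sum>d | d dvd n. of_real (g d)))
      = (\<Sum>n=1..x. \<chi> n / of_nat n * ((if n = 1 then of_real (ln (real x)) else 0) + mangoldt n))"
  proof (intro sum.cong refl)
    fix n assume n: "n \<in> {1..x}"
    have "(\<Sum>d | d dvd n. g d) = (if n = 1 then ln (real x) else 0) + mangoldt n"
      unfolding g_def by (rule sum_moebius_ln) (use n in auto)
    then have "complex_of_real (\<Sum>d | d dvd n. g d) = (if n = 1 then of_real (ln (real x)) else 0) + mangoldt n"
      by simp
    then show "\<chi> n / of_nat n * (\<Sum>d | d dvd n. of_real (g d))
       = \<chi> n / of_nat n * ((if n = 1 then of_real (ln (real x)) else 0) + mangoldt n)" by simp
  qed
  also have "\<dots> = mangoldt_sum_at \<chi> x + (\<Sum>n=1..x. if n = 1 then of_real (ln (real x)) else 0)"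
    unfolding mangoldt_sum_at_def sum.distrib[symmetric]
    by (intro sum.cong refl) (use dirichlet_characterD(1)[OF \<chi>] in \<open>auto simp: distrib_left\<close>)
  also have "\<dots> = mangoldt_sum_at \<chi> x + of_real (ln (real x))" using assms(4) by simp
  finally have "norm (mangoldt_sum_at \<chi> x + of_real (ln (real x))) \<le> 2 * real N / real x * (\<Sum>d=1..x. \<bar>g d\<bar>)"
    using character_divisor_sum[OF assms(1,2,4), of g] assms(3) by simp
  also have "\<dots> \<le> 2 * real N / real x * real x"
  proof (intro mult_left_mono)
    have "(\<Sum>d=1..x. \<bar>g d\<bar>) \<le> (\<Sum>d=1..x. ln (real x) - ln (real d))"
    proof (intro sum_mono)
      fix d assume d: "d \<in> {1..x}"
      have "\<bar>g d\<bar> \<le> 1 * \<bar>ln (real x / real d)\<bar>"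
        unfolding g_def abs_mult by (intro mult_right_mono abs_moebius_le) auto
      also have "\<dots> = ln (real x) - ln (real d)" using d by (simp add: ln_div)
      finally show "\<bar>g d\<bar> \<le> ln (real x) - ln (real d)" .
    qed
    also have "\<dots> = real x * ln (real x) - ln (fact x)"
      unfolding ln_fact_eq_sum_ln by (simp add: sum_subtractf)
    also have "\<dots> \<le> real x" using ln_fact_bounds(1)[OF assms(4)] by simp
    finally show "(\<Sum>d=1..x. \<bar>g d\<bar>) \<le> real x" .
  qed auto
  also have "\<dots> = 2 * real N" using assms(4) by simp
  finally show ?thesis .
qed

section \<open>Real characters do not vanish at 1\<close>

text \<open>Every divisor of \<open>q ^ k * m\<close> is \<open>q ^ i * e\<close> for exactly one \<open>i \<le> k\<close> and one divisor \<open>e\<close> of \<open>m\<close>.\<close>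

lemma divisor_sum_prime_power_mult:
  fixes \<xi> :: "nat \<Rightarrow> real"
  assumes q: "prime q" "\<not> q dvd m" "0 < m" and mult: "\<And>a b. \<xi> (a * b) = \<xi> a * \<xi> b"
  shows "(\<Sum>d | d dvd q ^ k * m. \<xi> d) = (\<Sum>i\<le>k. \<xi> (q ^ i)) * (\<Sum>e | e dvd m. \<xi> e)"
proof -
  let ?P = "{..k} \<times> {e. e dvd m}"
  have "inj_on (\<lambda>(i, e). q ^ i * e) ?P"
  proof -
    have aux: "i = j \<and> e = f" if "i \<le> j" "e dvd m" "q ^ i * e = q ^ j * f" for i j e f
    proof -
      have "q ^ i * e = q ^ i * (q ^ (j - i) * f)"
        using that by (simp add: mult.assoc[symmetric] power_add[symmetric])
      then have ef: "e = q ^ (j - i) * f" using q(1) by (simp add: prime_gt_0_nat)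
      have "j - i = 0"
      proof (rule ccontr)
        assume "j - i \<noteq> 0"
        then have "q dvd e" unfolding ef by (simp add: dvd_power)
        then show False using that(2) q(2) dvd_trans by blast
      qed
      then show ?thesis using that(1) ef by simp
    qed
    show ?thesis
    proof (rule inj_onI)
      fix x y assume *: "x \<in> ?P" "y \<in> ?P" "(case x of (i, e) \<Rightarrow> q ^ i * e) = (case y of (i, e) \<Rightarrow> q ^ i * e)"
      obtain i e j f where xy: "x = (i, e)" "y = (j, f)" by fastforce
      show "x = y" using * aux[of i j e f] aux[of j i f e] unfolding xy by (cases "i \<le> j") auto
    qed
  qed
  moreover have "{d. d dvd q ^ k * m} = (\<lambda>(i, e). q ^ i * e) ` ?P"
  proof (intro equalityI subsetI)
    fix d assume "d \<in> {d. d dvd q ^ k * m}"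
    then obtain b e where d: "d = b * e" "b dvd q ^ k" "e dvd m" using division_decomp by blast
    then obtain i where "i \<le> k" "b = q ^ i" using q(1) divides_primepow_nat by blast
    then show "d \<in> (\<lambda>(i, e). q ^ i * e) ` ?P" using d by force
  next
    fix d assume "d \<in> (\<lambda>(i, e). q ^ i * e) ` ?P"
    then show "d \<in> {d. d dvd q ^ k * m}" by (auto intro: mult_dvd_mono le_imp_power_dvd)
  qed
  ultimately have "(\<Sum>d | d dvd q ^ k * m. \<xi> d) = (\<Sum>(i, e)\<in>?P. \<xi> (q ^ i * e))"
    by (simp add: sum.reindex case_prod_unfold)
  also have "\<dots> = (\<Sum>i\<le>k. \<Sum>e | e dvd m. \<xi> (q ^ i) * \<xi> e)"
    unfolding mult by (rule sum.cartesian_product[symmetric])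
  finally show ?thesis by (simp add: sum_product)
qed

text \<open>Monsky's argument applies to every function with these properties; for a real nonprincipal
character, \<open>C\<close> is its modulus.\<close>

locale real_character =
  fixes \<xi> :: "nat \<Rightarrow> real" and C :: real
  assumes mult: "\<xi> (a * b) = \<xi> a * \<xi> b" and one: "\<xi> 1 = 1"
    and value_cases: "\<xi> a \<in> {-1, 0, 1}"
    and bounded: "\<bar>\<Sum>n<m. \<xi> n\<bar> \<le> C"
begin

lemma power: "\<xi> (a ^ k) = \<xi> a ^ k"
  by (induction k) (use one in \<open>auto simp: mult\<close>)

lemma sum_powers_nonneg: "0 \<le> (\<Sum>i\<le>k. \<xi> (a ^ i))" and sum_even_powers: "1 \<le> (\<Sum>i\<le>2 * k. \<xi> (a ^ i))"
proof -
  have alternating: "(\<Sum>i\<le>n. (- 1 :: real) ^ i) = (if even n then 1 else 0)" for n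
    by (induction n) auto
  have zero: "(\<Sum>i\<le>n. (0 :: real) ^ i) = 1" for n by (induction n) auto
  consider "\<xi> a = -1" | "\<xi> a = 0" | "\<xi> a = 1" using value_cases by blast
  then have "0 \<le> (\<Sum>i\<le>k. \<xi> (a ^ i)) \<and> 1 \<le> (\<Sum>i\<le>2 * k. \<xi> (a ^ i))"
    by cases (simp_all add: power alternating zero)
  then show "0 \<le> (\<Sum>i\<le>k. \<xi> (a ^ i))" "1 \<le> (\<Sum>i\<le>2 * k. \<xi> (a ^ i))" by auto
qed

text \<open>The divisor sum is multiplicative, and at a prime power it is \<open>\<Sum>\<^bsub>i \<le> k\<^esub> \<xi>(q) ^ i\<close>, that is, \<open>k + 1\<close>,
\<open>1\<close>, or alternately \<open>1\<close> and \<open>0\<close>.\<close>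

lemma divisor_sum_nonneg: "0 < n \<Longrightarrow> 0 \<le> (\<Sum>d | d dvd n. \<xi> d)"
proof (induction n rule: less_induct)
  case (less n)
  show ?case
  proof (cases "n = 1")
    case True
    then show ?thesis using one by simp
  next
    case False
    then obtain q where q: "prime q" "q dvd n" using prime_factor_nat by blast
    obtain m where m: "n = q ^ multiplicity q n * m" "\<not> q dvd m"
      using multiplicity_decompose'[of n q] less.prems q(1) by (metis less_numeral_extra(3) not_prime_unit)
    then have "0 < m" using less.prems by (intro Nat.gr0I) auto
    have "1 < q ^ multiplicity q n"
      using q less.prems by (intro one_less_power prime_gt_1_nat) (auto simp: prime_multiplicity_gt_zero_iff)
    then have "m < q ^ multiplicity q n * m" using \<open>0 < m\<close> by (intro n_less_m_mult_n) auto
    also note m(1)[symmetric]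
    finally have "m < n" .
    then have "0 \<le> (\<Sum>d | d dvd m. \<xi> d)" using less.IH \<open>0 < m\<close> by blast
    moreover have "(\<Sum>d | d dvd n. \<xi> d) = (\<Sum>i\<le>multiplicity q n. \<xi> (q ^ i)) * (\<Sum>e | e dvd m. \<xi> e)"
      by (subst m(1)) (rule divisor_sum_prime_power_mult[OF q(1) m(2) \<open>0 < m\<close> mult])
    ultimately show ?thesis using sum_powers_nonneg by simp
  qed
qed

text \<open>Even powers of a prime give infinitely many arguments at which the divisor sum is at least \<open>1\<close>;
the powers of \<open>4\<close> are enough to make the power series with these coefficients unbounded near \<open>1\<close>.\<close>

lemma divisor_sum_power_of_4: "1 \<le> (\<Sum>d | d dvd 4 ^ j. \<xi> d)"
proof -
  have "(\<Sum>d | d dvd 2 ^ (2 * j) * 1. \<xi> d) = (\<Sum>i\<le>2 * j. \<xi> (2 ^ i)) * (\<Sum>e | e dvd 1. \<xi> e)"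
    by (rule divisor_sum_prime_power_mult) (auto simp: mult)
  then show ?thesis using sum_even_powers[of 2 j] one by (simp add: power_mult)
qed

end

text \<open>The inequality of arithmetic and geometric means for the terms with indices \<open>i\<close> and
\<open>n - 1 - i\<close>. The ratio is written as a square so that the geometric mean is a power of \<open>s\<close>.\<close>

lemma geometric_sum_lower_bound:
  fixes s :: real
  assumes "0 < s"
  shows "real n * s ^ (n - 1) \<le> (\<Sum>i<n. (s\<^sup>2) ^ i)"
proof -
  have "2 * (\<Sum>i<n. (s\<^sup>2) ^ i) = (\<Sum>i<n. (s\<^sup>2) ^ i) + (\<Sum>i<n. (s\<^sup>2) ^ (n - Suc i))"
    using sum.nat_diff_reindex[of "\<lambda>i. (s\<^sup>2) ^ i" n] by simp
  also have "\<dots> = (\<Sum>i<n. (s\<^sup>2) ^ i + (s\<^sup>2) ^ (n - Suc i))" by (simp add: sum.distrib)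
  also have "\<dots> \<ge> (\<Sum>i<n. 2 * s ^ (n - 1))"
  proof (intro sum_mono)
    fix i assume "i \<in> {..<n}"
    then have "s ^ (n - 1) = s ^ i * s ^ (n - Suc i)" by (simp flip: power_add)
    moreover have "(s\<^sup>2) ^ k = (s ^ k)\<^sup>2" for k by (simp add: power_mult[symmetric] mult.commute)
    ultimately show "2 * s ^ (n - 1) \<le> (s\<^sup>2) ^ i + (s\<^sup>2) ^ (n - Suc i)"
      using sum_squares_bound[of "s ^ i" "s ^ (n - Suc i)"] by simp
  qed
  finally show ?thesis by simp
qed

text \<open>With \<open>g(d) = 1 + t + \<dots> + t ^ (d - 1)\<close> the weight is \<open>1 / d - t ^ d / g(d)\<close>. It decreases because
\<open>t ^ d / g(d) - t ^ (d + 1) / g(d + 1) = t ^ d / (g(d) g(d + 1))\<close>, and this is at most \<open>1 / (d (d + 1))\<close> by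
the previous lemma.\<close>

lemma lambert_weight_decreasing:
  fixes t :: real
  assumes t: "0 < t" "t < 1" and "1 \<le> d"
  shows "0 \<le> 1 / real d - t ^ d * (1 - t) / (1 - t ^ d)"
    and "1 / real (Suc d) - t ^ Suc d * (1 - t) / (1 - t ^ Suc d) \<le> 1 / real d - t ^ d * (1 - t) / (1 - t ^ d)"
proof -
  define g where "g n = (\<Sum>i<n. t ^ i)" for n
  have pos: "0 < g n" if "1 \<le> n" for n
    unfolding g_def using that t by (intro sum_pos) (auto simp: lessThan_empty_iff)
  have frac: "t ^ n * (1 - t) / (1 - t ^ n) = t ^ n / g n" if "1 \<le> n" for n
  proof -
    have "t ^ n < 1" using that t by (simp add: power_less_one_iff)
    moreover have "1 - t ^ n = (1 - t) * g n" unfolding g_def using one_diff_power_eq[of t n] by simp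
    ultimately show ?thesis using t by simp
  qed
  have "real d * t ^ d \<le> g d"
  proof -
    have "(\<Sum>i<d. t ^ d) \<le> g d" unfolding g_def using t by (intro sum_mono power_decreasing) auto
    then show ?thesis by simp
  qed
  then have "t ^ d / g d \<le> 1 / real d" using pos[OF \<open>1 \<le> d\<close>] \<open>1 \<le> d\<close> by (simp add: field_simps)
  then show "0 \<le> 1 / real d - t ^ d * (1 - t) / (1 - t ^ d)" using frac[OF \<open>1 \<le> d\<close>] by simp
  define s where "s = sqrt t"
  have s: "0 < s" "s \<le> 1" "s\<^sup>2 = t" using t by (auto simp: s_def)
  have "(real d * s ^ (d - 1)) * (real (Suc d) * s ^ d) \<le> g d * g (Suc d)"
    using geometric_sum_lower_bound[OF s(1), of d] geometric_sum_lower_bound[OF s(1), of "Suc d"] s pos[OF \<open>1 \<le> d\<close>]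
    unfolding g_def s(3) by (intro mult_mono) auto
  \<comment> \<open>The means multiply to \<open>s ^ (2 d - 1)\<close>, which exceeds \<open>s ^ (2 d) = t ^ d\<close>.\<close>
  moreover have "t ^ d \<le> s ^ (d - 1) * s ^ d"
  proof -
    have "t ^ d = s ^ d * s ^ d" unfolding s(3)[symmetric] by (simp add: power_mult_distrib power2_eq_square)
    also have "\<dots> \<le> s ^ (d - 1) * s ^ d" using s by (intro mult_right_mono power_decreasing) auto
    finally show ?thesis .
  qed
  then have "real d * real (Suc d) * t ^ d \<le> real d * real (Suc d) * (s ^ (d - 1) * s ^ d)"
    by (intro mult_left_mono) auto
  ultimately have key: "real d * real (Suc d) * t ^ d \<le> g d * g (Suc d)"
    by (simp only: ac_simps)
  have "t ^ d / g d - t ^ Suc d / g (Suc d) = t ^ d * (g (Suc d) - t * g d) / (g d * g (Suc d))"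
    using pos[of d] pos[of "Suc d"] \<open>1 \<le> d\<close> by (simp add: field_simps)
  also have "g (Suc d) - t * g d = 1"
    unfolding g_def by (subst sum.lessThan_Suc_shift) (simp add: sum_distrib_left)
  also have "t ^ d * 1 / (g d * g (Suc d)) \<le> 1 / (real d * real (Suc d))"
  proof -
    have "y * 1 / G \<le> 1 / D" if "0 < G" "0 < D" "D * y \<le> G" for y G D :: real
      using that by (simp add: field_simps)
    then show ?thesis using key pos[of d] pos[of "Suc d"] \<open>1 \<le> d\<close> by simp
  qed
  also have "1 / (real d * real (Suc d)) = 1 / real d - 1 / real (Suc d)"
    using \<open>1 \<le> d\<close> by (simp add: field_simps)
  finally show "1 / real (Suc d) - t ^ Suc d * (1 - t) / (1 - t ^ Suc d) \<le> 1 / real d - t ^ d * (1 - t) / (1 - t ^ d)"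
    using frac[of d] frac[of "Suc d"] \<open>1 \<le> d\<close> by simp
qed

context real_character
begin

text \<open>The power series with coefficients \<open>\<Sum>\<^bsub>d | n\<^esub> \<xi>(d)\<close> is the Lambert series of \<open>\<xi>(d) t ^ d / (1 - t ^ d)\<close>.
Since \<open>t ^ d / (1 - t ^ d)\<close> is close to \<open>1 / (d (1 - t))\<close>, vanishing of \<open>\<Sum> \<xi>(d) / d\<close> removes the pole at
\<open>t = 1\<close>, and the difference has decreasing weights, so Abel summation bounds it independently of \<open>t\<close>. The
last two terms are the truncation errors, which vanish as \<open>M\<close> grows.\<close>

lemma lambert_partial_sum_bound:
  assumes t: "0 < t" "t < 1"
    and vanishing: "\<And>M. \<bar>\<Sum>d=1..M. \<xi> d / real d\<bar> \<le> 2 * C / (real M + 1)"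
  shows "(\<Sum>n=1..M. (\<Sum>d | d dvd n. \<xi> d) * t ^ n)
    \<le> 2 * C + 2 * C / ((real M + 1) * (1 - t)) + real M * t ^ M / (1 - t)"
proof -
  define w where "w d = 1 / real d - t ^ d * (1 - t) / (1 - t ^ d)" for d
  have pow: "t ^ d < 1" if "1 \<le> d" for d using that t by (simp add: power_less_one_iff)
  have "(\<Sum>n=1..M. (\<Sum>d | d dvd n. \<xi> d) * t ^ n) = (\<Sum>n=1..M. \<Sum>d | d dvd n. \<xi> d * (t ^ d) ^ (n div d))"
    unfolding sum_distrib_right by (intro sum.cong refl) (auto simp flip: power_mult)
  also have "\<dots> = (\<Sum>d=1..M. \<Sum>k=1..M div d. \<xi> d * (t ^ d) ^ k)" by (rule sum_over_divisors)
  also have "\<dots> \<le> (\<Sum>d=1..M. \<xi> d * (t ^ d / (1 - t ^ d)) + t ^ M / (1 - t))"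
  proof (intro sum_mono)
    fix d assume d: "d \<in> {1..M}"
    \<comment> \<open>Cutting the geometric series at \<open>K\<close> omits terms from exponent \<open>d (K + 1) \<ge> M\<close> on.\<close>
    define K where "K = M div d"
    have "M \<le> d * (K + 1)" using dividend_less_times_div[of d M] d by (simp add: K_def)
    then have le: "(t ^ d) ^ (K + 1) \<le> t ^ M" unfolding power_mult[symmetric] using t by (intro power_decreasing) auto
    have "t ^ d \<le> t" using t d power_decreasing[of 1 d t] by simp
    then have "(t ^ d) ^ (K + 1) / (1 - t ^ d) \<le> t ^ M / (1 - t)" using le t by (intro frac_le) auto
    moreover have geo: "(\<Sum>k=1..K. (t ^ d) ^ k) = t ^ d / (1 - t ^ d) - (t ^ d) ^ (K + 1) / (1 - t ^ d)"
    proof -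
      have "(1 - t ^ d) * (\<Sum>k=1..K. (t ^ d) ^ k) = t ^ d - (t ^ d) ^ (K + 1)"
        using sum_gp_multiplied[of 1 K "t ^ d"] by (cases "K = 0") simp_all
      moreover have "1 - t ^ d \<noteq> 0" using pow[of d] d by simp
      ultimately show ?thesis by (metis diff_divide_distrib nonzero_mult_div_cancel_left)
    qed
    moreover have "\<bar>\<xi> d\<bar> \<le> 1" using value_cases[of d] by auto
    moreover have "0 \<le> (t ^ d) ^ (K + 1) / (1 - t ^ d)" using t pow[of d] d by auto
    moreover have "\<bar>x * y\<bar> \<le> z" if "\<bar>x\<bar> \<le> 1" "0 \<le> y" "y \<le> z" for x y z :: real
      using that mult_mono[of "\<bar>x\<bar>" 1 y z] by (simp add: abs_mult)
    ultimately have "\<bar>\<xi> d * ((t ^ d) ^ (K + 1) / (1 - t ^ d))\<bar> \<le> t ^ M / (1 - t)" by blast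
    then show "(\<Sum>k=1..M div d. \<xi> d * (t ^ d) ^ k) \<le> \<xi> d * (t ^ d / (1 - t ^ d)) + t ^ M / (1 - t)"
      unfolding sum_distrib_left[symmetric] K_def[symmetric] geo right_diff_distrib by linarith
  qed
  also have "\<dots> = (\<Sum>d=1..M. \<xi> d * (t ^ d / (1 - t ^ d))) + real M * t ^ M / (1 - t)"
    by (simp add: sum.distrib)
  also have "(\<Sum>d=1..M. \<xi> d * (t ^ d / (1 - t ^ d)))
      = ((\<Sum>d=1..M. \<xi> d / real d) - (\<Sum>d=1..M. \<xi> d * w d)) / (1 - t)"
    unfolding sum_subtractf[symmetric] sum_divide_distrib
  proof (intro sum.cong refl)
    fix d
    have "\<xi> d / real d - \<xi> d * w d = \<xi> d * (t ^ d / (1 - t ^ d)) * (1 - t)"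
      by (simp add: w_def right_diff_distrib[of "\<xi> d" "1 / real d"])
    then show "\<xi> d * (t ^ d / (1 - t ^ d)) = (\<xi> d / real d - \<xi> d * w d) / (1 - t)" using t by simp
  qed
  also have "\<dots> \<le> (2 * C / (real M + 1) + 2 * C * (1 - t)) / (1 - t)"
  proof (intro divide_right_mono)
    have "norm (\<Sum>d=1..<Suc M. \<xi> d * of_real (w d)) \<le> 2 * C * w 1"
      by (rule summation_by_parts_bound) (use bounded lambert_weight_decreasing[OF t] in \<open>auto simp: w_def\<close>)
    then have "\<bar>\<Sum>d=1..M. \<xi> d * w d\<bar> \<le> 2 * C * w 1" by (simp add: atLeastLessThanSuc_atLeastAtMost)
    also have "w 1 = 1 - t" using t by (simp add: w_def)
    finally show "(\<Sum>d=1..M. \<xi> d / real d) - (\<Sum>d=1..M. \<xi> d * w d) \<le> 2 * C / (real M + 1) + 2 * C * (1 - t)"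
      using vanishing[of M] by linarith
  qed (use t in simp)
  also have "\<dots> = 2 * C + 2 * C / ((real M + 1) * (1 - t))"
    using t by (simp add: add_divide_distrib add.commute)
  finally show ?thesis by simp
qed

text \<open>If the series \<open>\<Sum> \<xi>(d) / d\<close> had the value \<open>0\<close>, its tail bound would hold for every \<open>M\<close> in the form
negated here. Then the power series would stay below \<open>2 C\<close> as \<open>t\<close> tends to \<open>1\<close>, although arbitrarily many
of its terms tend to at least \<open>1\<close>.\<close>

theorem L_nonvanishing: "\<exists>M. 2 * C / (real M + 1) < \<bar>\<Sum>d=1..M. \<xi> d / real d\<bar>"
proof (rule ccontr)
  assume "\<not> ?thesis"
  then have vanishing: "\<bar>\<Sum>d=1..M. \<xi> d / real d\<bar> \<le> 2 * C / (real M + 1)" for M by (meson not_less)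
  obtain J :: nat where J: "2 * C < real J" using reals_Archimedean2 by blast
  have bound: "(\<Sum>j<J. t ^ (4 ^ j)) \<le> 2 * C" if t: "0 < t" "t < 1" for t :: real
  proof -
    have "(\<Sum>j<J. t ^ (4 ^ j)) \<le> 2 * C + 2 * C / ((real M + 1) * (1 - t)) + real M * t ^ M / (1 - t)"
      if "4 ^ J \<le> M" for M
    proof -
      have inj: "inj_on (\<lambda>j. 4 ^ j :: nat) {..<J}" by (auto simp: inj_on_def)
      have "(\<Sum>j<J. t ^ (4 ^ j)) \<le> (\<Sum>j<J. (\<Sum>d | d dvd 4 ^ j. \<xi> d) * t ^ (4 ^ j))"
        using t mult_right_mono[OF divisor_sum_power_of_4] by (intro sum_mono) fastforce
      also have "\<dots> = (\<Sum>n\<in>(\<lambda>j. 4 ^ j) ` {..<J}. (\<Sum>d | d dvd n. \<xi> d) * t ^ n)"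
        by (subst sum.reindex[OF inj]) simp
      also have "\<dots> \<le> (\<Sum>n=1..M. (\<Sum>d | d dvd n. \<xi> d) * t ^ n)"
      proof (intro sum_mono2)
        have "4 ^ j \<le> M" if "j < J" for j
          using that \<open>4 ^ J \<le> M\<close> power_increasing[of j J "4::nat"] by (meson le_trans less_imp_le one_le_numeral)
        then show "(\<lambda>j. 4 ^ j) ` {..<J} \<subseteq> {1..M}" by (auto simp: Suc_le_eq)
      qed (use t divisor_sum_nonneg in auto)
      finally show ?thesis using lambert_partial_sum_bound[OF t vanishing, of M] by linarith
    qed
    moreover have "(\<lambda>M. 2 * C + 2 * C / ((real M + 1) * (1 - t)) + real M * t ^ M / (1 - t)) \<longlonglongrightarrow> 2 * C"
    proof -
      have "(\<lambda>M. 2 * C + 2 * C / (1 - t) * inverse (real (Suc M)) + real M * t ^ M * (1 / (1 - t)))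
          \<longlonglongrightarrow> 2 * C + 2 * C / (1 - t) * 0 + 0 * (1 / (1 - t))"
        using t by (intro tendsto_intros LIMSEQ_inverse_real_of_nat powser_times_n_limit_0) simp
      then show ?thesis by (simp add: field_simps)
    qed
    ultimately show ?thesis
      by (intro LIMSEQ_le_const[of _ "2 * C"]) auto
  qed
  have "((\<lambda>t::real. \<Sum>j<J. t ^ (4 ^ j)) \<longlongrightarrow> (\<Sum>j<J. 1 ^ (4 ^ j))) (at_left 1)"
    by (intro tendsto_intros)
  moreover have "\<forall>\<^sub>F t in at_left (1::real). (\<Sum>j<J. t ^ (4 ^ j)) \<le> 2 * C"
    using eventually_at_left_real[of 0 1] by (rule eventually_mono) (auto intro!: bound)
  ultimately have "(\<Sum>j<J. (1::real) ^ (4 ^ j)) \<le> 2 * C"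
    by (intro tendsto_upperbound) auto
  then show False using J by simp
qed

end

section \<open>Contributions of prime powers\<close>

lemma sum_over_prime_powers_le:
  assumes "finite T" and prime: "\<And>q k. (q, k) \<in> T \<Longrightarrow> prime q \<and> 0 < k"
    and S: "\<And>n. n \<in> S \<Longrightarrow> mangoldt n \<noteq> (0::real) \<Longrightarrow> \<exists>(q, k)\<in>T. n = q ^ k" and "finite S"
  shows "(\<Sum>n\<in>S. mangoldt n / real n) \<le> (\<Sum>(q, k)\<in>T. ln (real q) * (1 / real q) ^ k)"
proof -
  have "(\<Sum>n\<in>S. mangoldt n / real n) = (\<Sum>n\<in>{n \<in> S. mangoldt n \<noteq> (0::real)}. mangoldt n / real n)"
    by (rule sum.mono_neutral_right) (use \<open>finite S\<close> in auto)
  also have "\<dots> \<le> (\<Sum>n\<in>(\<lambda>(q, k). q ^ k) ` T. mangoldt n / real n)"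
    by (rule sum_mono2) (use S \<open>finite T\<close> mangoldt_nonneg in \<open>fastforce+\<close>)
  also have "\<dots> \<le> (\<Sum>x\<in>T. (\<lambda>n. mangoldt n / real n) ((\<lambda>(q, k). q ^ k) x))"
    using sum_image_le[OF \<open>finite T\<close>, of "\<lambda>n. mangoldt n / real n" "\<lambda>(q, k). q ^ k"] mangoldt_nonneg
    by (simp add: o_def)
  also have "\<dots> = (\<Sum>(q, k)\<in>T. ln (real q) * (1 / real q) ^ k)"
    by (intro sum.cong refl) (use prime in \<open>auto simp: mangoldt_primepow power_divide\<close>)
  finally show ?thesis .
qed

lemma geometric_tail_le:
  fixes r :: real
  assumes "0 \<le> r" "r \<le> 1 / 2"
  shows "(\<Sum>k=m..n. r ^ k) \<le> 2 * r ^ m"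
proof (cases "m \<le> n")
  case True
  have "1 / 2 * (\<Sum>k=m..n. r ^ k) \<le> (1 - r) * (\<Sum>k=m..n. r ^ k)"
    using assms by (intro mult_right_mono sum_nonneg) auto
  also have "\<dots> \<le> r ^ m" unfolding sum_gp_multiplied[OF True] using assms by simp
  finally show ?thesis by simp
qed (use assms in auto)

text \<open>The right-hand side telescopes: \<open>ln q / q\<^sup>2\<close> is at most the decrement of \<open>(ln h + 2) / h\<close> from
\<open>h = q - 1\<close> to \<open>h = q\<close>. The constant \<open>2\<close> absorbs \<open>q (ln q - ln (q - 1)) \<le> q / (q - 1) \<le> 2\<close>.\<close>

lemma sum_ln_over_square_le:
  assumes "1 \<le> x"
  shows "(\<Sum>q=2..x. ln (real q) / (real q)\<^sup>2) \<le> 2 - (ln (real x) + 2) / real x"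
  using assms
proof (induction x rule: dec_induct)
  case (step h)
  define q where "q = Suc h"
  have q: "real q = real h + 1" "0 < real h" "0 < real q" using step by (auto simp: q_def)
  have "ln (real q) - ln (real h) \<le> 1 / real h" using ln_Suc_diff_le[of h] q(2) by (simp add: q_def)
  then have "real q * (ln (real q) - ln (real h)) \<le> real q * (1 / real h)"
    using q by (intro mult_left_mono) auto
  also have "\<dots> \<le> 2" using q step by (simp add: field_simps)
  finally have "ln (real q) \<le> real q * ln (real h) + 2 * real q - (real h * ln (real q) + 2 * real h)"
    by (simp add: q algebra_simps)
  then have "ln (real q) / (real q * real h)
      \<le> (real q * ln (real h) + 2 * real q - (real h * ln (real q) + 2 * real h)) / (real q * real h)"
    using q by (intro divide_right_mono) auto
  also have "\<dots> = (ln (real h) + 2) / real h - (ln (real q) + 2) / real q"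
    using q by (simp add: field_simps)
  finally have "ln (real q) / (real q * real h) \<le> (ln (real h) + 2) / real h - (ln (real q) + 2) / real q" .
  moreover have "ln (real q) / (real q)\<^sup>2 \<le> ln (real q) / (real q * real h)"
    using q by (intro divide_left_mono) (auto simp: power2_eq_square)
  ultimately have "ln (real q) / (real q)\<^sup>2 \<le> (ln (real h) + 2) / real h - (ln (real q) + 2) / real q"
    by linarith
  moreover have "(\<Sum>q=2..Suc h. ln (real q) / (real q)\<^sup>2)
      = (\<Sum>q=2..h. ln (real q) / (real q)\<^sup>2) + ln (real q) / (real q)\<^sup>2"
    using step by (simp add: q_def)
  ultimately show ?case using step.IH by (simp add: q_def)
qed auto

lemma prime_power_decomposition:
  assumes "mangoldt n \<noteq> (0::real)"
  obtains q k where "prime q" "0 < k" "n = q ^ k" "q \<le> n" "k \<le> n"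
proof -
  obtain q k where qk: "prime q" "0 < k" "n = q ^ k"
    using assms by (auto simp: mangoldt_def primepow_def split: if_splits)
  moreover have "q \<le> n" using qk prime_ge_1_nat[of q] by (simp add: self_le_power)
  moreover have "k \<le> n"
    using qk less_exp[of k] power_mono[of 2 q k] prime_ge_2_nat[of q] by linarith
  ultimately show ?thesis using that by blast
qed

text \<open>The contributing numbers are powers of the finitely many primes dividing \<open>N\<close>, and the powers of
one prime form a geometric series.\<close>

lemma mangoldt_sum_noncoprime_le:
  assumes "0 < N"
  shows "(\<Sum>n | n \<in> {1..x} \<and> \<not> coprime n N. mangoldt n / real n) \<le> (\<Sum>q\<in>prime_factors N. ln (real q))"
proof -
  have "(\<Sum>n | n \<in> {1..x} \<and> \<not> coprime n N. mangoldt n / real n)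
      \<le> (\<Sum>(q, k)\<in>prime_factors N \<times> {1..x}. ln (real q) * (1 / real q) ^ k)"
  proof (rule sum_over_prime_powers_le)
    fix n assume n: "n \<in> {n. n \<in> {1..x} \<and> \<not> coprime n N}" and "mangoldt n \<noteq> (0::real)"
    then obtain q k where qk: "prime q" "0 < k" "n = q ^ k" "k \<le> n" using prime_power_decomposition by metis
    then have "\<not> coprime q N" using n by auto
    then have "q \<in> prime_factors N" using qk(1) assms prime_imp_coprime by (auto simp: in_prime_factors_iff)
    then show "\<exists>(q, k)\<in>prime_factors N \<times> {1..x}. n = q ^ k" using qk n by (intro bexI[of _ "(q, k)"]) auto
  qed auto
  also have "\<dots> = (\<Sum>q\<in>prime_factors N. ln (real q) * (\<Sum>k=1..x. (1 / real q) ^ k))"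
    by (simp add: sum.cartesian_product[symmetric] sum_distrib_left)
  also have "\<dots> \<le> (\<Sum>q\<in>prime_factors N. ln (real q) * 1)"
  proof (intro sum_mono mult_left_mono)
    fix q assume "q \<in> prime_factors N"
    then have "2 \<le> q" using prime_ge_2_nat by auto
    then have "(\<Sum>k=1..x. (1 / real q) ^ k) \<le> 2 * (1 / real q) ^ 1"
      by (intro geometric_tail_le) (auto simp: field_simps)
    also have "\<dots> \<le> 1" using \<open>2 \<le> q\<close> by simp
    finally show "(\<Sum>k=1..x. (1 / real q) ^ k) \<le> 1" .
    show "0 \<le> ln (real q)" using \<open>2 \<le> q\<close> by simp
  qed
  finally show ?thesis by simp
qed

text \<open>Proper prime powers \<open>q ^ k\<close> with \<open>k \<ge> 2\<close> contribute at most \<open>2 ln q / q\<^sup>2\<close> for each \<open>q\<close>.\<close>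

lemma mangoldt_sum_nonprime_le:
  "(\<Sum>n | n \<in> {1..x} \<and> \<not> prime n. mangoldt n / real n) \<le> 4"
proof (cases "1 \<le> x")
  case True
  let ?T = "{q \<in> {2..x}. prime q} \<times> {2..x}"
  have "(\<Sum>n | n \<in> {1..x} \<and> \<not> prime n. mangoldt n / real n)
      \<le> (\<Sum>(q, k)\<in>?T. ln (real q) * (1 / real q) ^ k)"
  proof (rule sum_over_prime_powers_le)
    fix n assume n: "n \<in> {n. n \<in> {1..x} \<and> \<not> prime n}" and "mangoldt n \<noteq> (0::real)"
    then obtain q k where qk: "prime q" "0 < k" "n = q ^ k" "q \<le> n" "k \<le> n"
      using prime_power_decomposition by metis
    then have "k \<noteq> 1" using n by auto
    moreover have "q \<le> x" "k \<le> x" using qk(4,5) n by simp_all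
    ultimately show "\<exists>(q, k)\<in>?T. n = q ^ k"
      using qk(1-3) prime_ge_2_nat[OF qk(1)] by (intro bexI[of _ "(q, k)"]) auto
  qed auto
  also have "\<dots> = (\<Sum>q\<in>{q \<in> {2..x}. prime q}. ln (real q) * (\<Sum>k=2..x. (1 / real q) ^ k))"
    by (simp add: sum.cartesian_product[symmetric] sum_distrib_left)
  also have "\<dots> \<le> (\<Sum>q\<in>{2..x}. ln (real q) * (\<Sum>k=2..x. (1 / real q) ^ k))"
    by (intro sum_mono2) (auto intro!: mult_nonneg_nonneg sum_nonneg)
  also have "\<dots> \<le> (\<Sum>q\<in>{2..x}. ln (real q) * (2 * (1 / real q)\<^sup>2))"
    by (intro sum_mono mult_left_mono geometric_tail_le) (auto simp: field_simps)
  also have "\<dots> = 2 * (\<Sum>q=2..x. ln (real q) / (real q)\<^sup>2)"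
    by (simp add: sum_distrib_left power_one_over field_simps)
  also have "\<dots> \<le> 2 * 2"
    using sum_ln_over_square_le[OF True] True by (intro mult_left_mono) (auto intro: order_trans)
  finally show ?thesis by simp
qed auto

section \<open>Primes in arithmetic progressions\<close>

definition principal_character :: "nat \<Rightarrow> nat \<Rightarrow> complex" where
  "principal_character N n = (if coprime n N then 1 else 0)"

lemma dirichlet_character_principal: "dirichlet_character N (principal_character N)"
  unfolding dirichlet_character_def
proof (intro conjI allI impI)
  fix m n assume "[m = n] (mod N)"
  then have "coprime m N \<longleftrightarrow> coprime n N" by (meson cong_imp_coprime cong_sym)
  then show "principal_character N m = principal_character N n" by (simp add: principal_character_def)
qed (auto simp: principal_character_def)

lemma character_cases:
  assumes "dirichlet_character N \<chi>"
  shows "\<chi> = principal_character N \<or> nonprincipal_character N \<chi>"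
proof (cases "\<forall>a. coprime a N \<longrightarrow> \<chi> a = 1")
  case True
  then have "\<chi> = principal_character N"
    using dirichlet_characterD(4)[OF assms] by (intro ext) (auto simp: principal_character_def)
  then show ?thesis by simp
qed (use assms in \<open>auto simp: nonprincipal_character_def\<close>)

lemma mangoldt_sum_principal:
  assumes "0 < N"
  shows "\<exists>C. \<forall>x\<ge>1. norm (mangoldt_sum_at (principal_character N) x - of_real (ln (real x))) \<le> C"
proof -
  define B where "B = (\<Sum>q\<in>prime_factors N. ln (real q))"
  have "norm (mangoldt_sum_at (principal_character N) x - of_real (ln (real x))) \<le> 4 + B" if "1 \<le> x" for x
  proof -
    define r where "r = (\<Sum>n | n \<in> {1..x} \<and> \<not> coprime n N. mangoldt n / real n)"
    have r: "0 \<le> r" "r \<le> B"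
      using mangoldt_sum_noncoprime_le[OF assms, of x]
      by (auto simp: r_def B_def intro!: sum_nonneg divide_nonneg_nonneg mangoldt_nonneg)
    have "mangoldt_sum_at (principal_character N) x
        = of_real (\<Sum>n=1..x. if coprime n N then mangoldt n / real n else 0)"
      unfolding mangoldt_sum_at_def of_real_sum by (intro sum.cong refl) (simp add: principal_character_def)
    also have "(\<Sum>n=1..x. if coprime n N then mangoldt n / real n else 0)
        = (\<Sum>n=1..x. mangoldt n / real n) - (\<Sum>n=1..x. if \<not> coprime n N then mangoldt n / real n else 0)"
      unfolding sum_subtractf[symmetric] by (intro sum.cong refl) simp
    also have "(\<Sum>n=1..x. if \<not> coprime n N then mangoldt n / real n else 0) = r"
      unfolding r_def by (rule sum.mono_neutral_cong_right) auto
    finally have "norm (mangoldt_sum_at (principal_character N) x - of_real (ln (real x)))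
        = \<bar>(\<Sum>n=1..x. mangoldt n / real n) - r - ln (real x)\<bar>"
      by (metis norm_of_real of_real_diff)
    then show ?thesis using mertens_bound[OF that] r by linarith
  qed
  then show ?thesis by blast
qed

text \<open>Orthogonality, applied to \<open>\<chi> (n * l')\<close>; the inverse \<open>l'\<close> of \<open>l\<close> takes the place of the complex
conjugate of \<open>\<chi> l\<close>.\<close>

lemma progression_sum_eq_character_sum:
  assumes "0 < N" "[l * l' = 1] (mod N)"
  shows "(\<Sum>\<chi> | dirichlet_character N \<chi>. \<chi> l' * mangoldt_sum_at \<chi> x)
    = of_real (real (card {\<chi>. dirichlet_character N \<chi>}) * (\<Sum>n | n \<in> {1..x} \<and> [n = l] (mod N). mangoldt n / real n))"
proof -
  let ?X = "{\<chi>. dirichlet_character N \<chi>}"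
  have iff: "[n * l' = 1] (mod N) \<longleftrightarrow> [n = l] (mod N)" for n
  proof
    assume "[n * l' = 1] (mod N)"
    then have "[n * l' * l = 1 * l] (mod N)" by (rule cong_scalar_right)
    moreover have "[n * (l * l') = n * 1] (mod N)" using assms(2) by (rule cong_scalar_left)
    ultimately show "[n = l] (mod N)" by (metis cong_sym cong_trans mult.assoc mult.commute mult.right_neutral)
  next
    assume "[n = l] (mod N)"
    then have "[n * l' = l * l'] (mod N)" by (rule cong_scalar_right)
    then show "[n * l' = 1] (mod N)" using assms(2) cong_trans by blast
  qed
  have "(\<Sum>\<chi>\<in>?X. \<chi> l' * mangoldt_sum_at \<chi> x) = (\<Sum>\<chi>\<in>?X. \<Sum>n=1..x. \<chi> (n * l') * (mangoldt n / of_nat n))"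
    unfolding mangoldt_sum_at_def sum_distrib_left
  proof (intro sum.cong refl)
    fix \<chi> n assume "\<chi> \<in> ?X"
    then show "\<chi> l' * (\<chi> n / of_nat n * mangoldt n) = \<chi> (n * l') * (mangoldt n / of_nat n)"
      by (simp add: dirichlet_characterD(2)[of N \<chi> n l'])
  qed
  also have "\<dots> = (\<Sum>n=1..x. \<Sum>\<chi>\<in>?X. \<chi> (n * l') * (mangoldt n / of_nat n))" by (rule sum.swap)
  also have "\<dots> = (\<Sum>n=1..x. if [n = l] (mod N) then of_nat (card ?X) * (mangoldt n / of_nat n) else 0)"
    unfolding sum_distrib_right[symmetric] character_orthogonality[OF assms(1)] iff
    by (intro sum.cong refl) simp
  also have "\<dots> = (\<Sum>n | n \<in> {1..x} \<and> [n = l] (mod N). of_nat (card ?X) * (mangoldt n / of_nat n))"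
    by (rule sum.mono_neutral_cong_right) auto
  finally show ?thesis by (simp add: sum_distrib_left)
qed

lemma L_one_cnj:
  assumes "nonprincipal_character N \<chi>" "0 < N"
  shows "L_one (\<lambda>n. cnj (\<chi> n)) = cnj (L_one \<chi>)"
proof -
  obtain a where \<chi>: "dirichlet_character N \<chi>" and a: "coprime a N" "\<chi> a \<noteq> 1"
    using assms(1) by (auto simp: nonprincipal_character_def)
  have "summable (\<lambda>k. \<chi> k * of_real (1 / real k))"
    by (rule summation_by_parts_tail(1)[where M\<^sub>0 = 1, OF character_sum_bound[OF \<chi> assms(2) a]])
      (auto simp: frac_le lim_1_over_n)
  then have "(\<lambda>k. \<chi> k / of_nat k) sums L_one \<chi>" by (simp add: L_one_def summable_sums)
  then have "(\<lambda>k. cnj (\<chi> k) / of_nat k) sums cnj (L_one \<chi>)" using sums_cnj by fastforce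
  then show ?thesis by (simp add: L_one_def sums_iff)
qed

lemma L_one_nonzero_real:
  assumes "nonprincipal_character N \<chi>" "0 < N" and real: "\<And>n. Im (\<chi> n) = 0"
  shows "L_one \<chi> \<noteq> 0"
proof
  assume vanishing: "L_one \<chi> = 0"
  obtain a where \<chi>: "dirichlet_character N \<chi>" and a: "coprime a N" "\<chi> a \<noteq> 1"
    using assms(1) by (auto simp: nonprincipal_character_def)
  define \<xi> where "\<xi> n = Re (\<chi> n)" for n
  have \<chi>_eq: "\<chi> n = of_real (\<xi> n)" for n using real[of n] by (simp add: \<xi>_def complex_eq_iff)
  interpret real_character \<xi> "real N"
  proof
    show "\<xi> (a * b) = \<xi> a * \<xi> b" for a b
      using dirichlet_characterD(2)[OF \<chi>, of a b] by (simp add: \<chi>_eq flip: of_real_mult)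
    show "\<xi> 1 = 1" using dirichlet_characterD(1)[OF \<chi>] by (simp add: \<xi>_def)
    show "\<xi> n \<in> {-1, 0, 1}" for n
    proof (cases "coprime n N")
      case True
      then have "\<bar>\<xi> n\<bar> ^ totient N = 1"
        using dirichlet_character_root_of_unity[OF \<chi> True]
        by (metis \<chi>_eq norm_of_real norm_one norm_power)
      then have "\<bar>\<xi> n\<bar> = 1" using assms(2) power_eq_imp_eq_base[of "\<bar>\<xi> n\<bar>" "totient N" 1] by simp
      then show ?thesis by auto
    next
      case False
      then show ?thesis using dirichlet_characterD(4)[OF \<chi>, of n] by (simp add: \<xi>_def)
    qed
    show "\<bar>\<Sum>n<m. \<xi> n\<bar> \<le> real N" for m
      using character_sum_bound[OF \<chi> assms(2) a, of m] by (simp add: \<chi>_eq flip: of_real_sum)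
  qed
  obtain M where "2 * real N / (real M + 1) < \<bar>\<Sum>d=1..M. \<xi> d / real d\<bar>" using L_nonvanishing by blast
  moreover have "(\<Sum>m=1..M. \<chi> m / of_nat m) = of_real (\<Sum>d=1..M. \<xi> d / real d)" by (simp add: \<chi>_eq)
  then have "norm (\<Sum>m=1..M. \<chi> m / of_nat m) = \<bar>\<Sum>d=1..M. \<xi> d / real d\<bar>" by (simp only: norm_of_real)
  moreover have "norm (\<Sum>m=1..M. \<chi> m / of_nat m) \<le> 2 * real N / (real M + 1)"
    using L_one_tail[OF assms(1,2), of M] vanishing by simp
  ultimately show False by linarith
qed

text \<open>Summed over all characters, \<open>S\<^sub>\<chi>(x)\<close> is a nonnegative real number. The principal character
contributes \<open>ln x\<close>, each vanishing character contributes \<open>- ln x\<close>, and the rest is bounded; two vanishing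
characters would make the sum negative for large \<open>x\<close>.\<close>

lemma vanishing_characters_unique:
  assumes "0 < N"
  shows "card {\<chi>. nonprincipal_character N \<chi> \<and> L_one \<chi> = 0} \<le> 1"
proof (rule ccontr)
  let ?X = "{\<chi>. dirichlet_character N \<chi>}" and ?V = "{\<chi>. nonprincipal_character N \<chi> \<and> L_one \<chi> = 0}"
  assume "\<not> card ?V \<le> 1"
  \<comment> \<open>The coefficient of \<open>ln x\<close> in \<open>S\<^sub>\<chi>(x)\<close>.\<close>
  define e where "e \<chi> = (if \<chi> \<in> ?V then -1 else if \<chi> = principal_character N then 1 else 0 :: real)" for \<chi>
  have "\<exists>C. \<forall>x\<ge>1. Re (mangoldt_sum_at \<chi> x) \<le> e \<chi> * ln (real x) + C" if \<chi>: "\<chi> \<in> ?X" for \<chi>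
  proof -
    have Re: "Re z \<le> Re w + B" if "norm (z - w) \<le> B" for z w B
      using abs_Re_le_cmod[of "z - w"] that by simp
    consider "\<chi> \<in> ?V" | "\<chi> \<notin> ?V" "\<chi> = principal_character N" | "\<chi> \<notin> ?V" "\<chi> \<noteq> principal_character N" by blast
    then show ?thesis
    proof cases
      case 1
      then have "norm (mangoldt_sum_at \<chi> x + of_real (ln (real x))) \<le> 2 * real N" if "1 \<le> x" for x
        using mangoldt_sum_of_vanishing[OF _ assms _ that] by blast
      then show ?thesis using 1 Re[of "mangoldt_sum_at \<chi> x" "- of_real (ln (real x))" for x]
        by (intro exI[of _ "2 * real N"]) (simp add: e_def)
    next
      case 2
      obtain C where "\<And>x. 1 \<le> x \<Longrightarrow> norm (mangoldt_sum_at \<chi> x - of_real (ln (real x))) \<le> C"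
        using mangoldt_sum_principal[OF assms] 2(2) by blast
      moreover have "e \<chi> = 1" by (simp only: e_def if_not_P[OF 2(1)] if_P[OF 2(2)])
      ultimately show ?thesis using Re[of "mangoldt_sum_at \<chi> x" "of_real (ln (real x))" for x]
        by (intro exI[of _ C]) simp
    next
      case 3
      then obtain C where "\<And>x. 1 \<le> x \<Longrightarrow> norm (mangoldt_sum_at \<chi> x) \<le> C"
        using mangoldt_sum_bounded[OF _ assms, of \<chi>] character_cases \<chi> by blast
      moreover have "e \<chi> = 0" by (simp only: e_def if_not_P[OF 3(1)] if_not_P[OF 3(2)])
      ultimately show ?thesis using Re[of "mangoldt_sum_at \<chi> x" 0 for x]
        by (intro exI[of _ C]) simp
    qed
  qed
  then obtain C where C: "\<And>\<chi> x. \<chi> \<in> ?X \<Longrightarrow> 1 \<le> x \<Longrightarrow> Re (mangoldt_sum_at \<chi> x) \<le> e \<chi> * ln (real x) + C \<chi>"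
    by metis
  have V_sub: "?V \<subseteq> ?X" by (auto simp: nonprincipal_character_def)
  have "principal_character N \<notin> ?V" by (auto simp: nonprincipal_character_def principal_character_def)
  then have "(\<Sum>\<chi>\<in>?X. e \<chi>) = (\<Sum>\<chi>\<in>?X. if \<chi> = principal_character N then 1 else 0) - (\<Sum>\<chi>\<in>?X. if \<chi> \<in> ?V then 1 else 0)"
    unfolding sum_subtractf[symmetric] by (intro sum.cong refl) (auto simp: e_def)
  also have "(\<Sum>\<chi>\<in>?X. if \<chi> = principal_character N then 1 else (0::real)) = 1"
    using finite_dirichlet_characters[OF assms] dirichlet_character_principal by simp
  also have "(\<Sum>\<chi>\<in>?X. if \<chi> \<in> ?V then 1 else (0::real)) = (\<Sum>\<chi>\<in>?V. 1)"
    by (rule sum.mono_neutral_cong_right) (use finite_dirichlet_characters[OF assms] V_sub in auto)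
  finally have sum_e: "(\<Sum>\<chi>\<in>?X. e \<chi>) \<le> -1" using \<open>\<not> card ?V \<le> 1\<close> by simp
  have "ln (real x) \<le> (\<Sum>\<chi>\<in>?X. C \<chi>)" if "1 \<le> x" for x
  proof -
    have "(\<Sum>\<chi>\<in>?X. mangoldt_sum_at \<chi> x) = (\<Sum>\<chi>\<in>?X. \<chi> 1 * mangoldt_sum_at \<chi> x)"
      by (intro sum.cong refl) (use dirichlet_characterD(1) in auto)
    also have "\<dots> = of_real (real (card ?X) * (\<Sum>n | n \<in> {1..x} \<and> [n = 1] (mod N). mangoldt n / real n))"
      by (rule progression_sum_eq_character_sum[OF assms]) simp
    finally have "Re (\<Sum>\<chi>\<in>?X. mangoldt_sum_at \<chi> x)
        = real (card ?X) * (\<Sum>n | n \<in> {1..x} \<and> [n = 1] (mod N). mangoldt n / real n)"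
      by (simp only: Re_complex_of_real)
    then have "0 \<le> (\<Sum>\<chi>\<in>?X. Re (mangoldt_sum_at \<chi> x))"
      by (auto intro!: mult_nonneg_nonneg sum_nonneg divide_nonneg_nonneg mangoldt_nonneg)
    also have "\<dots> \<le> (\<Sum>\<chi>\<in>?X. e \<chi> * ln (real x) + C \<chi>)" by (intro sum_mono C that)
    also have "\<dots> = (\<Sum>\<chi>\<in>?X. e \<chi>) * ln (real x) + (\<Sum>\<chi>\<in>?X. C \<chi>)"
      by (simp add: sum.distrib sum_distrib_right)
    also have "\<dots> \<le> (-1) * ln (real x) + (\<Sum>\<chi>\<in>?X. C \<chi>)"
      using that sum_e by (intro add_right_mono mult_right_mono) auto
    finally show ?thesis by simp
  qed
  moreover obtain x :: nat where x: "exp (\<Sum>\<chi>\<in>?X. C \<chi>) < real x" using reals_Archimedean2 by blast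
  moreover have "0 < real x" using x by (meson exp_gt_zero less_trans)
  moreover from this have "(\<Sum>\<chi>\<in>?X. C \<chi>) < ln (real x)" using x by (metis exp_less_cancel_iff exp_ln)
  ultimately show False by (metis Suc_leI of_nat_0_less_iff One_nat_def not_le)
qed

text \<open>A vanishing character cannot be real, and a vanishing non-real character would differ from its
conjugate, which vanishes as well.\<close>

theorem L_one_nonzero:
  assumes "nonprincipal_character N \<chi>" "0 < N"
  shows "L_one \<chi> \<noteq> 0"
proof
  assume vanishing: "L_one \<chi> = 0"
  define \<psi> where "\<psi> = (\<lambda>n. cnj (\<chi> n))"
  obtain n where n: "Im (\<chi> n) \<noteq> 0" using L_one_nonzero_real[OF assms] vanishing by blast
  have "\<psi> n \<noteq> \<chi> n" using n by (simp add: \<psi>_def complex_eq_iff)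
  then have "card {\<chi>, \<psi>} = 2" by (metis card_2_iff)
  have "nonprincipal_character N \<psi>"
    using assms(1) dirichlet_character_cnj unfolding nonprincipal_character_def \<psi>_def
    by (metis complex_cnj_cnj complex_cnj_one)
  moreover have "L_one \<psi> = 0" using L_one_cnj[OF assms] vanishing by (simp add: \<psi>_def)
  ultimately have "{\<chi>, \<psi>} \<subseteq> {\<chi>. nonprincipal_character N \<chi> \<and> L_one \<chi> = 0}" using assms(1) vanishing by simp
  moreover have "finite {\<chi>. nonprincipal_character N \<chi> \<and> L_one \<chi> = 0}"
    by (rule finite_subset[OF _ finite_dirichlet_characters[OF assms(2)]]) (auto simp: nonprincipal_character_def)
  ultimately have "card {\<chi>, \<psi>} \<le> card {\<chi>. nonprincipal_character N \<chi> \<and> L_one \<chi> = 0}" by (rule card_mono[rotated])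
  then show False using \<open>card {\<chi>, \<psi>} = 2\<close> vanishing_characters_unique[OF assms(2)] by simp
qed

text \<open>Only the principal character contributes an unbounded term, so the sum of \<open>\<Lambda>(n) / n\<close> over the
progression grows like \<open>ln x\<close>. Finitely many primes, together with all proper prime powers, would
contribute only a bounded amount.\<close>

theorem dirichlet_primes_in_progression:
  assumes "0 < N" "coprime l N"
  shows "infinite {p::nat. prime p \<and> [p = l] (mod N)}"
proof
  let ?X = "{\<chi>. dirichlet_character N \<chi>}" and ?P = "{p::nat. prime p \<and> [p = l] (mod N)}"
  assume fin: "finite ?P"
  obtain l' where l': "[l * l' = 1] (mod N)" using cong_solve_coprime_nat[OF assms(2)] by auto
  have "\<exists>C. \<forall>x\<ge>1. norm (\<chi> l' * mangoldt_sum_at \<chi> x - (if \<chi> = principal_character N then of_real (ln (real x)) else 0)) \<le> C"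
    if \<chi>: "\<chi> \<in> ?X" for \<chi>
  proof (cases "\<chi> = principal_character N")
    case True
    have "coprime (l * l') N" using cong_imp_coprime[OF cong_sym[OF l']] by simp
    then have "\<chi> l' = 1" using True by (simp add: principal_character_def)
    then show ?thesis using mangoldt_sum_principal[OF assms(1)] True by simp
  next
    case False
    then have "nonprincipal_character N \<chi>" using character_cases \<chi> by blast
    then obtain C where C: "\<And>x. 1 \<le> x \<Longrightarrow> norm (mangoldt_sum_at \<chi> x) \<le> C"
      using mangoldt_sum_bounded[OF _ assms(1)] L_one_nonzero[OF _ assms(1)] by blast
    have "norm (\<chi> l' * mangoldt_sum_at \<chi> x) \<le> 1 * C" if "1 \<le> x" for x
      unfolding norm_mult using C[OF that] \<chi> norm_dirichlet_character_le[OF _ assms(1), of \<chi> l']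
      by (intro mult_mono) auto
    then show ?thesis using False by (intro exI[of _ C]) simp
  qed
  then obtain C where C: "\<And>\<chi> x. \<chi> \<in> ?X \<Longrightarrow> 1 \<le> x \<Longrightarrow>
      norm (\<chi> l' * mangoldt_sum_at \<chi> x - (if \<chi> = principal_character N then of_real (ln (real x)) else 0)) \<le> C \<chi>"
    by metis
  define B where "B = (\<Sum>p\<in>?P. mangoldt p / real p) + 4"
  have "ln (real x) \<le> real (card ?X) * B + (\<Sum>\<chi>\<in>?X. C \<chi>)" if "1 \<le> x" for x
  proof -
    define S where "S = (\<Sum>n | n \<in> {1..x} \<and> [n = l] (mod N). mangoldt n / real n)"
    have "(\<Sum>\<chi>\<in>?X. if \<chi> = principal_character N then complex_of_real (ln (real x)) else 0) = of_real (ln (real x))"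
      using finite_dirichlet_characters[OF assms(1)] dirichlet_character_principal by simp
    then have "of_real (real (card ?X) * S) - complex_of_real (ln (real x))
        = (\<Sum>\<chi>\<in>?X. \<chi> l' * mangoldt_sum_at \<chi> x - (if \<chi> = principal_character N then of_real (ln (real x)) else 0))"
      by (simp only: S_def progression_sum_eq_character_sum[OF assms(1) l', symmetric] sum_subtractf)
    also have "norm \<dots> \<le> (\<Sum>\<chi>\<in>?X. C \<chi>)" by (rule sum_norm_le) (use C that in blast)
    finally have "\<bar>real (card ?X) * S - ln (real x)\<bar> \<le> (\<Sum>\<chi>\<in>?X. C \<chi>)"
      by (metis norm_of_real of_real_diff)
    moreover have "S \<le> B"
    proof -
      have "S \<le> (\<Sum>n\<in>?P \<union> {n. n \<in> {1..x} \<and> \<not> prime n}. mangoldt n / real n)"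
        unfolding S_def using fin
        by (intro sum_mono2) (auto intro!: divide_nonneg_nonneg mangoldt_nonneg)
      also have "\<dots> = (\<Sum>p\<in>?P. mangoldt p / real p) + (\<Sum>n | n \<in> {1..x} \<and> \<not> prime n. mangoldt n / real n)"
        using fin by (intro sum.union_disjoint) auto
      finally show ?thesis using mangoldt_sum_nonprime_le[of x] by (simp add: B_def)
    qed
    then have "real (card ?X) * S \<le> real (card ?X) * B" by (intro mult_left_mono) auto
    ultimately show ?thesis by linarith
  qed
  moreover obtain x :: nat where x: "exp (real (card ?X) * B + (\<Sum>\<chi>\<in>?X. C \<chi>)) < real x"
    using reals_Archimedean2 by blast
  moreover have "0 < real x" using x by (meson exp_gt_zero less_trans)
  moreover from this have "real (card ?X) * B + (\<Sum>\<chi>\<in>?X. C \<chi>) < ln (real x)"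
    using x by (metis exp_less_cancel_iff exp_ln)
  ultimately show False by (metis Suc_leI of_nat_0_less_iff One_nat_def not_le)
qed

section \<open>The quadratic character\<close>

text \<open>Euler's criterion gives the equation modulo \<open>p\<close>, and the two sides differ by at most \<open>2 < p\<close>.\<close>

lemma Legendre_mult:
  assumes "prime p" "2 < p"
  shows "Legendre (a * b) (int p) = Legendre a (int p) * Legendre b (int p)"
proof -
  have "[Legendre (a * b) (int p) = (a * b) ^ ((p - 1) div 2)] (mod int p)"
    by (rule euler_criterion[OF assms])
  moreover have "[Legendre a (int p) * Legendre b (int p) = (a * b) ^ ((p - 1) div 2)] (mod int p)"
    unfolding power_mult_distrib by (intro cong_mult euler_criterion[OF assms])
  ultimately have "[Legendre (a * b) (int p) = Legendre a (int p) * Legendre b (int p)] (mod int p)"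
    using cong_sym cong_trans by blast
  then have "int p dvd Legendre (a * b) (int p) - Legendre a (int p) * Legendre b (int p)"
    by (simp add: cong_iff_dvd_diff)
  moreover have "\<bar>Legendre (a * b) (int p) - Legendre a (int p) * Legendre b (int p)\<bar> < int p"
    using assms(2) by (auto simp: Legendre_def)
  ultimately show ?thesis using zdvd_not_zless by (metis abs_dvd_iff dvd_abs_iff eq_iff_diff_eq_0 zero_less_abs_iff)
qed

text \<open>This lemma and the next state that an explicit linear combination of multiples of \<open>P\<close> is a
multiple of \<open>P\<close>. Calculations in \<open>\<F>\<^sub>p\<close> are carried out this way: each step names its cofactors, which
leaves a polynomial identity over the integers.\<close>

lemma dvd_combination3:
  fixes P :: int
  assumes "P dvd d1" "P dvd d2" "P dvd d3" "e = a1 * d1 + a2 * d2 + a3 * d3"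
  shows "P dvd e"
  using assms by simp

lemma dvd_combination4:
  fixes P :: int
  assumes "P dvd d1" "P dvd d2" "P dvd d3" "P dvd d4" "e = a1 * d1 + a2 * d2 + a3 * d3 + a4 * d4"
  shows "P dvd e"
  using assms by simp

text \<open>The value at \<open>-1\<close> separates the two parity classes and the two roots of the quadratics; the values
at \<open>-3\<close> and \<open>5\<close> say that the discriminants which arise from vanishing denominators are nonsquares.\<close>

locale apn_prime =
  fixes p :: nat
  assumes prime_p: "prime p" and p_gt_3: "3 < p"
    and Legendre_m1: "Legendre (-1) (int p) = -1"
    and Legendre_m3: "Legendre (-3) (int p) = -1"
    and Legendre_5: "Legendre 5 (int p) = -1"
begin

abbreviation P :: int where "P \<equiv> int p"
abbreviation chi :: "int \<Rightarrow> int" where "chi x \<equiv> Legendre x P"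

lemma prime_P: "prime P" using prime_p by simp

lemma P_dvd_mult: "P dvd a * b \<longleftrightarrow> P dvd a \<or> P dvd b"
  using prime_P by (simp add: prime_dvd_mult_iff)

lemma odd_p: "odd p" using prime_p p_gt_3 by (intro prime_odd_nat) auto

lemma P_dvd_cong: "P dvd a - b \<Longrightarrow> P dvd a \<longleftrightarrow> P dvd b"
  using dvd_add_right_iff[of P "a - b" b] by simp

lemma P_not_dvd_2: "\<not> P dvd 2" using p_gt_3 zdvd_imp_le[of P 2] by auto

lemma P_not_dvd_1: "\<not> P dvd 1" using p_gt_3 zdvd_imp_le[of P 1] by auto

lemma P_dvd_double: "P dvd 2 * a \<longleftrightarrow> P dvd a"
  using P_dvd_mult P_not_dvd_2 by blast

lemma chi_mult: "chi (a * b) = chi a * chi b"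
  using Legendre_mult[OF prime_p] p_gt_3 by simp

lemma chi_eq_0_iff: "chi a = 0 \<longleftrightarrow> P dvd a"
  by (simp add: Legendre_def cong_0_iff)

lemma chi_cases: "\<not> P dvd a \<Longrightarrow> chi a = 1 \<or> chi a = -1"
  by (auto simp: Legendre_def cong_0_iff)

lemma chi_cong: "P dvd a - b \<Longrightarrow> chi a = chi b"
proof -
  assume "P dvd a - b"
  then have "[a = b] (mod P)" by (simp add: cong_iff_dvd_diff)
  then have "[x = a] (mod P) \<longleftrightarrow> [x = b] (mod P)" "[a = x] (mod P) \<longleftrightarrow> [b = x] (mod P)" for x
    using cong_sym cong_trans by blast+
  then show ?thesis by (simp add: Legendre_def QuadRes_def)
qed

lemma chi_minus: "chi (- a) = - chi a"
  using chi_mult[of "-1" a] Legendre_m1 by simp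

lemma chi_square: "\<not> P dvd a \<Longrightarrow> chi (a\<^sup>2) = 1"
  using chi_cases[of a] by (auto simp: power2_eq_square chi_mult)

lemma nonresidue_square:
  assumes "chi d = -1" "P dvd y\<^sup>2 - d * s\<^sup>2"
  shows "P dvd s"
proof (rule ccontr)
  assume "\<not> P dvd s"
  then have "chi (y\<^sup>2) = -1" using chi_cong[OF assms(2)] assms(1) by (simp add: chi_mult chi_square)
  then show False using chi_square[of y] chi_eq_0_iff[of "y\<^sup>2"] chi_cases[of y]
    by (cases "P dvd y") (auto simp: power2_eq_square)
qed

text \<open>The coefficient \<open>A\<^bsub>-1\<^esub>(z)\<close>, taken as an integer instead of a residue modulo \<open>p\<close>.\<close>

definition parity_sign :: "int \<Rightarrow> int" where "parity_sign z = 1 - 2 * (z mod 2)"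

lemma parity_sign_cases: "(even z \<and> parity_sign z = 1) \<or> (odd z \<and> parity_sign z = -1)"
  by (auto simp: parity_sign_def odd_iff_mod_2_eq_one even_iff_mod_2_eq_zero)

lemma parity_sign_square: "parity_sign z * parity_sign z = 1" using parity_sign_cases[of z] by auto

lemma X_dvd: "P dvd X_res c p z - (z + c * (z mod 2))"
  by (simp add: X_res_def parity_bit_def mod_eq_dvd_iff[symmetric])

lemma Y_zero: "P dvd Y_res (-1) c p z" if "P dvd X_res c p z"
proof -
  have "p - 2 \<noteq> 0" using p_gt_3 by simp
  then have "P dvd X_res c p z ^ (p - 2)" using that by (metis dvd_power dvd_trans gr0I)
  then show ?thesis by (simp add: Y_res_def dvd_mod)
qed

lemma Y_inverse: "P dvd Y_res (-1) c p z * X_res c p z - parity_sign z" if "\<not> P dvd X_res c p z"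
proof -
  let ?X = "X_res c p z"
  obtain y where y: "?X = int y" by (metis X_res_def pos_mod_sign nonneg_int_cases of_nat_0_less_iff prime_gt_0_nat prime_p)
  then have "\<not> p dvd y" using that by simp
  then have "[y ^ (p - 1) = 1] (mod p)" by (rule fermat_theorem[OF prime_p])
  then have "[?X ^ (p - 1) = 1] (mod P)" unfolding y by (metis cong_int_iff of_nat_1 of_nat_power)
  moreover have "?X ^ (p - 2) * ?X = ?X ^ (p - 1)"
    using p_gt_3 by (metis Suc_diff_Suc numeral_2_eq_2 power_Suc2 Suc_lessD diff_Suc_1 One_nat_def numeral_3_eq_3)
  ultimately have "[parity_sign z * (?X ^ (p - 2) * ?X) = parity_sign z * 1] (mod P)" by (intro cong_mult cong_refl) simp
  moreover have "[Y_res (-1) c p z = parity_sign z * ?X ^ (p - 2)] (mod P)"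
    unfolding Y_res_def A_coeff_def parity_bit_def parity_sign_def cong_def by (simp add: mod_mult_left_eq)
  then have "[Y_res (-1) c p z * ?X = parity_sign z * ?X ^ (p - 2) * ?X] (mod P)" by (rule cong_scalar_right)
  ultimately have "[Y_res (-1) c p z * ?X = parity_sign z] (mod P)" by (metis cong_trans mult.assoc mult.right_neutral)
  then show ?thesis by (simp add: cong_iff_dvd_diff)
qed

lemma Y_dvd_iff: "P dvd Y_res (-1) c p z \<longleftrightarrow> P dvd X_res c p z"
proof (cases "P dvd X_res c p z")
  case False
  have "\<not> P dvd Y_res (-1) c p z"
  proof
    assume "P dvd Y_res (-1) c p z"
    then have "P dvd parity_sign z" using Y_inverse[OF False] by (metis dvd_diffD dvd_diff_commute dvd_mult2 dvd_diff_right_iff)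
    then show False using parity_sign_cases[of z] P_not_dvd_1 by auto
  qed
  then show ?thesis using False by simp
qed (use Y_zero in simp)

lemma R_odd_iff:
  "odd (R_bit c p z) \<longleftrightarrow> (if P dvd X_res c p z then odd z else chi (X_res c p z) = 1)"
proof (cases "P dvd X_res c p z")
  case True
  then have "chi (X_res c p z) = 0" by (simp add: chi_eq_0_iff)
  then show ?thesis using True by (simp add: R_bit_def rho_def parity_bit_def)
next
  case False
  then show ?thesis using chi_cases[OF False] by (auto simp: R_bit_def rho_def)
qed

lemma B_dvd_P: "P dvd B_map (-1) c p z - Y_res (-1) c p z"
proof -
  have "P dvd B_map (-1) c p z - (P * R_bit c p z + (P + 1) * Y_res (-1) c p z)"
    unfolding B_map_def by (rule dvd_trans[of P "int (2 * p)"]) (auto simp: mod_eq_dvd_iff[symmetric])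
  moreover have "P dvd P * R_bit c p z + (P + 1) * Y_res (-1) c p z - Y_res (-1) c p z"
    by (simp add: algebra_simps)
  ultimately show ?thesis by (metis (no_types, lifting) diff_add_cancel dvd_add add_diff_eq)
qed

lemma B_odd_iff: "odd (B_map (-1) c p z) \<longleftrightarrow> odd (R_bit c p z)"
proof -
  have "2 dvd B_map (-1) c p z - (P * R_bit c p z + (P + 1) * Y_res (-1) c p z)"
    unfolding B_map_def by (rule dvd_trans[of 2 "int (2 * p)"]) (auto simp: mod_eq_dvd_iff[symmetric])
  then show ?thesis using odd_p by simp
qed

lemma dvd_2P_iff: "int (2 * p) dvd a \<longleftrightarrow> even a \<and> P dvd a"
proof -
  have "coprime 2 P" using odd_p by (simp add: coprime_left_2_iff_odd)
  then show ?thesis using divides_mult[of 2 a P] by (auto intro: dvd_trans)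
qed

text \<open>The Chinese remainder theorem for \<open>2 p\<close>: the pair (parity, \<open>X\<close>) is a coordinate system on \<open>\<int>\<^bsub>2 p\<^esub>\<close>.\<close>

lemma eq_of_coordinates:
  assumes "z \<in> Zmod (2 * p)" "w \<in> Zmod (2 * p)" "even z \<longleftrightarrow> even w" "P dvd X_res c p z - X_res c p w"
  shows "z = w"
proof -
  have m: "z mod 2 = w mod 2" using assms(3) by (simp add: even_iff_mod_2_eq_zero) presburger
  have "P dvd z - w"
    by (rule dvd_combination3[OF assms(4) X_dvd[of c z] X_dvd[of c w], of _ 1 "-1" 1]) (simp add: m)
  moreover have "even (z - w)" using assms(3) by simp
  ultimately have "int (2 * p) dvd z - w" using dvd_2P_iff by blast
  then have "z mod int (2 * p) = w mod int (2 * p)" by (simp add: mod_eq_dvd_iff)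
  then show ?thesis using assms(1,2) by (simp add: Zmod_def)
qed

section \<open>The difference equation\<close>

definition solves :: "int \<Rightarrow> int \<Rightarrow> int \<Rightarrow> int \<Rightarrow> bool" where
  "solves c u v z \<longleftrightarrow> z \<in> Zmod (2 * p) \<and>
     (B_map (-1) c p ((z + u) mod int (2 * p)) - B_map (-1) c p z) mod int (2 * p) = v"

text \<open>The difference equation in coordinates: one equation between the \<open>Y\<close> modulo \<open>p\<close> and one between
the \<open>R\<close> modulo \<open>2\<close>. The shift of \<open>X\<close> depends on how the parity changes.\<close>

lemma solvesE:
  assumes "solves c u v z"
  obtains z' where "even z' \<longleftrightarrow> even (z + u)"
    "P dvd X_res c p z' - (X_res c p z + u + c * (z' mod 2 - z mod 2))"
    "P dvd Y_res (-1) c p z' - Y_res (-1) c p z - v"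
    "odd v \<longleftrightarrow> odd (R_bit c p z') \<noteq> odd (R_bit c p z)"
proof
  let ?z' = "(z + u) mod int (2 * p)"
  have z': "int (2 * p) dvd ?z' - (z + u)" by (simp add: mod_eq_dvd_iff[symmetric])
  then have "even (?z' - (z + u))" "P dvd ?z' - (z + u)" using dvd_2P_iff by blast+
  then show "even ?z' \<longleftrightarrow> even (z + u)" by simp
  show "P dvd X_res c p ?z' - (X_res c p z + u + c * (?z' mod 2 - z mod 2))"
    by (rule dvd_combination3[OF X_dvd[of c ?z'] X_dvd[of c z] \<open>P dvd ?z' - (z + u)\<close>, of _ 1 "-1" 1])
      (simp add: algebra_simps)
  have "int (2 * p) dvd B_map (-1) c p ?z' - B_map (-1) c p z - v"
    using assms unfolding solves_def by (metis dvd_minus_mod)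
  then have B: "even (B_map (-1) c p ?z' - B_map (-1) c p z - v)" "P dvd B_map (-1) c p ?z' - B_map (-1) c p z - v"
    using dvd_2P_iff by blast+
  show "P dvd Y_res (-1) c p ?z' - Y_res (-1) c p z - v"
    by (rule dvd_combination3[OF B(2) B_dvd_P[of c ?z'] B_dvd_P[of c z], of _ 1 "-1" 1]) simp
  show "odd v \<longleftrightarrow> odd (R_bit c p ?z') \<noteq> odd (R_bit c p z)"
    using B(1) B_odd_iff[of c ?z'] B_odd_iff[of c z] by auto
qed

text \<open>Clearing denominators in \<open>\<sigma> / (x + u) - \<sigma> / x = v\<close> gives the quadratic. Since \<open>v x (x + u) = - \<sigma> u\<close>,
the character of \<open>x (x + u)\<close> is that of \<open>- \<sigma> u v\<close>; on the other hand, it tells whether the two bits \<open>R\<close> differ,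
that is, the parity of \<open>v\<close>.\<close>

lemma even_shift_generic:
  assumes "solves c u v z" "even u" and x: "x = X_res c p z" and nz: "\<not> P dvd x" "\<not> P dvd x + u"
  shows "P dvd v * (x * (x + u)) + parity_sign z * u" "\<not> P dvd u \<Longrightarrow> odd v \<longleftrightarrow> chi (parity_sign z * (u * v)) = 1"
proof -
  obtain z' where z': "even z' \<longleftrightarrow> even (z + u)"
      "P dvd X_res c p z' - (x + u + c * (z' mod 2 - z mod 2))"
      "P dvd Y_res (-1) c p z' - Y_res (-1) c p z - v"
      "odd v \<longleftrightarrow> odd (R_bit c p z') \<noteq> odd (R_bit c p z)"
    using solvesE[OF assms(1)] unfolding x by blast
  define x' where "x' = X_res c p z'"
  have par: "z' mod 2 = z mod 2" using z'(1) \<open>even u\<close> by (simp add: even_iff_mod_2_eq_zero) presburger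
  then have parity_sign: "parity_sign z' = parity_sign z" by (simp add: parity_sign_def)
  have D: "P dvd x' - (x + u)" using z'(2) par by (simp add: x'_def)
  have nz': "\<not> P dvd x'" using D nz(2) P_dvd_cong by blast
  have B: "P dvd Y_res (-1) c p z * x - parity_sign z" using Y_inverse nz(1) x by simp
  have C: "P dvd Y_res (-1) c p z' * x' - parity_sign z" using Y_inverse[of c z'] nz' parity_sign by (simp add: x'_def)
  have "P dvd (- x * x') * (Y_res (-1) c p z' - Y_res (-1) c p z - v) + (- x') * (Y_res (-1) c p z * x - parity_sign z)
      + x * (Y_res (-1) c p z' * x' - parity_sign z) + (- v * x - parity_sign z) * (x' - (x + u))"
    by (rule dvd_combination4[OF z'(3) B C D refl])
  also have "\<dots> = v * (x * (x + u)) + parity_sign z * u" by (simp add: algebra_simps)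
  finally show E: "P dvd v * (x * (x + u)) + parity_sign z * u" .
  assume u: "\<not> P dvd u"
  have v: "\<not> P dvd v"
  proof
    assume "P dvd v"
    then have "P dvd v * (x * (x + u))" by simp
    then have "P dvd parity_sign z * u" using E by (simp add: dvd_add_right_iff)
    then show False using u parity_sign_cases[of z] by auto
  qed
  \<comment> \<open>The factor \<open>v\<^sup>2\<close> does not affect the character but avoids a division by \<open>v\<close>.\<close>
  have "P dvd v * v * (x * x') - (- (parity_sign z * (u * v)))"
    by (rule dvd_combination3[OF E D E, of _ v "v * v * x" 0]) (simp add: algebra_simps)
  then have "chi (v * v * (x * x')) = - chi (parity_sign z * (u * v))" using chi_cong chi_minus by metis
  moreover have "chi (v * v * (x * x')) = chi x * chi x'"
    using chi_square[OF v] by (simp add: chi_mult power2_eq_square)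
  moreover have "odd v \<longleftrightarrow> (chi x' = 1) \<noteq> (chi x = 1)"
    using z'(4) R_odd_iff[of c z'] R_odd_iff[of c z] nz(1) nz' by (simp add: x x'_def)
  ultimately show "odd v \<longleftrightarrow> chi (parity_sign z * (u * v)) = 1"
    using chi_cases[OF nz(1)] chi_cases[OF nz'] by auto
qed

text \<open>If one of the denominators is \<open>0\<close>, the equation reads \<open>\<sigma> / u = v\<close>. The two possibilities \<open>x = 0\<close> and
\<open>x = - u\<close> lead to opposite parities of \<open>v\<close>, because \<open>\<chi>(- u) = - \<chi>(u)\<close>.\<close>

lemma even_shift_special:
  assumes "solves c u v z" "even u" "\<not> P dvd u" and x: "x = X_res c p z" and special: "P dvd x \<or> P dvd x + u"
  shows "P dvd v * u - parity_sign z" "P dvd x \<Longrightarrow> odd v \<longleftrightarrow> (chi u = 1) \<noteq> odd z"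
    "P dvd x + u \<Longrightarrow> odd v \<longleftrightarrow> (chi u = 1) = odd z"
proof -
  obtain z' where z': "even z' \<longleftrightarrow> even (z + u)"
      "P dvd X_res c p z' - (x + u + c * (z' mod 2 - z mod 2))"
      "P dvd Y_res (-1) c p z' - Y_res (-1) c p z - v"
      "odd v \<longleftrightarrow> odd (R_bit c p z') \<noteq> odd (R_bit c p z)"
    using solvesE[OF assms(1)] unfolding x by blast
  define x' where "x' = X_res c p z'"
  have par: "z' mod 2 = z mod 2" using z'(1) \<open>even u\<close> by (simp add: even_iff_mod_2_eq_zero) presburger
  then have parity_sign: "parity_sign z' = parity_sign z" by (simp add: parity_sign_def)
  have D: "P dvd x' - (x + u)" using z'(2) par by (simp add: x'_def)
  have first: "P dvd v * u - parity_sign z \<and> (odd v \<longleftrightarrow> (chi u = 1) \<noteq> odd z)" if "P dvd x"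
  proof -
    have x'u: "P dvd x' - u" by (rule dvd_combination3[OF D that that, of _ 1 1 0]) simp
    then have nz': "\<not> P dvd x'" using assms(3) P_dvd_cong by blast
    have Y: "P dvd Y_res (-1) c p z" using Y_dvd_iff that x by simp
    have C: "P dvd Y_res (-1) c p z' * x' - parity_sign z" using Y_inverse[of c z'] nz' parity_sign by (simp add: x'_def)
    have "P dvd (- u) * (Y_res (-1) c p z' - Y_res (-1) c p z - v) + (- u) * Y_res (-1) c p z
       + 1 * (Y_res (-1) c p z' * x' - parity_sign z) + (- Y_res (-1) c p z') * (x' - u)"
      by (rule dvd_combination4[OF z'(3) Y C x'u refl])
    also have "\<dots> = v * u - parity_sign z" by (simp add: algebra_simps)
    finally have "P dvd v * u - parity_sign z" .
    moreover have "odd v \<longleftrightarrow> (chi u = 1) \<noteq> odd z"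
      using z'(4) R_odd_iff[of c z'] R_odd_iff[of c z] nz' that chi_cong[OF x'u] by (simp add: x x'_def)
    ultimately show ?thesis by blast
  qed
  have second: "P dvd v * u - parity_sign z \<and> (odd v \<longleftrightarrow> (chi u = 1) = odd z)" if xu: "P dvd x + u"
  proof -
    have nz: "\<not> P dvd x" using assms(3) xu by (metis dvd_add_right_iff)
    have "P dvd x'" by (rule dvd_combination3[OF D xu xu, of _ 1 1 0]) simp
    then have Y': "P dvd Y_res (-1) c p z'" "P dvd X_res c p z'" using Y_dvd_iff by (simp_all add: x'_def)
    have B: "P dvd Y_res (-1) c p z * x - parity_sign z" using Y_inverse nz x by simp
    have "P dvd (- u) * (Y_res (-1) c p z' - Y_res (-1) c p z - v) + u * Y_res (-1) c p z'
       + 1 * (Y_res (-1) c p z * x - parity_sign z) + (- Y_res (-1) c p z) * (x + u)"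
      by (rule dvd_combination4[OF z'(3) Y'(1) B xu refl])
    also have "\<dots> = v * u - parity_sign z" by (simp add: algebra_simps)
    finally have "P dvd v * u - parity_sign z" .
    moreover have "chi x = - chi u" using chi_cong[of x "- u"] xu chi_minus by simp
    then have "odd v \<longleftrightarrow> (chi u = 1) = odd z"
      using z'(1,4) R_odd_iff[of c z'] R_odd_iff[of c z] nz Y'(2) chi_cases[OF assms(3)] \<open>even u\<close>
      by (auto simp: x)
    ultimately show ?thesis by blast
  qed
  show "P dvd v * u - parity_sign z" using special first second by blast
  show "P dvd x \<Longrightarrow> odd v \<longleftrightarrow> (chi u = 1) \<noteq> odd z" using first by blast
  show "P dvd x + u \<Longrightarrow> odd v \<longleftrightarrow> (chi u = 1) = odd z" using second by blast
qed

lemma parity_sign_eq_if_cong: "even z \<longleftrightarrow> even w" if "P dvd parity_sign z - parity_sign w"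
proof -
  have "\<not> P dvd 2" "\<not> P dvd - 2" using P_not_dvd_2 by auto
  then show ?thesis using that parity_sign_cases[of z] parity_sign_cases[of w] by auto
qed

text \<open>Solutions with and without a vanishing denominator exclude each other: inserting \<open>v u = \<plusminus>1\<close> into the
quadratic gives \<open>x\<^sup>2 + u x \<plusminus> u\<^sup>2 = 0\<close>, of discriminant \<open>-3 u\<^sup>2\<close> or \<open>5 u\<^sup>2\<close>. There is at most one solution with a
vanishing denominator. The others all have the same parity, by \<open>\<chi>(-1) = -1\<close>, and satisfy one
quadratic equation.\<close>

lemma even_shift_no_three:
  assumes sols: "solves c u v z1" "solves c u v z2" "solves c u v z3" and u: "even u" "\<not> P dvd u"
  shows "z1 = z2 \<or> z1 = z3 \<or> z2 = z3"
proof -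
  define X where "X z = X_res c p z" for z
  define special where "special z \<longleftrightarrow> P dvd X z \<or> P dvd X z + u" for z
  have Z: "z \<in> Zmod (2 * p)" if "solves c u v z" for z using that by (simp add: solves_def)
  have mixed: False if a: "solves c u v a" "\<not> special a" and b: "solves c u v b" "special b" for a b
  proof -
    have E: "P dvd v * (X a * (X a + u)) + parity_sign a * u"
      using even_shift_generic(1)[OF a(1) u(1) X_def] a(2) by (simp add: special_def)
    have F: "P dvd v * u - parity_sign b"
      using even_shift_special(1)[OF b(1) u X_def] b(2) by (simp add: special_def)
    \<comment> \<open>Elimination of \<open>v\<close> from \<open>E\<close> and \<open>F\<close>, followed by completing the square.\<close>
    have "P dvd (4 * parity_sign b * u) * (v * (X a * (X a + u)) + parity_sign a * u) + (- 4 * parity_sign b * (X a * (X a + u))) * (v * u - parity_sign b)"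
      by (rule dvd_add[OF dvd_mult[OF E] dvd_mult[OF F]])
    also have "\<dots> = 4 * (parity_sign b * parity_sign b) * (X a * (X a + u)) + 4 * (parity_sign a * parity_sign b) * u\<^sup>2"
      by (simp add: algebra_simps power2_eq_square)
    also have "\<dots> = (2 * X a + u)\<^sup>2 - (1 - 4 * (parity_sign a * parity_sign b)) * u\<^sup>2"
      unfolding parity_sign_square by (simp add: algebra_simps power2_eq_square)
    finally have "P dvd (2 * X a + u)\<^sup>2 - (1 - 4 * (parity_sign a * parity_sign b)) * u\<^sup>2" .
    moreover have "chi (1 - 4 * (parity_sign a * parity_sign b)) = -1"
      using parity_sign_cases[of a] parity_sign_cases[of b] Legendre_m3 Legendre_5 by auto
    ultimately have "P dvd u" using nonresidue_square by blast
    then show False using u(2) by simp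
  qed
  have special_unique: "a = b" if a: "solves c u v a" "special a" and b: "solves c u v b" "special b" for a b
  proof -
    have F: "P dvd v * u - parity_sign z" if "solves c u v z" "special z" for z
      using even_shift_special(1)[OF that(1) u X_def] that(2) by (simp add: special_def)
    have "P dvd parity_sign a - parity_sign b"
      by (rule dvd_combination3[OF F[OF a] F[OF b] F[OF b], of _ "-1" 1 0]) simp
    then have par: "even a \<longleftrightarrow> even b" by (rule parity_sign_eq_if_cong)
    have bit: "(odd v \<longleftrightarrow> (chi u = 1) \<noteq> odd z) \<and> P dvd X z \<or> (odd v \<longleftrightarrow> (chi u = 1) = odd z) \<and> P dvd X z + u"
      if "solves c u v z" "special z" for z
      using even_shift_special(2,3)[OF that(1) u X_def] that(2) unfolding special_def by blast
    consider "P dvd X a" "P dvd X b" | "P dvd X a + u" "P dvd X b + u"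
      using bit[OF a] bit[OF b] par by blast
    then have "P dvd X a - X b"
    proof cases
      case 2
      then have "P dvd (X a + u) - (X b + u)" by (rule dvd_diff)
      then show ?thesis by simp
    qed simp
    then show ?thesis using eq_of_coordinates[OF Z[OF a(1)] Z[OF b(1)] par] by (simp add: X_def)
  qed
  have generic_pair: "(even a \<longleftrightarrow> even b) \<and> (P dvd X a - X b \<or> P dvd X a + X b + u)"
    if a: "solves c u v a" "\<not> special a" and b: "solves c u v b" "\<not> special b" for a b
  proof -
    have E: "P dvd v * (X z * (X z + u)) + parity_sign z * u" and bit: "odd v \<longleftrightarrow> chi (parity_sign z * (u * v)) = 1"
      if "solves c u v z" "\<not> special z" for z
      using even_shift_generic[OF that(1) u(1) X_def] that(2) u(2) by (simp_all add: special_def)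
    have v: "\<not> P dvd v"
    proof
      assume "P dvd v"
      then have "P dvd v * (X a * (X a + u))" by simp
      then have "P dvd parity_sign a * u" using E[OF a] by (simp add: dvd_add_right_iff)
      then show False using u(2) parity_sign_cases[of a] by auto
    qed
    have "chi (u * v) = 1 \<or> chi (u * v) = -1" using chi_cases P_dvd_mult u(2) v by blast
    then have par: "even a \<longleftrightarrow> even b"
      using bit[OF a] bit[OF b] parity_sign_cases[of a] parity_sign_cases[of b] by (auto simp: chi_minus)
    then have parity_sign: "parity_sign a = parity_sign b" using parity_sign_cases[of a] parity_sign_cases[of b] by auto
    have "P dvd v * ((X a - X b) * (X a + X b + u))"
      by (rule dvd_combination3[OF E[OF a] E[OF b] E[OF b], of _ 1 "-1" 0]) (simp add: parity_sign algebra_simps)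
    then show ?thesis using par v by (simp add: P_dvd_mult)
  qed
  show ?thesis
  proof (cases "special z1 \<or> special z2 \<or> special z3")
    case True
    then have "special z1 \<and> special z2" using mixed sols by blast
    then show ?thesis using special_unique sols by blast
  next
    case False
    then have par: "even z1 \<longleftrightarrow> even z2" "even z1 \<longleftrightarrow> even z3"
      and alt: "P dvd X z1 - X z2 \<or> P dvd X z1 + X z2 + u" "P dvd X z1 - X z3 \<or> P dvd X z1 + X z3 + u"
      using generic_pair sols by blast+
    consider "P dvd X z1 - X z2" | "P dvd X z1 - X z3" | "P dvd X z1 + X z2 + u" "P dvd X z1 + X z3 + u"
      using alt by blast
    then show ?thesis
    proof cases
      case 3
      then have "P dvd (X z1 + X z2 + u) - (X z1 + X z3 + u)" by (rule dvd_diff)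
      then have "P dvd X z2 - X z3" by simp
      then show ?thesis using eq_of_coordinates[OF Z[OF sols(2)] Z[OF sols(3)]] par by (simp add: X_def)
    qed (use eq_of_coordinates Z sols par in \<open>auto simp: X_def\<close>)
  qed
qed

text \<open>For odd \<open>u\<close> the parity changes, so \<open>X\<close> is shifted by \<open>t = u + \<sigma> c\<close> and the sign \<open>\<sigma>\<close> is reversed.
The numbers \<open>x'\<close>, \<open>y'\<close> are \<open>X\<close>, \<open>Y\<close> at \<open>z + u\<close>, and \<open>y\<close> is \<open>Y\<close> at \<open>z\<close>; the bits are compared only if neither \<open>x\<close> nor
\<open>x'\<close> vanishes modulo \<open>p\<close>.\<close>

lemma odd_shift_coordinates:
  assumes "solves c u v z" "odd u" and x: "x = X_res c p z" and t: "t = u + parity_sign z * c"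
  obtains x' y y' where "P dvd x' - (x + t)" "P dvd y' - y - v"
    "P dvd x \<longleftrightarrow> P dvd y" "P dvd x' \<longleftrightarrow> P dvd y'"
    "\<not> P dvd x \<Longrightarrow> P dvd y * x - parity_sign z" "\<not> P dvd x' \<Longrightarrow> P dvd y' * x' + parity_sign z"
    "\<not> P dvd x \<Longrightarrow> \<not> P dvd x' \<Longrightarrow> odd v \<longleftrightarrow> (chi x' = 1) \<noteq> (chi x = 1)"
proof -
  obtain z' where z': "even z' \<longleftrightarrow> even (z + u)"
      "P dvd X_res c p z' - (x + u + c * (z' mod 2 - z mod 2))"
      "P dvd Y_res (-1) c p z' - Y_res (-1) c p z - v"
      "odd v \<longleftrightarrow> odd (R_bit c p z') \<noteq> odd (R_bit c p z)"
    using solvesE[OF assms(1)] unfolding x by blast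
  have par: "z' mod 2 = 1 - z mod 2" using z'(1) \<open>odd u\<close> by (simp add: even_iff_mod_2_eq_zero) presburger
  then have parity_sign: "parity_sign z' = - parity_sign z" by (simp add: parity_sign_def)
  have "c * (z' mod 2 - z mod 2) = parity_sign z * c" by (simp only: par parity_sign_def) (simp add: algebra_simps)
  then have D: "P dvd X_res c p z' - (x + t)" using z'(2) unfolding t by (simp only: add.assoc)
  show ?thesis
  proof (rule that[OF D z'(3)])
    show "P dvd x \<longleftrightarrow> P dvd Y_res (-1) c p z" "P dvd X_res c p z' \<longleftrightarrow> P dvd Y_res (-1) c p z'"
      using Y_dvd_iff x by simp_all
    show "P dvd Y_res (-1) c p z * x - parity_sign z" if "\<not> P dvd x" using that Y_inverse x by simp
    show "P dvd Y_res (-1) c p z' * X_res c p z' + parity_sign z" if "\<not> P dvd X_res c p z'"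
      using Y_inverse[OF that] parity_sign by simp
    show "odd v \<longleftrightarrow> (chi (X_res c p z') = 1) \<noteq> (chi x = 1)" if "\<not> P dvd x" "\<not> P dvd X_res c p z'"
      using z'(4) R_odd_iff[of c z'] R_odd_iff[of c z] that by (simp add: x)
  qed
qed

text \<open>The equation \<open>- s / x' - s / x = v\<close> with denominators cleared.\<close>

lemma odd_shift_cross:
  fixes x x' y y' v s :: int
  assumes "P dvd y' - y - v" "P dvd y * x - s" "P dvd y' * x' + s"
  shows "P dvd v * (x * x') + s * (x + x')"
proof -
  have "P dvd x * (y' * x' + s) + (- x') * (y * x - s) + (- x * x') * (y' - y - v)"
    by (rule dvd_combination3[OF assms(3,2,1) refl])
  also have "\<dots> = v * (x * x') + s * (x + x')" by (simp add: algebra_simps)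
  finally show ?thesis .
qed

text \<open>For \<open>v = 0\<close> modulo \<open>p\<close> the equation is \<open>- 1 / x' = 1 / x\<close>, so \<open>x' = - x\<close>, also when \<open>x\<close> or \<open>x'\<close> is \<open>0\<close>.\<close>

lemma odd_shift_degenerate:
  assumes "solves c u v z" "odd u" and x: "x = X_res c p z" and t: "t = u + parity_sign z * c" and v: "P dvd v"
  shows "P dvd 2 * x + t"
proof -
  obtain x' y y' where D: "P dvd x' - (x + t)" and A: "P dvd y' - y - v"
    and xy: "P dvd x \<longleftrightarrow> P dvd y" and xy': "P dvd x' \<longleftrightarrow> P dvd y'"
    and B: "\<not> P dvd x \<Longrightarrow> P dvd y * x - parity_sign z" and C: "\<not> P dvd x' \<Longrightarrow> P dvd y' * x' + parity_sign z"
    using odd_shift_coordinates[OF assms(1-4)] by metis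
  have "P dvd (y' - y - v) + v" using A v by (rule dvd_add)
  then have "P dvd y' - y" by simp
  then have iff: "P dvd x \<longleftrightarrow> P dvd x'" using P_dvd_cong xy xy' by blast
  have "P dvd x + x'"
  proof (cases "P dvd x")
    case False
    then have "P dvd v * (x * x') + parity_sign z * (x + x')" using odd_shift_cross[OF A B C] iff by blast
    then have "P dvd parity_sign z * (x + x')" using v by (simp add: dvd_add_right_iff)
    then show ?thesis using parity_sign_cases[of z] by (auto simp: P_dvd_mult)
  qed (use iff in simp)
  then show ?thesis
    by (rule dvd_combination3[OF _ D D, of _ _ 1 "-1" 0]) simp
qed

text \<open>If one denominator is \<open>0\<close> and \<open>v\<close> is not, the other denominator is \<open>\<plusminus> t\<close> and determines \<open>v t\<close>.\<close>

lemma odd_shift_special: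
  assumes "solves c u v z" "odd u" and x: "x = X_res c p z" and t: "t = u + parity_sign z * c" and v: "\<not> P dvd v"
    and v1: "v1 = - parity_sign z * v"
  shows "P dvd x \<Longrightarrow> P dvd v1 * t - 1" "P dvd x + t \<Longrightarrow> P dvd v1 * t + 1"
proof -
  obtain x' y y' where D: "P dvd x' - (x + t)" and A: "P dvd y' - y - v"
    and xy: "P dvd x \<longleftrightarrow> P dvd y" and xy': "P dvd x' \<longleftrightarrow> P dvd y'"
    and B: "\<not> P dvd x \<Longrightarrow> P dvd y * x - parity_sign z" and C: "\<not> P dvd x' \<Longrightarrow> P dvd y' * x' + parity_sign z"
    using odd_shift_coordinates[OF assms(1-4)] by metis
  have not_both: "\<not> (P dvd x \<and> P dvd x')"
  proof
    assume "P dvd x \<and> P dvd x'"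
    then have "P dvd y' - y" using xy xy' by simp
    then show False using A v P_dvd_cong by blast
  qed
  show "P dvd v1 * t - 1" if "P dvd x"
  proof -
    have x't: "P dvd x' - t" by (rule dvd_combination3[OF D that that, of _ 1 1 0]) simp
    have C': "P dvd y' * x' + parity_sign z" using not_both that C by blast
    have y: "P dvd y" using that xy by blast
    have "P dvd (parity_sign z * t) * (y' - y - v) + (parity_sign z * t) * y + (- parity_sign z) * (y' * x' + parity_sign z) + (parity_sign z * y') * (x' - t)"
      by (rule dvd_combination4[OF A y C' x't refl])
    also have "\<dots> = - (parity_sign z * v * t) - parity_sign z * parity_sign z" by (simp add: algebra_simps)
    finally show ?thesis by (simp add: v1 parity_sign_square)
  qed
  show "P dvd v1 * t + 1" if xt: "P dvd x + t"
  proof -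
    have "P dvd x'" using D xt P_dvd_cong by blast
    then have y': "P dvd y'" and B': "P dvd y * x - parity_sign z" using not_both xy' B by blast+
    have "P dvd (parity_sign z * t) * (y' - y - v) + (- parity_sign z * t) * y' + (- parity_sign z) * (y * x - parity_sign z) + (parity_sign z * y) * (x + t)"
      by (rule dvd_combination4[OF A y' B' xt refl])
    also have "\<dots> = - (parity_sign z * v * t) + parity_sign z * parity_sign z" by (simp add: algebra_simps)
    finally show ?thesis by (simp add: v1 parity_sign_square)
  qed
qed

text \<open>The quadratic \<open>v\<^sub>1 x (x + t) = 2 x + t\<close> becomes monic with constant term \<open>-1\<close> in \<open>h = v\<^sub>1 x - 1\<close>. Moreover
\<open>h (x + t) = x\<close>, so \<open>\<chi>(h)\<close> compares the characters of \<open>x\<close> and \<open>x + t\<close>, which is what the parity of \<open>v\<close> records.\<close>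

lemma odd_shift_generic:
  assumes "solves c u v z" "odd u" and x: "x = X_res c p z" and t: "t = u + parity_sign z * c"
    and nz: "\<not> P dvd x" "\<not> P dvd x + t" and v1: "v1 = - parity_sign z * v" and h: "h = v1 * x - 1"
  shows "P dvd h\<^sup>2 + v1 * t * h - 1" "\<not> P dvd h" "odd v \<longleftrightarrow> chi h = -1"
proof -
  obtain x' y y' where D: "P dvd x' - (x + t)" and A: "P dvd y' - y - v"
    and B: "\<not> P dvd x \<Longrightarrow> P dvd y * x - parity_sign z" and C: "\<not> P dvd x' \<Longrightarrow> P dvd y' * x' + parity_sign z"
    and bit: "\<not> P dvd x \<Longrightarrow> \<not> P dvd x' \<Longrightarrow> odd v \<longleftrightarrow> (chi x' = 1) \<noteq> (chi x = 1)"
    using odd_shift_coordinates[OF assms(1-4)] by metis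
  have nz': "\<not> P dvd x'" using D nz(2) P_dvd_cong by blast
  have "P dvd (- parity_sign z) * (v * (x * x') + parity_sign z * (x + x'))"
    by (rule dvd_mult[OF odd_shift_cross[OF A B[OF nz(1)] C[OF nz']]])
  also have "(- parity_sign z) * (v * (x * x') + parity_sign z * (x + x')) = h * x' - (parity_sign z * parity_sign z) * x + (1 - parity_sign z * parity_sign z) * x'"
    by (simp add: h v1 algebra_simps)
  finally have E: "P dvd h * x' - x" by (simp add: parity_sign_square)
  show "P dvd h\<^sup>2 + v1 * t * h - 1"
    by (rule dvd_combination3[OF E D D, of _ v1 "v1 * (1 - v1 * x)" 0])
      (simp add: h power2_eq_square algebra_simps)
  show h0: "\<not> P dvd h"
  proof
    assume "P dvd h"
    then have "P dvd h * x'" by simp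
    then show False using E nz(1) P_dvd_cong by blast
  qed
  have "chi x = chi h * chi x'" using chi_cong[OF E] by (simp add: chi_mult)
  then show "odd v \<longleftrightarrow> chi h = -1"
    using bit[OF nz(1) nz'] chi_cases[OF nz(1)] chi_cases[OF nz'] chi_cases[OF h0] by auto
qed

text \<open>Two different roots \<open>h\<close> of the quadratic have product \<open>-1\<close>, a nonsquare, whereas the parity of
\<open>v\<close> prescribes one value of \<open>\<chi>(h)\<close>. A vanishing denominator means \<open>v\<^sub>1 t = \<plusminus>1\<close>; then the quadratic has
discriminant \<open>5\<close> and no root, and the sign decides which denominator vanishes.\<close>

lemma odd_shift_unique:
  assumes a: "solves c u v a" and b: "solves c u v b" and u: "odd u" and par: "even a \<longleftrightarrow> even b"
  shows "a = b"
proof -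
  define X where "X z = X_res c p z" for z
  define t where "t = u + parity_sign a * c"
  define v1 where "v1 = - parity_sign a * v"
  have parity_sign: "parity_sign b = parity_sign a" using par parity_sign_cases[of a] parity_sign_cases[of b] by auto
  have "P dvd X a - X b"
  proof (cases "P dvd v")
    case True
    have "P dvd (2 * X a + t) - (2 * X b + t)"
      using odd_shift_degenerate[OF a u X_def t_def True] odd_shift_degenerate[OF b u X_def _ True, of t]
      by (intro dvd_diff) (simp_all add: t_def parity_sign)
    then have "P dvd 2 * (X a - X b)" by (simp add: algebra_simps)
    then show ?thesis using P_dvd_double by blast
  next
    case False
    define h where "h z = v1 * X z - 1" for z
    have special: "P dvd X z \<Longrightarrow> P dvd v1 * t - 1" "P dvd X z + t \<Longrightarrow> P dvd v1 * t + 1"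
      if "z = a \<or> z = b" for z
      using that odd_shift_special[OF a u X_def t_def False v1_def]
        odd_shift_special[OF b u X_def _ False, of t v1] by (auto simp: t_def v1_def parity_sign)
    have generic: "P dvd (h z)\<^sup>2 + v1 * t * h z - 1" "\<not> P dvd h z" "odd v \<longleftrightarrow> chi (h z) = -1"
      if "z = a \<or> z = b" "\<not> P dvd X z" "\<not> P dvd X z + t" for z
      using that odd_shift_generic[OF a u X_def t_def _ _ v1_def h_def]
        odd_shift_generic[OF b u X_def _ _ _ _ h_def, of t] by (auto simp: t_def v1_def parity_sign)
    have mixed: False if "P dvd v1 * t - k" "k\<^sup>2 = 1" and g: "P dvd (h z)\<^sup>2 + v1 * t * h z - 1" for k z
    proof -
      have "P dvd 4 * ((h z)\<^sup>2 + v1 * t * h z - 1) + (- 4 * h z) * (v1 * t - k)"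
        by (rule dvd_add[OF dvd_mult[OF g] dvd_mult[OF that(1)]])
      also have "\<dots> = (2 * h z + k)\<^sup>2 - 5 * 1\<^sup>2 + (1 - k\<^sup>2)" by (simp add: power2_eq_square algebra_simps)
      finally have "P dvd (2 * h z + k)\<^sup>2 - 5 * 1\<^sup>2" using that(2) by simp
      then have "P dvd 1" using nonresidue_square[OF Legendre_5] by blast
      then show False using P_not_dvd_1 by simp
    qed
    have no_both: "\<not> (P dvd v1 * t - 1 \<and> P dvd v1 * t + 1)"
    proof
      assume *: "P dvd v1 * t - 1 \<and> P dvd v1 * t + 1"
      have "P dvd 2"
        by (rule dvd_combination3[OF conjunct1[OF *] conjunct2[OF *] conjunct2[OF *], of _ "-1" 1 0]) simp
      then show False using P_not_dvd_2 by simp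
    qed
    have mixed': False if "P dvd v1 * t - 1 \<or> P dvd v1 * t + 1" "z = a \<or> z = b" "\<not> P dvd X z" "\<not> P dvd X z + t" for z
      using that(1) mixed[of 1 z] mixed[of "-1" z] generic(1)[OF that(2-4)] by auto
    show ?thesis
    proof (cases "P dvd X a \<or> P dvd X a + t \<or> P dvd X b \<or> P dvd X b + t")
      case True
      then have "P dvd v1 * t - 1 \<or> P dvd v1 * t + 1" using special by blast
      then have "P dvd X a \<or> P dvd X a + t" "P dvd X b \<or> P dvd X b + t" using mixed' by blast+
      then consider "P dvd X a" "P dvd X b" | "P dvd X a + t" "P dvd X b + t" using special no_both by blast
      then show ?thesis
      proof cases
        case 2
        then have "P dvd (X a + t) - (X b + t)" by (rule dvd_diff)
        then show ?thesis by simp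
      qed simp
    next
      case gen: False
      then have ga: "P dvd (h a)\<^sup>2 + v1 * t * h a - 1" "\<not> P dvd h a" "odd v \<longleftrightarrow> chi (h a) = -1"
        and gb: "P dvd (h b)\<^sup>2 + v1 * t * h b - 1" "\<not> P dvd h b" "odd v \<longleftrightarrow> chi (h b) = -1"
        using generic by blast+
      have "P dvd (h a - h b) * (h a + h b + v1 * t)"
        by (rule dvd_combination3[OF ga(1) gb(1) gb(1), of _ 1 "-1" 0]) (simp add: algebra_simps power2_eq_square)
      then consider "P dvd h a - h b" | "P dvd h a + h b + v1 * t" by (auto simp: P_dvd_mult)
      then show ?thesis
      proof cases
        case 1
        then have "P dvd v1 * (X a - X b)" by (simp add: h_def algebra_simps)
        then show ?thesis using False parity_sign_cases[of a] by (auto simp: P_dvd_mult v1_def)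
      next
        case 2
        have "P dvd h a * h b - (-1)"
          by (rule dvd_combination3[OF 2 ga(1) ga(1), of _ "h a" "-1" 0]) (simp add: algebra_simps power2_eq_square)
        then have "chi (h a) * chi (h b) = -1" using chi_cong[of "h a * h b" "-1"] Legendre_m1 by (simp add: chi_mult)
        then show ?thesis using ga(2,3) gb(2,3) chi_cases by fastforce
      qed
    qed
  qed
  then show ?thesis using eq_of_coordinates[OF _ _ par] a b by (simp add: X_def solves_def)
qed

section \<open>The permutation is almost perfect nonlinear\<close>

lemma card_solutions_le:
  assumes "u \<in> Zmod (2 * p)" "u \<noteq> 0"
  shows "card {z. solves c u v z} \<le> 2"
proof (rule ccontr)
  assume "\<not> card {z. solves c u v z} \<le> 2"
  then have "Suc (Suc (Suc 0)) \<le> card {z. solves c u v z}" by simp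
  then obtain z1 z2 z3 where sols: "solves c u v z1" "solves c u v z2" "solves c u v z3"
    and distinct: "z1 \<noteq> z2" "z1 \<noteq> z3" "z2 \<noteq> z3"
    by (auto simp: card_le_Suc_iff)
  show False
  proof (cases "even u")
    case True
    have "\<not> P dvd u"
    proof
      assume "P dvd u"
      then have "int (2 * p) dvd u" using True dvd_2P_iff by blast
      then show False using assms zdvd_imp_le[of "int (2 * p)" u] by (auto simp: Zmod_def)
    qed
    then show False using even_shift_no_three[OF sols True] distinct by blast
  next
    case False
    then show False using odd_shift_unique sols distinct by blast
  qed
qed

text \<open>If \<open>X\<close> is nonzero, equal values of \<open>Y\<close> leave \<open>X\<close> and \<open>- X\<close> with opposite parities as the only
candidates besides equality, and \<open>\<chi>(-1) = -1\<close> gives these different bits \<open>R\<close>. If \<open>X\<close> is \<open>0\<close>, the bit \<open>R\<close> is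
the parity.\<close>

lemma B_map_bij: "bij_betw (B_map (-1) c p) (Zmod (2 * p)) (Zmod (2 * p))"
proof -
  have "inj_on (B_map (-1) c p) (Zmod (2 * p))"
  proof (rule inj_onI)
    fix z w assume zw: "z \<in> Zmod (2 * p)" "w \<in> Zmod (2 * p)" and eq: "B_map (-1) c p z = B_map (-1) c p w"
    define x y where "x = X_res c p z" and "y = X_res c p w"
    have Y: "P dvd Y_res (-1) c p z - Y_res (-1) c p w"
      by (rule dvd_combination3[OF B_dvd_P[of c z] B_dvd_P[of c w] B_dvd_P[of c w], of _ "-1" 1 0]) (simp add: eq)
    have R: "odd (R_bit c p z) \<longleftrightarrow> odd (R_bit c p w)" using eq B_odd_iff by metis
    have iff: "P dvd x \<longleftrightarrow> P dvd y" using P_dvd_cong[OF Y] Y_dvd_iff by (simp add: x_def y_def)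
    have "(even z \<longleftrightarrow> even w) \<and> P dvd x - y"
    proof (cases "P dvd x")
      case True
      then show ?thesis using iff R R_odd_iff[of c z] R_odd_iff[of c w] by (simp add: x_def y_def)
    next
      case False
      then have nz: "\<not> P dvd x" "\<not> P dvd y" using iff by auto
      have "P dvd parity_sign z * y - parity_sign w * x"
      proof -
        have "P dvd (- y) * (Y_res (-1) c p z * x - parity_sign z) + x * (Y_res (-1) c p w * y - parity_sign w)
            + (x * y) * (Y_res (-1) c p z - Y_res (-1) c p w)"
          unfolding x_def y_def using nz
          by (intro dvd_combination3[OF Y_inverse[of c z] Y_inverse[of c w] Y refl]) (simp_all add: x_def y_def)
        also have "\<dots> = parity_sign z * y - parity_sign w * x" by (simp add: algebra_simps)
        finally show ?thesis .
      qed
      moreover have "chi x = 1 \<longleftrightarrow> chi y = 1"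
        using R R_odd_iff[of c z] R_odd_iff[of c w] nz by (simp add: x_def y_def)
      then have "chi x = chi y" using chi_cases nz by metis
      then have "\<not> P dvd x + y" using chi_cong[of x "- y"] chi_minus[of y] chi_cases[OF nz(1)] by auto
      ultimately show ?thesis
        using parity_sign_cases[of z] parity_sign_cases[of w] by (auto simp: dvd_diff_commute add.commute)
    qed
    then show "z = w" unfolding x_def y_def using eq_of_coordinates[OF zw] by blast
  qed
  moreover have "B_map (-1) c p ` Zmod (2 * p) \<subseteq> Zmod (2 * p)"
    using p_gt_3 by (auto simp: B_map_def Zmod_def)
  moreover have "finite (Zmod (2 * p))" by (simp add: Zmod_def)
  ultimately show ?thesis by (simp add: bij_betw_def endo_inj_surj)
qed

lemma B_dvd_diff_iff:
  "int (2 * p) dvd B_map (-1) c p a - B_map (-1) c p b - (B_map (-1) c p d - B_map (-1) c p e) \<longleftrightarrow>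
    P dvd Y_res (-1) c p a - Y_res (-1) c p b - (Y_res (-1) c p d - Y_res (-1) c p e) \<and>
    ((odd (R_bit c p a) \<noteq> odd (R_bit c p b)) = (odd (R_bit c p d) \<noteq> odd (R_bit c p e)))"
proof -
  let ?B = "B_map (-1) c p" and ?Y = "Y_res (-1) c p"
  have "P dvd 1 * (?B a - ?Y a) + (-1) * (?B b - ?Y b) + (-1) * (?B d - ?Y d) + 1 * (?B e - ?Y e)"
    by (rule dvd_combination4[OF B_dvd_P B_dvd_P B_dvd_P B_dvd_P refl])
  then have "P dvd (?B a - ?B b - (?B d - ?B e)) - (?Y a - ?Y b - (?Y d - ?Y e))" by (simp add: algebra_simps)
  from P_dvd_cong[OF this] show ?thesis
    unfolding dvd_2P_iff using B_odd_iff[of c a] B_odd_iff[of c b] B_odd_iff[of c d] B_odd_iff[of c e] by auto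
qed

text \<open>For \<open>u = p + 1\<close> the even elements with \<open>X = 1\<close> and \<open>X = - 2\<close> have the same difference: both
\<open>1 / 2 - 1 / 1\<close> and \<open>1 / (-1) - 1 / (-2)\<close> are \<open>- 1 / 2\<close>, and the bits agree since \<open>\<chi>(-1) = -1\<close>.\<close>

lemma two_solutions:
  obtains u v where "u \<in> Zmod (2 * p)" "u \<noteq> 0" "v \<in> Zmod (2 * p)" "2 \<le> card {z. solves c u v z}"
proof -
  let ?n = "int (2 * p)" and ?B = "B_map (-1) c p" and ?Y = "Y_res (-1) c p" and ?X = "X_res c p"
  define u z1 z2 v where "u = P + 1" and "z1 = P + 1" and "z2 = 2 * P - 2" and "v = (?B 2 - ?B (P + 1)) mod ?n"
  have P: "3 < P" "odd P" using p_gt_3 odd_p by simp_all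
  have shift1: "(z1 + u) mod ?n = 2" using P by (simp add: z1_def u_def mod_eq_dvd_iff algebra_simps)
  have shift2: "(z2 + u) mod ?n = P - 1"
  proof -
    have "z2 + u = (P - 1) + ?n" by (simp add: z2_def u_def)
    then show ?thesis using P by (simp only: mod_add_self2) simp
  qed
  have X: "?X 2 = 2" "?X (P + 1) = 1" using P by (simp_all add: X_res_def parity_bit_def)
  have par: "(P - 1) mod 2 = 0" "(2 * P - 2) mod 2 = 0" using P by presburger+
  have X': "P dvd ?X (P - 1) - (-1)" "P dvd ?X (2 * P - 2) - (-2)"
    by (rule dvd_combination3[OF X_dvd[of c "P - 1"] dvd_refl dvd_refl, of _ 1 1 0], simp add: par)
      (rule dvd_combination3[OF X_dvd[of c "2 * P - 2"] dvd_refl dvd_refl, of _ 1 2 0], simp add: par)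
  have parity_sign: "parity_sign 2 = 1" "parity_sign (P + 1) = 1" "parity_sign (P - 1) = 1" "parity_sign (2 * P - 2) = 1"
    using parity_sign_cases[of 2] parity_sign_cases[of "P + 1"] parity_sign_cases[of "P - 1"] parity_sign_cases[of "2 * P - 2"] P by auto
  have nz: "\<not> P dvd ?X 2" "\<not> P dvd ?X (P + 1)" "\<not> P dvd ?X (P - 1)" "\<not> P dvd ?X (2 * P - 2)"
    using P_dvd_cong[OF X'(1)] P_dvd_cong[OF X'(2)] X P_not_dvd_1 P_not_dvd_2 by simp_all
  have Y1: "P dvd ?Y (P + 1) - 1" using Y_inverse[OF nz(2)] X parity_sign by simp
  have Y2: "P dvd ?Y 2 * 2 - 1" using Y_inverse[OF nz(1)] X parity_sign by simp
  have Y3: "P dvd ?Y (P - 1) + 1"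
    by (rule dvd_combination3[OF Y_inverse[OF nz(3)] X'(1) X'(1), of _ "-1" "?Y (P - 1)" 0])
      (simp add: parity_sign algebra_simps)
  have Y4: "P dvd 2 * ?Y (2 * P - 2) + 1"
    by (rule dvd_combination3[OF Y_inverse[OF nz(4)] X'(2) X'(2), of _ "-1" "?Y (2 * P - 2)" 0])
      (simp only: parity_sign, simp add: distrib_left)
  have "P dvd 2 * (?Y (P - 1) - ?Y (2 * P - 2) - (?Y 2 - ?Y (P + 1)))"
  proof -
    have "P dvd 2 * (?Y (P - 1) + 1) + (-1) * (2 * ?Y (2 * P - 2) + 1) + (-1) * (?Y 2 * 2 - 1) + 2 * (?Y (P + 1) - 1)"
      by (rule dvd_combination4[OF Y3 Y4 Y2 Y1 refl])
    then show ?thesis by (simp add: algebra_simps)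
  qed
  then have Y: "P dvd ?Y (P - 1) - ?Y (2 * P - 2) - (?Y 2 - ?Y (P + 1))" using P_dvd_double by blast
  have "chi 1 = 1" using chi_square[OF P_not_dvd_1] by simp
  moreover have "chi (?X (P - 1)) = -1" "chi (?X (2 * P - 2)) = - chi 2"
    using chi_cong[OF X'(1)] chi_cong[OF X'(2)] chi_minus[of 2] Legendre_m1 by simp_all
  ultimately have R: "(odd (R_bit c p (P - 1)) \<noteq> odd (R_bit c p (2 * P - 2)))
      = (odd (R_bit c p 2) \<noteq> odd (R_bit c p (P + 1)))"
    using R_odd_iff[of c] nz X chi_cases[OF P_not_dvd_2] by auto
  have "?n dvd ?B (P - 1) - ?B (2 * P - 2) - (?B 2 - ?B (P + 1))" using B_dvd_diff_iff Y R by blast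
  then have "(?B (P - 1) - ?B (2 * P - 2)) mod ?n = v" unfolding v_def by (simp only: mod_eq_dvd_iff)
  then have "solves c u v z1" "solves c u v z2"
    unfolding solves_def shift1 shift2 using P by (auto simp: Zmod_def z1_def z2_def v_def)
  moreover have "z1 \<noteq> z2" using P by (simp add: z1_def z2_def)
  moreover have "finite {z. solves c u v z}"
    by (rule finite_subset[of _ "Zmod (2 * p)"]) (auto simp: solves_def Zmod_def)
  ultimately have "card {z1, z2} \<le> card {z. solves c u v z}" by (intro card_mono) auto
  then have "2 \<le> card {z. solves c u v z}" using \<open>z1 \<noteq> z2\<close> by simp
  moreover have "u \<in> Zmod (2 * p)" "u \<noteq> 0" "v \<in> Zmod (2 * p)" using P by (auto simp: Zmod_def u_def v_def)
  ultimately show ?thesis using that by blast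
qed

theorem B_map_APN: "APN (2 * p) (B_map (-1) c p)"
proof -
  let ?F = "B_map (-1) c p" and ?Z = "Zmod (2 * p)"
  let ?counts = "{card {x \<in> ?Z. (?F ((x + u) mod int (2 * p)) - ?F x) mod int (2 * p) = v} | u v.
            u \<in> ?Z \<and> u \<noteq> 0 \<and> v \<in> ?Z}"
  have solves: "{x \<in> ?Z. (?F ((x + u) mod int (2 * p)) - ?F x) mod int (2 * p) = v} = {z. solves c u v z}" for u v
    by (simp add: solves_def)
  have le: "k \<le> 2" if "k \<in> ?counts" for k
    using that card_solutions_le unfolding solves by blast
  then have "finite ?counts" by (meson finite_nat_set_iff_bounded_le)
  moreover obtain u v where uv: "u \<in> ?Z" "u \<noteq> 0" "v \<in> ?Z" "2 \<le> card {z. solves c u v z}"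
    by (rule two_solutions)
  moreover have "card {z. solves c u v z} = 2" using card_solutions_le[OF uv(1,2)] uv(4) by (intro antisym)
  then have "2 \<in> ?counts" unfolding solves using uv by (metis (mono_tags, lifting) mem_Collect_eq)
  ultimately show ?thesis unfolding APN_def differential_uniformity_def using le by (intro Max_eqI)
qed

end

section \<open>Numbers that are not prime powers\<close>

lemma not_primepow_if_exact_divisor:
  fixes q k :: nat
  assumes "prime q" "0 < k"
  shows "\<not> primepow (q\<^sup>2 * k + q)"
proof
  assume "primepow (q\<^sup>2 * k + q)"
  then obtain r j where r: "prime r" "0 < j" "q\<^sup>2 * k + q = r ^ j" by (auto simp: primepow_def)
  have "q dvd q\<^sup>2 * k + q" by (simp add: power2_eq_square)
  then have "q dvd r" using r assms(1) prime_dvd_power by metis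
  then have "q = r" using r(1) assms(1) primes_dvd_imp_eq by blast
  moreover have "j \<noteq> 1" using r(3) assms \<open>q = r\<close> by (auto simp: prime_gt_0_nat)
  ultimately have "q\<^sup>2 dvd q ^ j" using r(2) by (intro le_imp_power_dvd) simp
  then have "q\<^sup>2 dvd q\<^sup>2 * k + q" using r(3) \<open>q = r\<close> by metis
  then have "q\<^sup>2 dvd q" by (simp add: dvd_add_right_iff)
  then have "q * q \<le> q" using assms(1) by (auto simp: power2_eq_square prime_gt_0_nat dest: dvd_imp_le)
  then show False using prime_gt_1_nat[OF assms(1)] by simp
qed

lemma not_primepow_if_two_prime_divisors:
  fixes q s m :: nat
  assumes "prime q" "prime s" "q \<noteq> s" "q dvd m" "s dvd m"
  shows "\<not> primepow m"
proof
  assume "primepow m"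
  then obtain r k where "prime r" "0 < k" "m = r ^ k" by (auto simp: primepow_def)
  then show False using assms prime_dvd_power primes_dvd_imp_eq by metis
qed

lemma Legendre_minus_one:
  assumes "prime p" "[p = 3] (mod 4)"
  shows "Legendre (-1) (int p) = -1"
proof -
  have "p mod 4 = 3" using assms(2) by (simp add: cong_def)
  then have "2 < p" "odd ((p - 1) div 2)" by presburger+
  then have "[Legendre (-1) (int p) = -1] (mod int p)"
    using euler_criterion[OF assms(1), of "-1"] by simp
  then have "int p dvd Legendre (-1) (int p) - (-1)" by (simp add: cong_iff_dvd_diff)
  then show ?thesis using zdvd_imp_le[of "int p" 2] \<open>2 < p\<close> by (auto simp: Legendre_def split: if_splits)
qed

lemma Legendre_2_mod_3: "[p = 2] (mod 3) \<Longrightarrow> Legendre (int p) 3 = -1"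
proof -
  assume "[p = 2] (mod 3)"
  then have p: "int p mod 3 = 2" by (simp add: cong_def) presburger
  have "\<not> [y\<^sup>2 = int p] (mod 3)" for y :: int
  proof -
    have "y mod 3 = 0 \<or> y mod 3 = 1 \<or> y mod 3 = 2" by presburger
    then have "(y mod 3)\<^sup>2 mod 3 \<noteq> 2" by auto
    then show ?thesis using p by (simp add: cong_def power_mod)
  qed
  then show ?thesis using p by (simp add: Legendre_def QuadRes_def cong_def)
qed

lemma Legendre_2_mod_5: "[p = 2] (mod 5) \<Longrightarrow> Legendre (int p) 5 = -1"
proof -
  assume "[p = 2] (mod 5)"
  then have p: "int p mod 5 = 2" by (simp add: cong_def) presburger
  have "\<not> [y\<^sup>2 = int p] (mod 5)" for y :: int
  proof -
    have "y mod 5 = 0 \<or> y mod 5 = 1 \<or> y mod 5 = 2 \<or> y mod 5 = 3 \<or> y mod 5 = 4" by presburger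
    then have "(y mod 5)\<^sup>2 mod 5 \<noteq> 2" by auto
    then show ?thesis using p by (simp add: cong_def power_mod)
  qed
  then show ?thesis using p by (simp add: Legendre_def QuadRes_def cong_def)
qed

text \<open>The residue modulo \<open>4\<close> gives \<open>\<chi>(-1)\<close>. By quadratic reciprocity, \<open>\<chi>(3)\<close> and \<open>\<chi>(5)\<close> follow from the fact
that \<open>2\<close> is a nonsquare modulo \<open>3\<close> and modulo \<open>5\<close>; the reciprocity sign is \<open>-1\<close> for \<open>3\<close> and \<open>1\<close> for \<open>5\<close>.\<close>

lemma apn_prime_if_cong:
  assumes "prime p" "5 < p" "[p = 3] (mod 4)" "[p = 2] (mod 3)" "[p = 2] (mod 5)"
  shows "apn_prime p"
proof
  show "prime p" "3 < p" using assms by auto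
  show m1: "Legendre (-1) (int p) = -1" by (rule Legendre_minus_one[OF assms(1,3)])
  have odd: "odd ((p - 1) div 2)" using assms(3) by (simp add: cong_def) presburger
  have "Legendre (int p) (int 3) * Legendre (int 3) (int p) = (-1) ^ ((p - 1) div 2 * ((3 - 1) div 2))"
    by (rule Quadratic_Reciprocity) (use assms in auto)
  then have "Legendre 3 (int p) = 1" using Legendre_2_mod_3[OF assms(4)] odd by simp
  moreover have "Legendre (-1 * 3) (int p) = Legendre (-1) (int p) * Legendre 3 (int p)"
    by (rule Legendre_mult) (use assms in auto)
  ultimately show "Legendre (-3) (int p) = -1" using m1 by simp
  have "prime (5::nat)" by simp
  then have "Legendre (int p) (int 5) * Legendre (int 5) (int p) = (-1) ^ ((p - 1) div 2 * ((5 - 1) div 2))"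
    by (intro Quadratic_Reciprocity) (use assms in auto)
  then show "Legendre 5 (int p) = -1" using Legendre_2_mod_5[OF assms(5)] by simp
qed

lemma progression_element:
  assumes "prime p" "[p = 11027] (mod 44100)"
  obtains t where "p = 11027 + 44100 * t" "apn_prime p"
proof -
  have "p mod 44100 = 11027" using assms(2) by (simp add: cong_def)
  then obtain t where t: "p = 11027 + 44100 * t" by (metis add.commute mult_div_mod_eq)
  have "p = 3 + 4 * (2756 + 11025 * t)" "p = 2 + 3 * (3675 + 14700 * t)" "p = 2 + 5 * (2205 + 8820 * t)"
    using t by simp_all
  then have "[p = 3] (mod 4)" "[p = 2] (mod 3)" "[p = 2] (mod 5)"
    unfolding cong_def by (metis mod_mult_self2)+
  then have "apn_prime p" using t by (intro apn_prime_if_cong[OF assms(1)]) auto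
  then show ?thesis using that t by blast
qed

lemma neighbours_not_primepow:
  fixes t :: nat
  assumes "p = 11027 + 44100 * t" "m \<in> {2 * p - 1, 2 * p + 1, 2 * p + 2, 2 * p + 3, 2 * p + 4}"
  shows "\<not> primepow m"
proof -
  have primes: "prime (2::nat)" "prime (3::nat)" "prime (5::nat)" "prime (7::nat)"
    by simp_all
  consider "m = 3\<^sup>2 * (2450 + 9800 * t) + 3" | "m = 5\<^sup>2 * (882 + 3528 * t) + 5" | "m = 6 * (3676 + 14700 * t)"
    | "m = 7\<^sup>2 * (450 + 1800 * t) + 7" | "m = 2\<^sup>2 * (5514 + 22050 * t) + 2"
    using assms by auto
  then show ?thesis
  proof cases
    case 3
    then have "2 dvd m" "3 dvd m" by (auto intro: dvd_mult2)
    then show ?thesis by (intro not_primepow_if_two_prime_divisors[OF primes(1,2)]) auto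
  qed (simp_all only: not_primepow_if_exact_divisor primes add_pos_nonneg zero_less_numeral zero_le not_False_eq_True)
qed

theorem theorem8:
  shows "infinite {p::nat. prime p \<and> [p = 11027] (mod 44100)} \<and>
    (\<forall>p n :: nat. prime p \<longrightarrow> [p = 11027] (mod 44100) \<longrightarrow> n = 2 * p \<longrightarrow>
       (\<forall>m \<in> {n - 1, n + 1, n + 2, n + 3, n + 4}. \<not> primepow m) \<and>
       (\<forall>c \<in> Zmod p. bij_betw (B_map (-1) c p) (Zmod n) (Zmod n) \<and> APN n (B_map (-1) c p)) \<and>
       (\<nexists>r::nat. primepow r \<and> n = r + 1) \<and>
       (\<nexists>(r::nat) (j::nat). primepow r \<and> 1 \<le> j \<and> j \<le> 4 \<and> int n = int r - int j))"
proof (intro conjI allI impI)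
  have "coprime (11027::nat) 44100" by (simp add: coprime_iff_gcd_eq_1 gcd_non_0_nat)
  then show "infinite {p::nat. prime p \<and> [p = 11027] (mod 44100)}"
    by (intro dirichlet_primes_in_progression) auto
next
  fix p n :: nat
  assume p: "prime p" "[p = 11027] (mod 44100)" and n: "n = 2 * p"
  obtain t where t: "p = 11027 + 44100 * t" and "apn_prime p" using progression_element[OF p] .
  interpret apn_prime p by fact
  show no_primepow: "\<forall>m \<in> {n - 1, n + 1, n + 2, n + 3, n + 4}. \<not> primepow m"
    unfolding n using neighbours_not_primepow[OF t] by blast
  show "\<forall>c \<in> Zmod p. bij_betw (B_map (-1) c p) (Zmod n) (Zmod n) \<and> APN n (B_map (-1) c p)"
    unfolding n using B_map_bij B_map_APN by blast
  show "\<nexists>r::nat. primepow r \<and> n = r + 1" using no_primepow by auto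
  show "\<nexists>(r::nat) (j::nat). primepow r \<and> 1 \<le> j \<and> j \<le> 4 \<and> int n = int r - int j"
  proof clarify
    fix r j :: nat
    assume r: "primepow r" "1 \<le> j" "j \<le> 4" "int n = int r - int j"
    then have "r = n + j" by simp
    moreover have "j = 1 \<or> j = 2 \<or> j = 3 \<or> j = 4" using r by auto
    ultimately show False using no_primepow r(1) by auto
  qed
qed

end
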